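(* Let $\Phi$ be a Banach function space over $(\mathbb{R},dt)$ such that the Hardy–Littlewood maximal operator $M$ is bounded on $\Phi$ and on its (Köthe) dual $\Phi'$. (i) Let $X$ be a Banach space. Then for every $p\in(1,\infty)$ $$\Phi(X)\subset \bigcup_{w\in A_p} L^p_w(X).$$ (ii) Let $X$ and $Y$ be Banach spaces and $p\in(1,\infty)$. Let $\{T_j\}_{j\in J}$ be a family of linear operators $T_j:\mathcal{S}(X)\to\mathcal{S}'(Y)$ such that for every $\mathcal{W}\subset A_p$ with $\sup_{w\in\mathcal{W}}[w]_{A_p}<\infty$ $$\sup_{w\in\mathcal{W}}\ \sup_{j\in J}\ \|T_j\|_{\mathcal{L}(L^p_w(X),L^p_w(Y))}<\infty .$$ Then each $T_j$ extends to a linear operator $\mathcal{T}_j$ defined on $\bigcup_{w\in A_p}L^p_w(X)$, which is a linear subspace of $L^1_{loc}(X)$, and $\mathcal{T}_j$ restricts to an operator in $\mathcal{L}(\Phi(X),\Phi(Y))$. Moreover, $$\sup_{j\in J}\|\mathcal{T}_j\|_{\mathcal{L}(\Phi(X),\Phi(Y))}<\infty .$$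
   Context: $L^0$ is the space of (a.e. classes of) complex measurable functions on $\mathbb{R}$. A Banach function space $\Phi$ over $(\mathbb{R},dt)$ is a (nonzero) Banach space which is an order ideal of $L^0$ (if $f\in L^0$, $g\in\Phi$ and $|f|\le|g|$ a.e., then $f\in\Phi$ and $\|f\|_\Phi\le\|g\|_\Phi$) and has the Fatou property. Its Köthe dual is $\Phi'=\{g\in L^0:\ \|g\|_{\Phi'}:=\sup\{\int_{\mathbb{R}}|fg|\,dt:\ \|f\|_\Phi\le 1\}<\infty\}$, and $(\Phi')'=\Phi$ with equal norms (Lorentz–Luxemburg). $M$ is the Hardy–Littlewood maximal operator on $\mathbb{R}$; "$M$ is bounded on $\Phi$" means $\|Mg\|_\Phi\le C\|g\|_\Phi$ for all $g\in\Phi$, with some constant $C$. For a Banach space $X$ with norm $|\cdot|_X$, $\Phi(X)$ is the space of strongly measurable $f:\mathbb{R}\to X$ with $|f|_X\in\Phi$, normed by $\|f\|_{\Phi(X)}=\||f|_X\|_\Phi$. $A_p$ is the Muckenhoupt class of weights on $\mathbb{R}$, with constant $[w]_{A_p}=\sup_Q\left(\frac1{|Q|}\int_Q w\right)\left(\frac1{|Q|}\int_Q w^{1-p'}\right)^{p-1}$ (supremum over bounded intervals $Q$, $1/p+1/p'=1$), and $L^p_w(X)=L^p(\mathbb{R},w\,dt;X)$. $\mathcal{S}(X)=\mathcal{S}(\mathbb{R};X)$ is the $X$-valued Schwartz space and $\mathcal{S}'(X)$ is the space of $X$-valued tempered distributions on $\mathbb{R}$. For a linear $T:\mathcal{S}(X)\to\mathcal{S}'(Y)$,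 finiteness of $\|T\|_{\mathcal{L}(L^p_w(X),L^p_w(Y))}$ means that $Tf\in L^p_w(Y)$ for $f\in\mathcal{S}(X)$ and that $\sup\{\|Tf\|_{L^p_w(Y)}: f\in\mathcal{S}(X),\ \|f\|_{L^p_w(X)}\le 1\}$ is finite; this supremum is the norm. *)

theory Defs
  imports "HOL-Analysis.Analysis"
begin

class complex_banach = banach +
  fixes scaleC :: "complex \<Rightarrow> 'a \<Rightarrow> 'a"
  assumes scaleC_add_right: "scaleC c (x + y) = scaleC c x + scaleC c y"
    and scaleC_add_left: "scaleC (c + d) x = scaleC c x + scaleC d x"
    and scaleC_scaleC: "scaleC c (scaleC d x) = scaleC (c * d) x"
    and scaleC_of_real: "scaleC (complex_of_real r) x = r *\<^sub>R x"
    and norm_scaleC: "norm (scaleC c x) = cmod c * norm x"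

instantiation complex :: complex_banach
begin

definition scaleC_complex :: "complex \<Rightarrow> complex \<Rightarrow> complex" where
  "scaleC_complex c z = c * z"

instance
  by standard (auto simp: scaleC_complex_def algebra_simps norm_mult scaleR_conv_of_real)

end

text \<open>
  Elements of spaces of a.e. classes are represented by functions; the spaces and norms
  used for this purpose are invariant under changes on \<^const>\<open>lebesgue\<close> null sets.
\<close>

definition fun_subspace :: "(real \<Rightarrow> 'x::complex_banach) set \<Rightarrow> bool" where
  "fun_subspace V \<longleftrightarrow>
     (\<lambda>t. 0) \<in> V \<and>
     (\<forall>f\<in>V. \<forall>g\<in>V. (\<lambda>t. f t + g t) \<in> V) \<and>
     (\<forall>c. \<forall>f\<in>V. (\<lambda>t. scaleC c (f t)) \<in> V)"

text \<open>A linear operator between spaces of a.e. classes, acting on representatives.\<close>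

definition linear_operator ::
    "(real \<Rightarrow> 'x::complex_banach) set \<Rightarrow> (real \<Rightarrow> 'y::complex_banach) set
     \<Rightarrow> ((real \<Rightarrow> 'x) \<Rightarrow> (real \<Rightarrow> 'y)) \<Rightarrow> bool" where
  "linear_operator V W L \<longleftrightarrow>
     (\<forall>f\<in>V. L f \<in> W) \<and>
     (\<forall>f\<in>V. \<forall>g\<in>V. (AE t in lebesgue. f t = g t) \<longrightarrow> (AE t in lebesgue. L f t = L g t)) \<and>
     (\<forall>f\<in>V. \<forall>g\<in>V. AE t in lebesgue. L (\<lambda>s. f s + g s) t = L f t + L g t) \<and>
     (\<forall>c. \<forall>f\<in>V. AE t in lebesgue. L (\<lambda>s. scaleC c (f s)) t = scaleC c (L f t))"

text \<open>
  Strong (Bochner) measurability.  For nonseparable \<open>'x\<close> this is stronger than membership in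
  \<^term>\<open>borel_measurable lebesgue\<close>.
\<close>

definition strongly_measurable :: "(real \<Rightarrow> 'x::real_normed_vector) \<Rightarrow> bool" where
  "strongly_measurable f \<longleftrightarrow>
     (\<exists>s :: nat \<Rightarrow> real \<Rightarrow> 'x. (\<forall>n. simple_function lebesgue (s n)) \<and>
        (AE t in lebesgue. (\<lambda>n. s n t) \<longlonglongrightarrow> f t))"

definition L1_loc :: "(real \<Rightarrow> 'x::real_normed_vector) set" where
  "L1_loc =
     {f. strongly_measurable f \<and>
         (\<forall>a b. (\<integral>\<^sup>+t\<in>{a..b}. ennreal (norm (f t)) \<partial>lebesgue) < \<infinity>)}"

text \<open>
  The library's \<open>has_bochner_integral\<close> is restricted to second countable spaces; this is its
  definition with Borel measurability replaced by strong measurability.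
\<close>

definition has_strong_integral :: "(real \<Rightarrow> 'x::real_normed_vector) \<Rightarrow> 'x \<Rightarrow> bool" where
  "has_strong_integral f I \<longleftrightarrow>
     strongly_measurable f \<and>
     (\<exists>s :: nat \<Rightarrow> real \<Rightarrow> 'x.
        (\<forall>i. Bochner_Integration.simple_bochner_integrable lebesgue (s i)) \<and>
        (\<lambda>i. \<integral>\<^sup>+t. ennreal (norm (f t - s i t)) \<partial>lebesgue) \<longlonglongrightarrow> 0 \<and>
        (\<lambda>i. Bochner_Integration.simple_bochner_integral lebesgue (s i)) \<longlonglongrightarrow> I)"

locale banach_function_space =
  fixes \<Phi> :: "(real \<Rightarrow> complex) set" and N :: "(real \<Rightarrow> complex) \<Rightarrow> real"
  assumes measurable: "\<Phi> \<subseteq> borel_measurable lebesgue"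
    and subspace: "fun_subspace \<Phi>"
    and nonzero: "\<exists>f\<in>\<Phi>. \<not> (AE t in lebesgue. f t = 0)"
    and norm_nonneg: "f \<in> \<Phi> \<Longrightarrow> 0 \<le> N f"
    and norm_eq_0: "f \<in> \<Phi> \<Longrightarrow> N f = 0 \<longleftrightarrow> (AE t in lebesgue. f t = 0)"
    and norm_scale: "f \<in> \<Phi> \<Longrightarrow> N (\<lambda>t. c * f t) = cmod c * N f"
    and norm_triangle: "f \<in> \<Phi> \<Longrightarrow> g \<in> \<Phi> \<Longrightarrow> N (\<lambda>t. f t + g t) \<le> N f + N g"
    and complete:
      "(\<And>n::nat. F n \<in> \<Phi>) \<Longrightarrow>
       (\<And>e. e > 0 \<Longrightarrow> \<exists>k. \<forall>m\<ge>k. \<forall>n\<ge>k. N (\<lambda>t. F m t - F n t) < e) \<Longrightarrow>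
       \<exists>f\<in>\<Phi>. (\<lambda>n. N (\<lambda>t. F n t - f t)) \<longlonglongrightarrow> 0"
    and ideal:
      "f \<in> borel_measurable lebesgue \<Longrightarrow> g \<in> \<Phi> \<Longrightarrow>
       (AE t in lebesgue. cmod (f t) \<le> cmod (g t)) \<Longrightarrow> f \<in> \<Phi> \<and> N f \<le> N g"
    and fatou:
      "(\<And>n::nat. (\<lambda>t. complex_of_real (G n t)) \<in> \<Phi>) \<Longrightarrow>
       (AE t in lebesgue. (\<forall>n. 0 \<le> G n t \<and> G n t \<le> G (Suc n) t) \<and> (\<lambda>n. G n t) \<longlonglongrightarrow> h t) \<Longrightarrow>
       h \<in> borel_measurable lebesgue \<Longrightarrow>
       bdd_above (range (\<lambda>n. N (\<lambda>t. complex_of_real (G n t)))) \<Longrightarrow>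
       (\<lambda>t. complex_of_real (h t)) \<in> \<Phi> \<and>
       N (\<lambda>t. complex_of_real (h t)) = (SUP n. N (\<lambda>t. complex_of_real (G n t)))"

definition kothe_ennnorm ::
    "(real \<Rightarrow> complex) set \<Rightarrow> ((real \<Rightarrow> complex) \<Rightarrow> real) \<Rightarrow> (real \<Rightarrow> complex) \<Rightarrow> ennreal" where
  "kothe_ennnorm \<Phi> N g =
     (SUP f\<in>{f\<in>\<Phi>. N f \<le> 1}. \<integral>\<^sup>+t. ennreal (cmod (f t * g t)) \<partial>lebesgue)"

definition kothe_dual ::
    "(real \<Rightarrow> complex) set \<Rightarrow> ((real \<Rightarrow> complex) \<Rightarrow> real) \<Rightarrow> (real \<Rightarrow> complex) set" where
  "kothe_dual \<Phi> N = {g \<in> borel_measurable lebesgue. kothe_ennnorm \<Phi> N g < \<infinity>}"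

definition kothe_norm ::
    "(real \<Rightarrow> complex) set \<Rightarrow> ((real \<Rightarrow> complex) \<Rightarrow> real) \<Rightarrow> (real \<Rightarrow> complex) \<Rightarrow> real" where
  "kothe_norm \<Phi> N g = enn2real (kothe_ennnorm \<Phi> N g)"

text \<open>
  The uncentred Hardy--Littlewood maximal function.  Every bounded interval has the same averages
  as its closure, so closed intervals suffice.
\<close>

definition maximal_function :: "(real \<Rightarrow> complex) \<Rightarrow> real \<Rightarrow> ennreal" where
  "maximal_function g t =
     (SUP (a, b)\<in>{(a, b). a < b \<and> a \<le> t \<and> t \<le> b}.
        (\<integral>\<^sup>+s\<in>{a..b}. ennreal (cmod (g s)) \<partial>lebesgue) / ennreal (b - a))"

text \<open>
  The finiteness requirement is needed because \<^const>\<open>enn2real\<close> sends \<open>\<infinity>\<close> to \<open>0\<close>.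
\<close>

definition maximal_bounded_on ::
    "(real \<Rightarrow> complex) set \<Rightarrow> ((real \<Rightarrow> complex) \<Rightarrow> real) \<Rightarrow> bool" where
  "maximal_bounded_on \<Phi> N \<longleftrightarrow>
     (\<exists>C. \<forall>g\<in>\<Phi>.
        (AE t in lebesgue. maximal_function g t < \<infinity>) \<and>
        (\<lambda>t. complex_of_real (enn2real (maximal_function g t))) \<in> \<Phi> \<and>
        N (\<lambda>t. complex_of_real (enn2real (maximal_function g t))) \<le> C * N g)"

definition vector_valued ::
    "(real \<Rightarrow> complex) set \<Rightarrow> (real \<Rightarrow> 'x::real_normed_vector) set" where
  "vector_valued \<Phi> = {f. strongly_measurable f \<and> (\<lambda>t. complex_of_real (norm (f t))) \<in> \<Phi>}"

definition vector_norm ::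
    "((real \<Rightarrow> complex) \<Rightarrow> real) \<Rightarrow> (real \<Rightarrow> 'x::real_normed_vector) \<Rightarrow> real" where
  "vector_norm N f = N (\<lambda>t. complex_of_real (norm (f t)))"

definition operator_norm ::
    "(real \<Rightarrow> complex) set \<Rightarrow> ((real \<Rightarrow> complex) \<Rightarrow> real) \<Rightarrow>
     ((real \<Rightarrow> 'x::complex_banach) \<Rightarrow> (real \<Rightarrow> 'y::complex_banach)) \<Rightarrow> ennreal" where
  "operator_norm \<Phi> N L =
     (SUP f\<in>{f \<in> vector_valued \<Phi>. vector_norm N f \<le> 1}. ennreal (vector_norm N (L f)))"

definition bounded_operators ::
    "(real \<Rightarrow> complex) set \<Rightarrow> ((real \<Rightarrow> complex) \<Rightarrow> real) \<Rightarrow>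
     ((real \<Rightarrow> 'x::complex_banach) \<Rightarrow> (real \<Rightarrow> 'y::complex_banach)) set" where
  "bounded_operators \<Phi> N =
     {L. linear_operator (vector_valued \<Phi>) (vector_valued \<Phi>) L \<and> operator_norm \<Phi> N L < \<infinity>}"

text \<open>Real powers of extended nonnegative reals; used for positive exponents only.\<close>

definition ennreal_powr :: "ennreal \<Rightarrow> real \<Rightarrow> ennreal" where
  "ennreal_powr x r = (if x = \<infinity> then \<infinity> else ennreal (enn2real x powr r))"

definition conj_exponent :: "real \<Rightarrow> real" where
  "conj_exponent p = p / (p - 1)"

definition weight :: "(real \<Rightarrow> real) \<Rightarrow> bool" where
  "weight w \<longleftrightarrow>
     w \<in> borel_measurable lebesgue \<and> (AE t in lebesgue. 0 < w t) \<and> w \<in> L1_loc"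

definition Ap_const :: "real \<Rightarrow> (real \<Rightarrow> real) \<Rightarrow> ennreal" where
  "Ap_const p w =
     (SUP (a, b)\<in>{(a, b). a < b}.
        ((\<integral>\<^sup>+t\<in>{a..b}. ennreal (w t) \<partial>lebesgue) / ennreal (b - a)) *
        ennreal_powr
          ((\<integral>\<^sup>+t\<in>{a..b}. ennreal (w t powr (1 - conj_exponent p)) \<partial>lebesgue) / ennreal (b - a))
          (p - 1))"

definition Ap :: "real \<Rightarrow> (real \<Rightarrow> real) set" where
  "Ap p = {w. weight w \<and> Ap_const p w < \<infinity>}"

definition Lpw_norm :: "real \<Rightarrow> (real \<Rightarrow> real) \<Rightarrow> (real \<Rightarrow> 'x::real_normed_vector) \<Rightarrow> ennreal" where
  "Lpw_norm p w f =
     ennreal_powr (\<integral>\<^sup>+t. ennreal (norm (f t) powr p) * ennreal (w t) \<partial>lebesgue) (1 / p)"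

definition Lpw :: "real \<Rightarrow> (real \<Rightarrow> real) \<Rightarrow> (real \<Rightarrow> 'x::real_normed_vector) set" where
  "Lpw p w = {f. strongly_measurable f \<and> Lpw_norm p w f < \<infinity>}"

definition nth_vderiv :: "nat \<Rightarrow> (real \<Rightarrow> 'x::real_normed_vector) \<Rightarrow> real \<Rightarrow> 'x" where
  "nth_vderiv n = (\<lambda>f t. vector_derivative f (at t)) ^^ n"

definition schwartz :: "(real \<Rightarrow> 'x::real_normed_vector) set" where
  "schwartz =
     {f. (\<forall>n t. nth_vderiv n f differentiable (at t)) \<and>
         (\<forall>m n. bdd_above (range (\<lambda>t. \<bar>t\<bar> ^ m * norm (nth_vderiv n f t))))}"

definition schwartz_seminorm :: "nat \<Rightarrow> nat \<Rightarrow> (real \<Rightarrow> 'x::real_normed_vector) \<Rightarrow> real" where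
  "schwartz_seminorm m n f = (SUP t. \<bar>t\<bar> ^ m * norm (nth_vderiv n f t))"

definition schwartz_topology :: "(real \<Rightarrow> 'x::real_normed_vector) topology" where
  "schwartz_topology = topology_generated_by
     {{g \<in> schwartz. schwartz_seminorm m n (\<lambda>t. g t - f t) < e} | f m n e.
        f \<in> schwartz \<and> 0 < e}"

text \<open>
  A tempered distribution is only relevant on \<^const>\<open>schwartz\<close>; its values at other functions
  are arbitrary.
\<close>

definition tempered_distributions :: "((real \<Rightarrow> complex) \<Rightarrow> 'y::complex_banach) set" where
  "tempered_distributions =
     {u. continuous_map schwartz_topology euclidean u \<and>
         (\<forall>\<phi>\<in>schwartz. \<forall>\<psi>\<in>schwartz. u (\<lambda>t. \<phi> t + \<psi> t) = u \<phi> + u \<psi>) \<and>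
         (\<forall>c. \<forall>\<phi>\<in>schwartz. u (\<lambda>t. c * \<phi> t) = scaleC c (u \<phi>))}"

definition schwartz_operator ::
    "((real \<Rightarrow> 'x::complex_banach) \<Rightarrow> (real \<Rightarrow> complex) \<Rightarrow> 'y::complex_banach) \<Rightarrow> bool" where
  "schwartz_operator T \<longleftrightarrow>
     (\<forall>f\<in>schwartz. T f \<in> tempered_distributions) \<and>
     (\<forall>f\<in>schwartz. \<forall>g\<in>schwartz. \<forall>\<phi>\<in>schwartz. T (\<lambda>t. f t + g t) \<phi> = T f \<phi> + T g \<phi>) \<and>
     (\<forall>c. \<forall>f\<in>schwartz. \<forall>\<phi>\<in>schwartz. T (\<lambda>t. scaleC c (f t)) \<phi> = scaleC c (T f \<phi>))"

definition represents ::
    "(real \<Rightarrow> 'y::complex_banach) \<Rightarrow> ((real \<Rightarrow> complex) \<Rightarrow> 'y) \<Rightarrow> bool" where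
  "represents g u \<longleftrightarrow>
     (\<forall>\<phi>\<in>schwartz. has_strong_integral (\<lambda>t. scaleC (\<phi> t) (g t)) (u \<phi>))"

text \<open>
  The representing function is unique a.e., so that the infimum is the norm of this function.
\<close>

definition Lpw_norm_distr ::
    "real \<Rightarrow> (real \<Rightarrow> real) \<Rightarrow> ((real \<Rightarrow> complex) \<Rightarrow> 'y::complex_banach) \<Rightarrow> ennreal" where
  "Lpw_norm_distr p w u = (INF g\<in>{g \<in> Lpw p w. represents g u}. Lpw_norm p w g)"

definition Lpw_operator_norm ::
    "real \<Rightarrow> (real \<Rightarrow> real) \<Rightarrow>
     ((real \<Rightarrow> 'x::complex_banach) \<Rightarrow> (real \<Rightarrow> complex) \<Rightarrow> 'y::complex_banach) \<Rightarrow> ennreal" where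
  "Lpw_operator_norm p w T =
     (if \<forall>f\<in>schwartz. \<exists>g\<in>Lpw p w. represents g (T f)
      then SUP f\<in>{f \<in> schwartz. Lpw_norm p w f \<le> 1}. Lpw_norm_distr p w (T f)
      else \<infinity>)"

definition extends_schwartz_operator ::
    "((real \<Rightarrow> 'x::complex_banach) \<Rightarrow> (real \<Rightarrow> complex) \<Rightarrow> 'y::complex_banach) \<Rightarrow>
     (real \<Rightarrow> 'x) set \<Rightarrow> ((real \<Rightarrow> 'x) \<Rightarrow> (real \<Rightarrow> 'y)) \<Rightarrow> bool" where
  "extends_schwartz_operator T V L \<longleftrightarrow>
     schwartz \<subseteq> V \<and> (\<forall>f\<in>schwartz. represents (L f) (T f))"

end

theory Submission
  imports Defs
begin

text \<open>
  Extrapolation by the Rubio de Francia algorithm.  For \<open>f\<close> in \<open>\<Phi>\<close> and \<open>h\<close> in the Koethe dual, summing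
  iterates of the maximal operator gives \<open>A\<^sub>1\<close> majorants \<open>v\<close> of \<open>f\<close> and \<open>u\<close> of \<open>h\<close> of comparable norm.
  Then \<open>w = v\<^bsup>1-p\<^esup> u\<close> is in \<open>A\<^sub>p\<close> with a constant depending only on the bounds for the maximal operator,
  the \<open>L\<^sup>p\<^sub>w\<close> norm of \<open>f\<close> is controlled by \<open>\<integral>vu\<close>, and \<open>\<integral>|g|h\<close> is controlled by the \<open>L\<^sup>p\<^sub>w\<close> norm of \<open>g\<close>
  and \<open>\<integral>vu\<close>.  With \<open>g\<close> the image of \<open>f\<close>, Lorentz--Luxemburg duality turns the uniform weighted bounds into a bound on
  \<open>\<Phi>\<close>.  The extensions for different weights are consistent because the minimum of two \<open>A\<^sub>p\<close> weights is
  an \<open>A\<^sub>p\<close> weight.  Only bounds up to constants matter, so \<open>\<integral>|f|\<^sup>p w\<close> with a quasi-triangle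
  inequality replaces the norm throughout.
\<close>

subsection \<open>Strong measurability\<close>

text \<open>The weight is built for a pair f, h, and duality lets h vary for fixed f. The value of
  the extended operator at f must therefore be one function for all weights at once, which is why
  the extension is set up as a relation and compared across weights before a value is chosen. The
  estimates are inhomogeneous: x <= x^p + 1 stands in for Hoelder's inequality, so bounds are proved
  for functions of norm at most R, and R = 1 gives the operator norm. In the duality step a
  projection in L^2 replaces the Hahn-Banach theorem; truncation and the Fatou property then remove
  the square integrability. The operator is given on Schwartz functions only, so the dense class has
  to consist of these; compactly supported bumps serve because they belong to \<open>Lpw p w\<close>
  for every locally integrable w. The value spaces may be nonseparable, where Borel measurability is
  not stable under sums, so strong measurability is carried along throughout.\<close>

lemma borel_measurable_lebesgue_AE_eq:
  fixes f g :: "real \<Rightarrow> 'x::topological_space"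
  assumes f: "f \<in> borel_measurable lebesgue" and eq: "AE t in lebesgue. f t = g t"
  shows "g \<in> borel_measurable lebesgue"
proof (rule measurableI)
  fix A :: "'x set" assume A: "A \<in> sets borel"
  have "f -` A \<inter> space lebesgue \<in> sets lebesgue" using f A by (rule measurable_sets)
  moreover have "AE t in lebesgue. t \<in> f -` A \<inter> space lebesgue \<longleftrightarrow> t \<in> g -` A \<inter> space lebesgue"
    using eq by eventually_elim auto
  ultimately show "g -` A \<inter> space lebesgue \<in> sets lebesgue"
    using completion.in_sets_AE[where M=lborel and A="f -` A \<inter> space lebesgue" and B="g -` A \<inter> space lebesgue"] by simp
qed auto

lemma strongly_measurable_simple:
  "simple_function lebesgue f \<Longrightarrow> strongly_measurable f"
  unfolding strongly_measurable_def by (rule exI[of _ "\<lambda>n. f"]) auto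

lemma strongly_measurable_AE_eq:
  assumes "strongly_measurable f" and "AE t in lebesgue. f t = g t"
  shows "strongly_measurable g"
proof -
  obtain s where s: "\<And>n. simple_function lebesgue (s n)" "AE t in lebesgue. (\<lambda>n. s n t) \<longlonglongrightarrow> f t"
    using assms(1) unfolding strongly_measurable_def by blast
  have "AE t in lebesgue. (\<lambda>n. s n t) \<longlonglongrightarrow> g t"
    using s(2) assms(2) by eventually_elim simp
  with s(1) show ?thesis unfolding strongly_measurable_def by blast
qed

text \<open>For a nonseparable type the Borel sets of a product can exceed the product of the Borel
  sigma-algebras. Applying \<open>h\<close> to pairs of simple functions avoids the product
  sigma-algebra altogether.\<close>

lemma strongly_measurable_compose2:
  assumes f: "strongly_measurable f" and g: "strongly_measurable g"
    and h: "continuous_on UNIV (\<lambda>z. h (fst z) (snd z))"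
  shows "strongly_measurable (\<lambda>t. h (f t) (g t))"
proof -
  obtain s where s: "\<And>n. simple_function lebesgue (s n)" "AE t in lebesgue. (\<lambda>n. s n t) \<longlonglongrightarrow> f t"
    using f unfolding strongly_measurable_def by blast
  obtain r where r: "\<And>n. simple_function lebesgue (r n)" "AE t in lebesgue. (\<lambda>n. r n t) \<longlonglongrightarrow> g t"
    using g unfolding strongly_measurable_def by blast
  have "AE t in lebesgue. (\<lambda>n. h (s n t) (r n t)) \<longlonglongrightarrow> h (f t) (g t)"
    using s(2) r(2)
  proof eventually_elim
    case (elim t)
    have "(\<lambda>n. (s n t, r n t)) \<longlonglongrightarrow> (f t, g t)" using elim by (intro tendsto_Pair)
    from continuous_on_tendsto_compose[OF h this] show ?case by simp
  qed
  moreover have "simple_function lebesgue (\<lambda>t. h (s n t) (r n t))" for n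
    using s(1) r(1) by (rule simple_function_compose2[where h=h])
  ultimately show ?thesis unfolding strongly_measurable_def by (intro exI[of _ "\<lambda>n t. h (s n t) (r n t)"] conjI allI)
qed

lemma strongly_measurable_compose:
  fixes f :: "real \<Rightarrow> 'x::real_normed_vector"
  assumes "strongly_measurable f" and h: "continuous_on UNIV h"
  shows "strongly_measurable (\<lambda>t. h (f t))"
proof -
  have "continuous_on UNIV (\<lambda>z. h (fst (z :: 'x \<times> 'x)))"
    by (rule continuous_on_compose2[OF h]) (auto intro: continuous_intros)
  then show ?thesis
    using strongly_measurable_compose2[OF assms(1) assms(1), of "\<lambda>x y. h x"] by simp
qed

lemma strongly_measurable_const: "strongly_measurable (\<lambda>t. c)"
  by (simp add: strongly_measurable_simple)

lemma strongly_measurable_add: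
  "strongly_measurable f \<Longrightarrow> strongly_measurable g \<Longrightarrow> strongly_measurable (\<lambda>t. f t + g t)"
  by (rule strongly_measurable_compose2) (auto intro!: continuous_intros)

lemma strongly_measurable_diff:
  "strongly_measurable f \<Longrightarrow> strongly_measurable g \<Longrightarrow> strongly_measurable (\<lambda>t. f t - g t)"
  by (rule strongly_measurable_compose2) (auto intro!: continuous_intros)

lemma strongly_measurable_scaleR:
  "strongly_measurable f \<Longrightarrow> strongly_measurable g \<Longrightarrow> strongly_measurable (\<lambda>t. f t *\<^sub>R g t)"
  by (rule strongly_measurable_compose2) (auto intro!: continuous_intros)

lemma scaleC_scaleR: "scaleC c (r *\<^sub>R x) = r *\<^sub>R scaleC c (x::'x::complex_banach)"
  by (metis mult.commute scaleC_of_real scaleC_scaleC)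

lemma bounded_linear_scaleC: "bounded_linear (scaleC c :: 'x::complex_banach \<Rightarrow> 'x)"
  by (rule bounded_linear_intro[of _ "cmod c"])
     (auto simp: scaleC_add_right scaleC_scaleR norm_scaleC)

lemma scaleC_diff_right: "scaleC c (x - y) = scaleC c x - scaleC c (y::'x::complex_banach)"
  by (rule linear_diff[OF bounded_linear.linear[OF bounded_linear_scaleC]])

lemma strongly_measurable_scaleC:
  "strongly_measurable f \<Longrightarrow> strongly_measurable (\<lambda>t. scaleC c (f t))"
  using strongly_measurable_compose bounded_linear.continuous_on[OF bounded_linear_scaleC continuous_on_id]
  by blast

lemma strongly_measurable_borel:
  assumes "strongly_measurable f" shows "f \<in> borel_measurable lebesgue"
proof -
  obtain s where s: "\<And>n. simple_function lebesgue (s n)" "AE t in lebesgue. (\<lambda>n. s n t) \<longlonglongrightarrow> f t"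
    using assms unfolding strongly_measurable_def by blast
  from s(2) obtain Z where Z: "{t \<in> space lebesgue. \<not> (\<lambda>n. s n t) \<longlonglongrightarrow> f t} \<subseteq> Z" "Z \<in> null_sets lebesgue"
    unfolding eventually_ae_filter by auto
  \<comment> \<open>Setting everything to 0 on the exceptional set makes the convergence hold at
    every point, as the limit theorem for measurable functions demands.\<close>
  let ?s = "\<lambda>n t. if t \<in> Z then 0 else s n t" and ?f = "\<lambda>t. if t \<in> Z then 0 else f t"
  have "Z \<in> sets lebesgue" using Z(2) by auto
  then have m: "?s n \<in> borel_measurable lebesgue" for n
    using s(1)[of n, THEN borel_measurable_simple_function] by (intro measurable_If_set) auto
  have "?f \<in> borel_measurable lebesgue"
    by (rule borel_measurable_LIMSEQ_metric[OF m]) (use Z(1) in \<open>auto\<close>)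
  moreover have "AE t in lebesgue. ?f t = f t"
    using AE_not_in[OF Z(2)] by eventually_elim simp
  ultimately show ?thesis by (rule borel_measurable_lebesgue_AE_eq)
qed

text \<open>The values of all approximating simple functions form a countable set. Together with
  \<open>strongly_measurable_borel\<close> and \<open>strongly_measurableI_separable\<close> this is
  Pettis' criterion: strongly measurable means Borel measurable and essentially separably
  valued.\<close>

lemma strongly_measurable_separable:
  assumes "strongly_measurable f"
  obtains D where "countable D" "AE t in lebesgue. f t \<in> closure D"
proof -
  obtain s where s: "\<And>n. simple_function lebesgue (s n)" "AE t in lebesgue. (\<lambda>n. s n t) \<longlonglongrightarrow> f t"
    using assms unfolding strongly_measurable_def by blast
  define D where "D = (\<Union>n. range (s n))"
  have "finite (range (s n))" for n using simple_functionD(1)[OF s(1)[of n]] by simp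
  then have "countable D" unfolding D_def by (intro countable_UN) (auto intro: countable_finite)
  moreover have "AE t in lebesgue. f t \<in> closure D"
    using s(2)
  proof eventually_elim
    case (elim t)
    then show ?case unfolding closure_sequential by (intro exI[of _ "\<lambda>n. s n t"]) (auto simp: D_def)
  qed
  ultimately show ?thesis using that by blast
qed

text \<open>Approximate \<open>f t\<close> by a nearest point among the first \<open>n\<close> elements of a dense sequence.\<close>

lemma strongly_measurableI_separable:
  fixes f :: "real \<Rightarrow> 'x::real_normed_vector"
  assumes f: "f \<in> borel_measurable lebesgue" and D: "countable D" "AE t in lebesgue. f t \<in> closure D"
  shows "strongly_measurable f"
proof -
  \<comment> \<open>Adjoining 0 makes the set nonempty, so that it is the range of a
    sequence.\<close>
  have "countable (insert 0 D)" using D(1) by simp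
  then obtain d :: "nat \<Rightarrow> 'x" where d: "range d = insert 0 D"
    by (metis insert_not_empty uncountable_def)
  define near where "near n t k \<longleftrightarrow> k \<le> n \<and> (\<forall>i\<le>n. dist (d k) (f t) \<le> dist (d i) (f t))" for n t k
  \<comment> \<open>The least index breaks ties between equally near points, which makes the index a
    measurable function of t.\<close>
  define s where "s n t = d (LEAST k. near n t k)" for n t
  have ex: "\<exists>k. near n t k" for n t
  proof -
    have "\<exists>k\<in>{..n}. \<forall>i\<in>{..n}. dist (d k) (f t) \<le> dist (d i) (f t)"
      using arg_min_if_finite[of "{..n}" "\<lambda>i. dist (d i) (f t)"]
      by (intro bexI[of _ "arg_min_on (\<lambda>i. dist (d i) (f t)) {..n}"]) (auto simp: not_less)
    then show ?thesis unfolding near_def by blast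
  qed
  have meas [measurable]: "(\<lambda>t. dist (d k) (f t)) \<in> borel_measurable lebesgue" for k
    using f by (intro borel_measurable_continuous_on[of "\<lambda>x. dist (d k) x"]) (auto intro!: continuous_intros)
  have [measurable]: "Measurable.pred lebesgue (\<lambda>t. near n t k)" for n k
    unfolding near_def by measurable
  have [measurable]: "(\<lambda>t. LEAST k. near n t k) \<in> measurable lebesgue (count_space UNIV)" for n
    by measurable
  have "simple_function lebesgue (s n)" for n
  proof -
    have "simple_function lebesgue (\<lambda>t. LEAST k. near n t k)"
    unfolding simple_function_def
    proof (intro conjI ballI)
      have "(LEAST k. near n t k) \<le> n" for t
        using LeastI_ex[OF ex, of n t] unfolding near_def by simp
      then have "(\<lambda>t. LEAST k. near n t k) ` space lebesgue \<subseteq> {..n}" by auto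
      then show "finite ((\<lambda>t. LEAST k. near n t k) ` space lebesgue)"
        using finite_subset by blast
    next
      fix x show "(\<lambda>t. LEAST k. near n t k) -` {x} \<inter> space lebesgue \<in> sets lebesgue"
        by (rule measurable_sets[of _ _ "count_space UNIV"]) auto
    qed
    then show ?thesis unfolding s_def by (rule simple_function_compose1)
  qed
  moreover have "AE t in lebesgue. (\<lambda>n. s n t) \<longlonglongrightarrow> f t"
    using D(2)
  proof eventually_elim
    case (elim t)
    show ?case
    proof (rule metric_LIMSEQ_I)
      fix r :: real assume "0 < r"
      then obtain y where "y \<in> D" "dist y (f t) < r" using elim unfolding closure_approachable by blast
      then obtain k where k: "dist (d k) (f t) < r" using d by (metis insertI2 rangeE)
      have "dist (s n t) (f t) < r" if "k \<le> n" for n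
        using LeastI_ex[OF ex, of n t] that k unfolding s_def near_def by (meson le_less_trans)
      then show "\<exists>no. \<forall>n\<ge>no. dist (s n t) (f t) < r" by blast
    qed
  qed
  ultimately show ?thesis unfolding strongly_measurable_def by blast
qed

text \<open>Pettis' criterion replaces a diagonal choice among the approximating simple functions:
  the limit is Borel measurable, and its values lie in the closure of the union of the countable
  sets for the single terms.\<close>

lemma strongly_measurable_LIMSEQ:
  fixes f :: "real \<Rightarrow> 'x::real_normed_vector"
  assumes s: "\<And>n. strongly_measurable (s n)" and lim: "AE t in lebesgue. (\<lambda>n. s n t) \<longlonglongrightarrow> f t"
  shows "strongly_measurable f"
proof -
  have "\<exists>D. countable D \<and> (AE t in lebesgue. s n t \<in> closure D)" for n
    using strongly_measurable_separable[OF s[of n]] by blast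
  then obtain D where D: "\<And>n. countable (D n)" "\<And>n. AE t in lebesgue. s n t \<in> closure (D n)" by metis
  from lim obtain Z where Z: "{t \<in> space lebesgue. \<not> (\<lambda>n. s n t) \<longlonglongrightarrow> f t} \<subseteq> Z" "Z \<in> null_sets lebesgue"
    unfolding eventually_ae_filter by auto
  let ?s = "\<lambda>n t. if t \<in> Z then 0 else s n t" and ?f = "\<lambda>t. if t \<in> Z then 0 else f t"
  have "Z \<in> sets lebesgue" using Z(2) by auto
  then have m: "?s n \<in> borel_measurable lebesgue" for n
    using strongly_measurable_borel[OF s[of n]] by (intro measurable_If_set) auto
  have "?f \<in> borel_measurable lebesgue"
    by (rule borel_measurable_LIMSEQ_metric[OF m]) (use Z(1) in \<open>auto\<close>)
  moreover have "AE t in lebesgue. ?f t = f t"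
    using AE_not_in[OF Z(2)] by eventually_elim simp
  ultimately have f: "f \<in> borel_measurable lebesgue" by (rule borel_measurable_lebesgue_AE_eq)
  have "AE t in lebesgue. \<forall>n. s n t \<in> closure (D n)" using D(2) by (simp add: AE_all_countable)
  then have "AE t in lebesgue. f t \<in> closure (\<Union>n. D n)"
    using lim
  proof eventually_elim
    case (elim t)
    then have "s n t \<in> closure (\<Union>n. D n)" for n
      using closure_mono[of "D n" "\<Union>n. D n"] by blast
    with elim(2) show ?case by (metis closed_closure closed_sequentially)
  qed
  with f show ?thesis by (intro strongly_measurableI_separable[of f "\<Union>n. D n"]) (auto intro: D(1))
qed

lemma strongly_measurable_continuous:
  fixes f :: "real \<Rightarrow> 'x::real_normed_vector"
  assumes "continuous_on UNIV f"
  shows "strongly_measurable f"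
proof (rule strongly_measurableI_separable[where D="f ` \<rat>"])
  have "f \<in> borel_measurable borel" using assms by (rule borel_measurable_continuous_onI)
  then show "f \<in> borel_measurable lebesgue" by (simp add: measurable_completion)
  have "f t \<in> closure (f ` \<rat>)" for t
  proof -
    have "f ` closure \<rat> \<subseteq> closure (f ` \<rat>)"
      by (rule continuous_image_closure_subset[OF assms]) auto
    then show ?thesis using Rats_closure_real by auto
  qed
  then show "AE t in lebesgue. f t \<in> closure (f ` \<rat>)" by simp
qed (simp add: countable_rat)

lemma strongly_measurable_iff_borel:
  "strongly_measurable f \<longleftrightarrow> f \<in> borel_measurable lebesgue"
  for f :: "real \<Rightarrow> 'x::{real_normed_vector, second_countable_topology}"
proof
  assume f: "f \<in> borel_measurable lebesgue"
  obtain D :: "'x set" where D: "countable D" "closure D = UNIV"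
    using separable by (metis UNIV_I subsetI top.extremum_uniqueI)
  show "strongly_measurable f"
    by (rule strongly_measurableI_separable[OF f D(1)]) (simp add: D(2))
qed (rule strongly_measurable_borel)

lemma strongly_measurable_norm [measurable_dest]:
  "strongly_measurable f \<Longrightarrow> (\<lambda>t. norm (f t)) \<in> borel_measurable lebesgue"
  by (rule measurable_compose[OF strongly_measurable_borel borel_measurable_norm])

lemma strongly_measurable_indicator_scaleR:
  "E \<in> sets lebesgue \<Longrightarrow> strongly_measurable (\<lambda>t. indicat_real E t *\<^sub>R x)"
  by (intro strongly_measurable_scaleR strongly_measurable_const)
     (simp add: strongly_measurable_iff_borel)

subsection \<open>Weighted power integrals\<close>

definition power_integral :: "real \<Rightarrow> (real \<Rightarrow> real) \<Rightarrow> (real \<Rightarrow> 'x::real_normed_vector) \<Rightarrow> ennreal" where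
  "power_integral p w f = (\<integral>\<^sup>+t. ennreal (norm (f t) powr p) * ennreal (w t) \<partial>lebesgue)"

lemma Lpw_norm_le_iff:
  assumes "0 < p" "0 \<le> K"
  shows "Lpw_norm p w f \<le> ennreal K \<longleftrightarrow> power_integral p w f \<le> ennreal (K powr p)"
proof (cases "power_integral p w f")
  case (real r)
  have "r powr (1 / p) \<le> K \<longleftrightarrow> r \<le> K powr p"
  proof
    assume "r powr (1 / p) \<le> K"
    then have "(r powr (1 / p)) powr p \<le> K powr p" using assms by (intro powr_mono2) auto
    then show "r \<le> K powr p" using assms real(1) by (simp add: powr_powr)
  next
    assume "r \<le> K powr p"
    then have "r powr (1 / p) \<le> (K powr p) powr (1 / p)" using assms real by (intro powr_mono2) auto
    then show "r powr (1 / p) \<le> K" using assms by (simp add: powr_powr)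
  qed
  then show ?thesis using real assms
    by (simp add: Lpw_norm_def ennreal_powr_def power_integral_def[symmetric] ennreal_le_iff)
next
  case top
  then show ?thesis
    by (simp add: Lpw_norm_def ennreal_powr_def power_integral_def[symmetric] top_unique)
qed

lemma Lpw_iff:
  "f \<in> Lpw p w \<longleftrightarrow> strongly_measurable f \<and> power_integral p w f < \<infinity>"
  by (auto simp: Lpw_def Lpw_norm_def ennreal_powr_def power_integral_def[symmetric] less_top)

lemma LpwI: "strongly_measurable f \<Longrightarrow> power_integral p w f < \<infinity> \<Longrightarrow> f \<in> Lpw p w"
  by (simp add: Lpw_iff)

lemma power_integral_cong_norm:
  "(AE t in lebesgue. norm (f t) = norm (g t)) \<Longrightarrow> power_integral p w f = power_integral p w g"
  unfolding power_integral_def by (rule nn_integral_cong_AE) auto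

lemma power_integral_mono:
  assumes "0 \<le> p" "AE t in lebesgue. norm (f t) \<le> norm (g t)" "AE t in lebesgue. w t \<le> w' t"
  shows "power_integral p w f \<le> power_integral p w' g"
  unfolding power_integral_def
proof (rule nn_integral_mono_AE)
  show "AE t in lebesgue. ennreal (norm (f t) powr p) * ennreal (w t) \<le>
      ennreal (norm (g t) powr p) * ennreal (w' t)"
    using assms(2,3)
    by eventually_elim (use assms(1) in \<open>auto intro!: mult_mono ennreal_leI powr_mono2\<close>)
qed

lemma power_integral_scale:
  fixes f :: "real \<Rightarrow> 'x::real_normed_vector" and g :: "real \<Rightarrow> 'y::real_normed_vector"
  assumes f: "strongly_measurable f" and w: "w \<in> borel_measurable lebesgue"
    and eq: "\<And>t. norm (g t) = c * norm (f t)" and c: "0 \<le> c"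
  shows "power_integral p w g = ennreal (c powr p) * power_integral p w f"
proof -
  have [measurable]: "(\<lambda>t. norm (f t)) \<in> borel_measurable lebesgue" "w \<in> borel_measurable lebesgue"
    using f w by (auto intro: strongly_measurable_norm)
  have "power_integral p w g =
      (\<integral>\<^sup>+t. ennreal (c powr p) * (ennreal (norm (f t) powr p) * ennreal (w t)) \<partial>lebesgue)"
    unfolding power_integral_def
    by (rule nn_integral_cong) (simp add: eq powr_mult c ennreal_mult mult.assoc)
  also have "\<dots> = ennreal (c powr p) * power_integral p w f"
    unfolding power_integral_def by (rule nn_integral_cmult) measurable
  finally show ?thesis .
qed

text \<open>Comparison with twice the maximum, in place of convexity, covers all exponents p >= 0.
  The exponent p - 1 in the A_p constant may be below 1.\<close>

lemma powr_add_le: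
  fixes x y p :: real
  assumes "0 \<le> x" "0 \<le> y" "0 \<le> p"
  shows "(x + y) powr p \<le> 2 powr p * (x powr p + y powr p)"
proof -
  have "(x + y) powr p \<le> (2 * max x y) powr p" using assms by (intro powr_mono2) auto
  also have "\<dots> = 2 powr p * max x y powr p" using assms by (simp add: powr_mult)
  also have "max x y powr p \<le> x powr p + y powr p" by (auto simp: max_def)
  finally show ?thesis by simp
qed

lemma power_integral_add_le:
  fixes f g :: "real \<Rightarrow> 'x::real_normed_vector"
  assumes p: "0 \<le> p" and f: "strongly_measurable f" and g: "strongly_measurable g"
    and w: "w \<in> borel_measurable lebesgue"
    and le: "\<And>t. norm (h t) \<le> norm (f t) + norm (g t)"
  shows "power_integral p w h \<le> ennreal (2 powr p) * (power_integral p w f + power_integral p w g)"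
proof -
  have [measurable]: "(\<lambda>t. norm (f t)) \<in> borel_measurable lebesgue"
    "(\<lambda>t. norm (g t)) \<in> borel_measurable lebesgue" "w \<in> borel_measurable lebesgue"
    using f g w by (auto intro: strongly_measurable_norm)
  have "norm (h t) powr p \<le> 2 powr p * (norm (f t) powr p + norm (g t) powr p)" for t
    by (rule order_trans[OF powr_mono2[OF p _ le] powr_add_le]) (auto simp: p)
  then have "ennreal (norm (h t) powr p) \<le>
      ennreal (2 powr p) * (ennreal (norm (f t) powr p) + ennreal (norm (g t) powr p))" for t
    by (metis (no_types, lifting) ennreal_leI ennreal_mult ennreal_plus powr_ge_zero add_nonneg_nonneg)
  then have "power_integral p w h \<le> (\<integral>\<^sup>+t. ennreal (2 powr p) *
      (ennreal (norm (f t) powr p) * ennreal (w t) + ennreal (norm (g t) powr p) * ennreal (w t)) \<partial>lebesgue)"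
    unfolding power_integral_def
    by (intro nn_integral_mono) (auto intro: mult_right_mono simp flip: distrib_right mult.assoc)
  also have "\<dots> = ennreal (2 powr p) * (power_integral p w f + power_integral p w g)"
    unfolding power_integral_def by (subst nn_integral_cmult, measurable) (subst nn_integral_add, auto)
  finally show ?thesis .
qed

text \<open>The bound is asked for eventually because it will come from Cauchy estimates, which hold
  only beyond a given index.\<close>

lemma power_integral_fatou:
  fixes u :: "nat \<Rightarrow> real \<Rightarrow> 'x::real_normed_vector"
  assumes u: "\<And>n. strongly_measurable (u n)" and w: "w \<in> borel_measurable lebesgue" and p: "0 < p"
    and lim: "AE t in lebesgue. (\<lambda>n. u n t) \<longlonglongrightarrow> v t"
    and B: "eventually (\<lambda>n. power_integral p w (u n) \<le> B) sequentially"
  shows "power_integral p w v \<le> B"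
proof -
  have [measurable]: "(\<lambda>t. norm (u n t)) \<in> borel_measurable lebesgue" "w \<in> borel_measurable lebesgue" for n
    using u w by (auto intro: strongly_measurable_norm)
  let ?u = "\<lambda>n t. ennreal (norm (u n t) powr p) * ennreal (w t)"
  have "power_integral p w v \<le> (\<integral>\<^sup>+t. liminf (\<lambda>n. ?u n t) \<partial>lebesgue)"
    unfolding power_integral_def
  proof (rule nn_integral_mono_AE)
    show "AE t in lebesgue. ennreal (norm (v t) powr p) * ennreal (w t) \<le> liminf (\<lambda>n. ?u n t)"
      using lim
    proof eventually_elim
      case (elim t)
      have "(\<lambda>n. ennreal (norm (u n t) powr p)) \<longlonglongrightarrow> ennreal (norm (v t) powr p)"
        using p elim by (intro tendsto_ennrealI tendsto_powr' tendsto_norm) auto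
      then have "(\<lambda>n. ?u n t) \<longlonglongrightarrow> ennreal (norm (v t) powr p) * ennreal (w t)"
        by (intro tendsto_mult_ennreal tendsto_const) auto
      then show ?case by (metis lim_imp_Liminf order_refl sequentially_bot)
    qed
  qed
  also have "\<dots> \<le> liminf (\<lambda>n. power_integral p w (u n))"
    unfolding power_integral_def by (rule nn_integral_liminf) measurable
  also have "\<dots> \<le> limsup (\<lambda>n. power_integral p w (u n))" by (rule Liminf_le_Limsup) simp
  also have "\<dots> \<le> B" using B by (rule Limsup_bounded)
  finally show ?thesis .
qed

section \<open>Completeness of the weighted spaces along rapidly Cauchy sequences\<close>

lemma convergent_of_geometric_increments:
  fixes g :: "nat \<Rightarrow> 'x::banach"
  assumes "\<And>n. norm (g n - g (Suc n)) \<le> R * (1 / 2) ^ n"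
  shows "convergent g"
proof -
  have "summable (\<lambda>n. R * (1 / 2 :: real) ^ n)" by (intro summable_mult summable_geometric) simp
  then have "summable (\<lambda>n. norm (g n - g (Suc n)))"
    by (rule summable_comparison_test'[where N=0]) (use assms in auto)
  then have "summable (\<lambda>n. g n - g (Suc n))" by (rule summable_norm_cancel)
  then obtain s where "(\<lambda>n. \<Sum>i<n. g i - g (Suc i)) \<longlonglongrightarrow> s" unfolding summable_def sums_def by blast
  then have "(\<lambda>n. g 0 - (\<Sum>i<n. g i - g (Suc i))) \<longlonglongrightarrow> g 0 - s" by (intro tendsto_intros)
  moreover have "g 0 - (\<Sum>i<n. g i - g (Suc i)) = g n" for n by (induction n) (auto simp: algebra_simps)
  ultimately show ?thesis by (auto simp: convergent_def)
qed

text \<open>The Riesz-Fischer argument at a fixed rate. Of the decay 4^(-pn), a factor 2^(-pn) makes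
  the integrals of the weighted increments summable, and the other factor 2^(-pn) yields pointwise
  increments of order 2^(-n). Fatou's lemma carries the Cauchy estimate over to the limit.\<close>

lemma power_integral_complete:
  fixes g :: "nat \<Rightarrow> real \<Rightarrow> 'x::banach"
  assumes p: "0 < p" and w: "w \<in> borel_measurable lebesgue" "AE t in lebesgue. 0 < w t"
    and g: "\<And>n. strongly_measurable (g n)" and A: "0 \<le> A"
    and cauchy: "\<And>n m. n \<le> m \<Longrightarrow>
      power_integral p w (\<lambda>t. g n t - g m t) \<le> ennreal (A * (4 powr - p) ^ n)"
  obtains h where "strongly_measurable h" "AE t in lebesgue. (\<lambda>n. g n t) \<longlonglongrightarrow> h t"
    "\<And>n. power_integral p w (\<lambda>t. g n t - h t) \<le> ennreal (A * (4 powr - p) ^ n)"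
proof -
  have d: "strongly_measurable (\<lambda>t. g n t - g m t)" for n m by (intro strongly_measurable_diff g)
  have [measurable]: "(\<lambda>t. norm (g n t - g m t)) \<in> borel_measurable lebesgue" for n m
    by (rule strongly_measurable_norm[OF d])
  note w(1)[measurable]
  define a where "a n t = ennreal ((2 powr p) ^ n * norm (g n t - g (Suc n) t) powr p) * ennreal (w t)" for n t
  have [measurable]: "a n \<in> borel_measurable lebesgue" for n unfolding a_def by measurable
  have a_int: "(\<integral>\<^sup>+t. a n t \<partial>lebesgue) \<le> ennreal (A * (2 powr - p) ^ n)" for n
  proof -
    have "(\<integral>\<^sup>+t. a n t \<partial>lebesgue) = ennreal ((2 powr p) ^ n) * power_integral p w (\<lambda>t. g n t - g (Suc n) t)"
      unfolding a_def power_integral_def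
      by (subst nn_integral_cmult[symmetric]) (auto simp: ennreal_mult mult.assoc)
    also have "\<dots> \<le> ennreal ((2 powr p) ^ n) * ennreal (A * (4 powr - p) ^ n)"
      by (intro mult_left_mono cauchy) auto
    also have "\<dots> = ennreal (A * ((2 powr p) * 4 powr - p) ^ n)"
      using A by (simp add: ennreal_mult[symmetric] power_mult_distrib mult_ac)
    also have "(2 powr p) * 4 powr - p = (2 powr - p :: real)"
    proof -
      have "(4::real) powr - p = (2 powr 2) powr - p" by simp
      then show ?thesis unfolding powr_powr by (simp flip: powr_add)
    qed
    finally show ?thesis .
  qed
  have "(\<integral>\<^sup>+t. (\<Sum>n. a n t) \<partial>lebesgue) = (\<Sum>n. \<integral>\<^sup>+t. a n t \<partial>lebesgue)"
    by (rule nn_integral_suminf) measurable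
  also have "\<dots> \<le> (\<Sum>n. ennreal (A * (2 powr - p) ^ n))" by (intro suminf_le a_int) auto
  also have "\<dots> = ennreal (\<Sum>n. A * (2 powr - p) ^ n)"
  proof (rule suminf_ennreal_eq)
    have "2 powr - p < (1::real)" using p by (simp add: powr_minus field_simps)
    then show "(\<lambda>n. A * (2 powr - p) ^ n) sums (\<Sum>n. A * (2 powr - p) ^ n)"
      by (intro summable_sums summable_mult summable_geometric) auto
  qed (use A in auto)
  finally have "(\<integral>\<^sup>+t. (\<Sum>n. a n t) \<partial>lebesgue) \<noteq> \<infinity>" by (metis ennreal_neq_top infinity_ennreal_def top_unique)
  then have "AE t in lebesgue. (\<Sum>n. a n t) \<noteq> \<infinity>"
    by (rule nn_integral_noteq_infinite[rotated]) measurable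
  then have "AE t in lebesgue. convergent (\<lambda>n. g n t)"
    using w(2)
  proof eventually_elim
    case (elim t)
    then obtain M where M: "(\<Sum>n. a n t) = ennreal M" "0 \<le> M" by (cases "\<Sum>n. a n t") auto
    \<comment> \<open>One term of the sum is at most M; solving (2^n x)^p w(t) <= M for the
      increment x gives x <= R 2^(-n).\<close>
    define R where "R = (M / w t) powr (1 / p)"
    have "norm (g n t - g (Suc n) t) \<le> R * (1 / 2) ^ n" for n
    proof -
      let ?x = "norm (g n t - g (Suc n) t)"
      have "a n t \<le> (\<Sum>n. a n t)"
        using sum_le_suminf[of "\<lambda>n. a n t" "{n}"] by simp
      then have "(2 powr p) ^ n * ?x powr p * w t \<le> M"
        using elim(2) M unfolding a_def by (simp add: ennreal_mult[symmetric] ennreal_le_iff)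
      moreover have "(2 powr p) ^ n = (2 ^ n) powr p"
        by (simp flip: powr_realpow add: powr_powr mult.commute)
      ultimately have "(2 ^ n * ?x) powr p \<le> M / w t"
        using elim(2) by (simp add: powr_mult field_simps)
      then have "((2 ^ n * ?x) powr p) powr (1 / p) \<le> R"
        unfolding R_def using p by (intro powr_mono2) auto
      then have "2 ^ n * ?x \<le> R" using p by (simp add: powr_powr)
      then show ?thesis by (simp add: field_simps power_divide)
    qed
    then show ?case by (rule convergent_of_geometric_increments)
  qed
  then have lim: "AE t in lebesgue. (\<lambda>n. g n t) \<longlonglongrightarrow> lim (\<lambda>n. g n t)"
    by eventually_elim (simp add: convergent_LIMSEQ_iff)
  show thesis
  proof (rule that[OF strongly_measurable_LIMSEQ[OF g lim] lim])
    fix n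
    show "power_integral p w (\<lambda>t. g n t - lim (\<lambda>n. g n t)) \<le> ennreal (A * (4 powr - p) ^ n)"
    proof (rule power_integral_fatou[OF d w(1) p])
      show "AE t in lebesgue. (\<lambda>m. g n t - g m t) \<longlonglongrightarrow> g n t - lim (\<lambda>n. g n t)"
        using lim by eventually_elim (intro tendsto_intros)
      show "\<forall>\<^sub>F m in sequentially. power_integral p w (\<lambda>t. g n t - g m t) \<le> ennreal (A * (4 powr - p) ^ n)"
        using cauchy by (auto simp: eventually_sequentially)
    qed
  qed
qed

subsection \<open>Schwartz functions\<close>

lemma nth_vderiv_0 [simp]: "nth_vderiv 0 f = f"
  by (simp add: nth_vderiv_def)

lemma nth_vderiv_Suc: "nth_vderiv (Suc n) f = (\<lambda>t. vector_derivative (nth_vderiv n f) (at t))"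
  by (simp add: nth_vderiv_def)

text \<open>Membership in \<open>schwartz\<close> speaks of all iterated derivatives. A class that
  contains a derivative of each of its members reduces it to the decay of the members, so formulas
  for higher derivatives never appear.\<close>

lemma schwartz_coinduct:
  assumes deriv: "\<And>f. f \<in> C \<Longrightarrow> \<exists>f'\<in>C. \<forall>t. (f has_vector_derivative f' t) (at t)"
    and bdd: "\<And>f m. f \<in> C \<Longrightarrow> bdd_above (range (\<lambda>t. \<bar>t\<bar> ^ m * norm (f t)))"
  shows "C \<subseteq> schwartz"
proof
  fix f assume f: "f \<in> C"
  have C: "nth_vderiv n f \<in> C" for n
  proof (induction n)
    case (Suc n)
    then obtain f' where "f' \<in> C" "\<And>t. (nth_vderiv n f has_vector_derivative f' t) (at t)"
      using deriv by blast
    moreover have "nth_vderiv (Suc n) f = f'"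
      using calculation(2) by (auto simp: nth_vderiv_Suc vector_derivative_at)
    ultimately show ?case by simp
  qed (use f in simp)
  have "nth_vderiv n f differentiable (at t)" for n t
    using deriv[OF C[of n]] differentiableI_vector by blast
  with bdd[OF C] show "f \<in> schwartz" by (simp add: schwartz_def)
qed

lemma schwartz_has_vector_derivative:
  "f \<in> schwartz \<Longrightarrow> (nth_vderiv n f has_vector_derivative nth_vderiv (Suc n) f t) (at t)"
  by (simp add: schwartz_def nth_vderiv_Suc vector_derivative_works[symmetric])

lemma schwartz_bdd: "f \<in> schwartz \<Longrightarrow> bdd_above (range (\<lambda>t. \<bar>t\<bar> ^ m * norm (nth_vderiv n f t)))"
  by (simp add: schwartz_def)

lemma schwartz_add:
  assumes f: "f \<in> schwartz" and g: "g \<in> schwartz"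
  shows "(\<lambda>t. f t + g t) \<in> schwartz"
proof -
  define C where "C = range (\<lambda>n t. nth_vderiv n f t + nth_vderiv n g t)"
  have "C \<subseteq> schwartz"
  proof (rule schwartz_coinduct)
    fix h assume "h \<in> C"
    then obtain n where h: "h = (\<lambda>t. nth_vderiv n f t + nth_vderiv n g t)" unfolding C_def by blast
    show "\<exists>h'\<in>C. \<forall>t. (h has_vector_derivative h' t) (at t)"
      unfolding h C_def
      by (intro bexI[of _ "\<lambda>t. nth_vderiv (Suc n) f t + nth_vderiv (Suc n) g t"] allI
          has_vector_derivative_add schwartz_has_vector_derivative f g rangeI)
    fix m
    obtain A B where AB: "\<And>t. \<bar>t\<bar> ^ m * norm (nth_vderiv n f t) \<le> A" "\<And>t. \<bar>t\<bar> ^ m * norm (nth_vderiv n g t) \<le> B"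
      using schwartz_bdd[OF f, of m n] schwartz_bdd[OF g, of m n] by (auto simp: bdd_above_def)
    have "\<bar>t\<bar> ^ m * norm (h t) \<le> A + B" for t
    proof -
      have "\<bar>t\<bar> ^ m * norm (h t) \<le> \<bar>t\<bar> ^ m * (norm (nth_vderiv n f t) + norm (nth_vderiv n g t))"
        unfolding h by (intro mult_left_mono norm_triangle_ineq) simp
      with AB[of t] show ?thesis by (simp add: distrib_left)
    qed
    then show "bdd_above (range (\<lambda>t. \<bar>t\<bar> ^ m * norm (h t)))" by (auto simp: bdd_above_def)
  qed
  moreover have "(\<lambda>t. f t + g t) \<in> C" unfolding C_def by (rule range_eqI[of _ _ 0]) simp
  ultimately show ?thesis by blast
qed

lemma schwartz_bounded_linear:
  assumes f: "f \<in> schwartz" and L: "bounded_linear L"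
  shows "(\<lambda>t. L (f t)) \<in> schwartz"
proof -
  define C where "C = range (\<lambda>n t. L (nth_vderiv n f t))"
  obtain K where K: "\<And>x. norm (L x) \<le> norm x * K" "0 \<le> K"
    using bounded_linear.nonneg_bounded[OF L] by blast
  have "C \<subseteq> schwartz"
  proof (rule schwartz_coinduct)
    fix h assume "h \<in> C"
    then obtain n where h: "h = (\<lambda>t. L (nth_vderiv n f t))" unfolding C_def by blast
    show "\<exists>h'\<in>C. \<forall>t. (h has_vector_derivative h' t) (at t)"
      unfolding h C_def
      by (intro bexI[of _ "\<lambda>t. L (nth_vderiv (Suc n) f t)"] allI
          bounded_linear.has_vector_derivative[OF L] schwartz_has_vector_derivative f rangeI)
    fix m
    obtain A where A: "\<And>t. \<bar>t\<bar> ^ m * norm (nth_vderiv n f t) \<le> A"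
      using schwartz_bdd[OF f, of m n] by (auto simp: bdd_above_def)
    have "\<bar>t\<bar> ^ m * norm (h t) \<le> A * K" for t
    proof -
      have "\<bar>t\<bar> ^ m * norm (h t) \<le> \<bar>t\<bar> ^ m * (norm (nth_vderiv n f t) * K)"
        unfolding h by (intro mult_left_mono K) simp
      also have "\<dots> \<le> A * K" using mult_right_mono[OF A K(2)] by (simp add: mult.assoc)
      finally show ?thesis .
    qed
    then show "bdd_above (range (\<lambda>t. \<bar>t\<bar> ^ m * norm (h t)))" by (auto simp: bdd_above_def)
  qed
  moreover have "(\<lambda>t. L (f t)) \<in> C" unfolding C_def by (rule range_eqI[of _ _ 0]) simp
  ultimately show ?thesis by blast
qed

lemma schwartz_scaleC: "f \<in> schwartz \<Longrightarrow> (\<lambda>t. scaleC c (f t)) \<in> schwartz"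
  by (rule schwartz_bounded_linear[OF _ bounded_linear_scaleC])

lemma schwartz_strongly_measurable:
  assumes f: "f \<in> schwartz" shows "strongly_measurable f"
proof (rule strongly_measurable_continuous)
  have "(f has_vector_derivative nth_vderiv 1 f t) (at t)" for t
    using schwartz_has_vector_derivative[OF f, of 0 t] by simp
  then show "continuous_on UNIV f"
    by (meson continuous_at_imp_continuous_on has_vector_derivative_continuous)
qed

lemma nn_integral_inverse_1_plus_square:
  "(\<integral>\<^sup>+t. ennreal (1 / (1 + t\<^sup>2)) \<partial>lebesgue) < \<infinity>"
proof -
  let ?f = "\<lambda>t::real. 1 / (1 + t\<^sup>2)"
  have *: "(\<integral>\<^sup>+t. ennreal (?f t) * indicator {0..} t \<partial>lborel) < \<infinity>"
  proof -
    have "(\<integral>\<^sup>+t. ennreal (?f t) * indicator {0..} t \<partial>lborel) = ennreal (pi / 2 - arctan 0)"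
    proof (rule nn_integral_FTC_atLeast)
      show "DERIV arctan x :> ?f x" for x :: real
        using DERIV_arctan[of x] by (simp add: inverse_eq_divide)
      show "(arctan \<longlongrightarrow> pi / 2) at_top" by (rule tendsto_arctan_at_top)
      have "continuous_on UNIV ?f"
        by (intro continuous_intros) (smt (verit) zero_le_power2)
      then show "?f \<in> borel_measurable borel" by (rule borel_measurable_continuous_onI)
    qed auto
    then show ?thesis by simp
  qed
  have "(\<integral>\<^sup>+t. ennreal (?f t) * indicator {..0} t \<partial>lborel) =
      (\<integral>\<^sup>+t. ennreal (?f t) * indicator {0..} t \<partial>lborel)"
    by (subst nn_integral_real_affine[where c="-1" and t=0]) (auto intro!: nn_integral_cong simp: indicator_def)
  with * have **: "(\<integral>\<^sup>+t. ennreal (?f t) * indicator {..0} t \<partial>lborel) < \<infinity>" by simp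
  have "(\<integral>\<^sup>+t. ennreal (?f t) \<partial>lborel) \<le>
      (\<integral>\<^sup>+t. ennreal (?f t) * indicator {0..} t + ennreal (?f t) * indicator {..0} t \<partial>lborel)"
    by (intro nn_integral_mono) (auto simp: indicator_def)
  also have "\<dots> = (\<integral>\<^sup>+t. ennreal (?f t) * indicator {0..} t \<partial>lborel) +
      (\<integral>\<^sup>+t. ennreal (?f t) * indicator {..0} t \<partial>lborel)"
    by (rule nn_integral_add) measurable
  also have "\<dots> < \<infinity>" using * ** by (auto simp: less_top)
  finally show ?thesis by (simp add: nn_integral_completion)
qed

text \<open>Of the p factors |f|, one supplies the decay of order t^(-2) and the remaining p - 1 are
  bounded by a constant. The constant weight is chosen because it lies in every A_p class and so
  places Schwartz functions in the union of the weighted spaces.\<close>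

lemma schwartz_power_integral_1:
  assumes f: "f \<in> schwartz" and p: "1 \<le> p"
  shows "power_integral p (\<lambda>_. 1) f < \<infinity>"
proof -
  obtain A B where AB: "\<And>t. norm (f t) \<le> A" "\<And>t. \<bar>t\<bar> ^ 2 * norm (f t) \<le> B"
    using schwartz_bdd[OF f, of 0 0] schwartz_bdd[OF f, of 2 0] by (auto simp: bdd_above_def)
  have A: "0 \<le> A" using AB(1)[of 0] norm_ge_zero order_trans by blast
  define D where "D = A powr (p - 1) * (A + B)"
  have D: "norm (f t) powr p \<le> D * (1 / (1 + t\<^sup>2))" for t
  proof -
    have "norm (f t) powr p = norm (f t) powr (p - 1) * norm (f t)"
      by (cases "f t = 0") (auto simp: powr_mult_base mult.commute)
    also have "\<dots> \<le> A powr (p - 1) * norm (f t)"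
      using p AB(1)[of t] by (intro mult_right_mono powr_mono2) auto
    also have "norm (f t) \<le> (A + B) / (1 + t\<^sup>2)"
      using AB[of t] by (simp add: field_simps add_pos_nonneg)
    finally show ?thesis unfolding D_def by (simp add: mult_left_mono)
  qed
  have "0 \<le> D" using D[of 0] by (simp add: order_trans[OF powr_ge_zero])
  have "power_integral p (\<lambda>_. 1) f \<le> (\<integral>\<^sup>+t. ennreal D * ennreal (1 / (1 + t\<^sup>2)) \<partial>lebesgue)"
    unfolding power_integral_def
    using D \<open>0 \<le> D\<close> by (intro nn_integral_mono) (simp flip: ennreal_mult add: ennreal_leI)
  also have "\<dots> = ennreal D * (\<integral>\<^sup>+t. ennreal (1 / (1 + t\<^sup>2)) \<partial>lebesgue)"
    by (rule nn_integral_cmult) (simp add: measurable_completion)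
  also have "\<dots> < \<infinity>"
    using nn_integral_inverse_1_plus_square by (simp add: ennreal_mult_less_top)
  finally show ?thesis .
qed

subsection \<open>Smooth bump functions\<close>

text \<open>For \<open>i = 0\<close> this is the standard smooth function that is positive for t > 0
  and vanishes to infinite order at 0. The powers of 1/t make the span of the family closed under
  differentiation.\<close>

definition flat :: "nat \<Rightarrow> real \<Rightarrow> real" where
  "flat i t = (if t \<le> 0 then 0 else (1 / t) ^ i * exp (- (1 / t)))"

lemma flat_tendsto_0: "(flat i \<longlongrightarrow> 0) (at 0)"
proof (rule filterlim_split_at)
  show "(flat i \<longlongrightarrow> 0) (at_left 0)"
    by (rule tendsto_eventually) (auto simp: flat_def eventually_at_filter)
  have "((\<lambda>t. inverse t ^ i / exp (inverse t)) \<longlongrightarrow> 0) (at_right (0::real))"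
    using filterlim_compose[OF tendsto_power_div_exp_0[of i] filterlim_inverse_at_top_right] .
  moreover have "eventually (\<lambda>t. inverse t ^ i / exp (inverse t) = flat i t) (at_right 0)"
    by (auto simp: flat_def eventually_at_filter exp_minus divide_inverse)
  ultimately show "(flat i \<longlongrightarrow> 0) (at_right 0)" by (rule Lim_transform_eventually)
qed

lemma flat_deriv: "(flat i has_real_derivative flat (i + 2) t - i * flat (i + 1) t) (at t)"
proof -
  consider "t < 0" | "t = 0" | "0 < t" by linarith
  then show ?thesis
  proof cases
    case 1
    have "((\<lambda>_. 0) has_real_derivative 0) (at t)" by simp
    moreover have "eventually (\<lambda>s. s < 0) (nhds t)" using 1 eventually_nhds_in_open[of "{..<0}" t] by simp
    then have "eventually (\<lambda>s. 0 = flat i s) (nhds t)" by eventually_elim (simp add: flat_def)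
    ultimately have "(flat i has_real_derivative 0) (at t)"
      using 1 by (subst DERIV_cong_ev[symmetric, where f="\<lambda>_. 0" and x=t, OF refl _ refl]) auto
    with 1 show ?thesis by (simp add: flat_def)
  next
    case 2
    \<comment> \<open>At 0 the difference quotient of \<open>flat i\<close> is
      \<open>flat (i + 1)\<close>, whose limit is already known to be 0.\<close>
    have "((\<lambda>h. (flat i (0 + h) - flat i 0) / h) \<longlongrightarrow> 0) (at 0)"
    proof (rule Lim_transform_eventually[OF flat_tendsto_0[of "i + 1"]])
      show "\<forall>\<^sub>F h in at 0. flat (i + 1) h = (flat i (0 + h) - flat i 0) / h"
        by (auto simp: flat_def eventually_at_filter)
    qed
    then have "(flat i has_real_derivative 0) (at 0)" unfolding DERIV_def by simp
    with 2 show ?thesis by (simp add: flat_def)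
  next
    case 3
    have "((\<lambda>t. (1 / t) ^ i * exp (- (1 / t))) has_real_derivative
        (1 / t) ^ (i + 2) * exp (- (1 / t)) - i * ((1 / t) ^ (i + 1) * exp (- (1 / t)))) (at t)"
    proof -
      have d: "((\<lambda>t. 1 / t) has_real_derivative - ((1 / t)\<^sup>2)) (at t)"
        using 3 by (auto intro!: derivative_eq_intros simp: field_simps power2_eq_square)
      \<comment> \<open>For \<open>i = 0\<close> the truncated exponent \<open>i - Suc 0\<close>
        does no harm, since its term carries the factor i.\<close>
      have eq: "u ^ i * (e * - (- (u\<^sup>2))) + real i * (- (u\<^sup>2) * u ^ (i - Suc 0)) * e =
          u ^ (i + 2) * e - i * (u ^ (i + 1) * e)" for u e :: real
        by (cases i) (simp_all add: algebra_simps power2_eq_square)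
      show ?thesis
        using DERIV_mult'[OF DERIV_power[OF d, of i] DERIV_chain2[OF DERIV_exp DERIV_minus[OF d]]]
        unfolding eq .
    qed
    moreover have "eventually (\<lambda>s. 0 < s) (nhds t)" using 3 eventually_nhds_in_open[of "{0<..}" t] by simp
    then have "eventually (\<lambda>s. (1 / s) ^ i * exp (- (1 / s)) = flat i s) (nhds t)"
      by eventually_elim (simp add: flat_def)
    ultimately have "(flat i has_real_derivative
        (1 / t) ^ (i + 2) * exp (- (1 / t)) - i * ((1 / t) ^ (i + 1) * exp (- (1 / t)))) (at t)"
      by (subst DERIV_cong_ev[symmetric, where f="\<lambda>s. (1 / s) ^ i * exp (- (1 / s))" and x=t, OF refl _ refl]) auto
    with 3 show ?thesis by (simp add: flat_def)
  qed
qed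

text \<open>Sums are included because the product rule produces them; real factors are absorbed into
  the vector x. The dilation k is left free so that, for \<open>i = j = 0\<close> and k growing, the
  products tend to x on the open interval from a to b.\<close>

inductive_set bumps :: "(real \<Rightarrow> 'x::real_normed_vector) set" where
  base: "(\<lambda>t. (flat i (k * (t - a)) * flat j (k * (b - t))) *\<^sub>R x) \<in> bumps" if "0 < k"
| add: "(\<lambda>t. f t + g t) \<in> bumps" if "f \<in> bumps" "g \<in> bumps"

lemma bumps_deriv:
  "f \<in> bumps \<Longrightarrow> \<exists>f'\<in>bumps. \<forall>t. (f has_vector_derivative f' t) (at t)"
proof (induction rule: bumps.induct)
  case (base k i a j b x)
  define F where "F i j y = (\<lambda>t. (flat i (k * (t - a)) * flat j (k * (b - t))) *\<^sub>R y)" for i j and y :: 'a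
  have F: "F i j y \<in> bumps" for i j y unfolding F_def by (rule bumps.base[OF base])
  \<comment> \<open>Two terms for each factor of the product, from \<open>flat_deriv\<close>. The
    chain rule factors k and -k and the integer coefficients are moved into the vector.\<close>
  let ?f = "\<lambda>t. F (i + 2) j (k *\<^sub>R x) t + F (i + 1) j (- (k * i) *\<^sub>R x) t + F i (j + 2) (- k *\<^sub>R x) t +
      F i (j + 1) ((k * j) *\<^sub>R x) t"
  have "?f \<in> bumps" by (intro bumps.add F)
  moreover have "((\<lambda>t. (flat i (k * (t - a)) * flat j (k * (b - t))) *\<^sub>R x) has_vector_derivative ?f t) (at t)" for t
  proof -
    have *: "((\<lambda>t. flat i (k * (t - a)) * flat j (k * (b - t))) has_real_derivative
        flat i (k * (t - a)) * ((flat (j + 2) (k * (b - t)) - j * flat (j + 1) (k * (b - t))) * (- k)) +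
        (flat (i + 2) (k * (t - a)) - i * flat (i + 1) (k * (t - a))) * k * flat j (k * (b - t))) (at t)"
      by (rule DERIV_mult'; rule DERIV_chain2[OF flat_deriv]) (auto intro!: derivative_eq_intros)
    have "((\<lambda>t. (flat i (k * (t - a)) * flat j (k * (b - t))) *\<^sub>R x) has_vector_derivative
        (flat i (k * (t - a)) * ((flat (j + 2) (k * (b - t)) - j * flat (j + 1) (k * (b - t))) * (- k)) +
        (flat (i + 2) (k * (t - a)) - i * flat (i + 1) (k * (t - a))) * k * flat j (k * (b - t))) *\<^sub>R x) (at t)"
      using has_vector_derivative_scaleR[OF * has_vector_derivative_const[of x "at t"]] by simp
    then show ?thesis
      by (rule has_vector_derivative_eq_rhs) (simp add: F_def algebra_simps flip: scaleR_add_left scaleR_diff_left scaleR_minus_left)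
  qed
  ultimately show ?case by (intro bexI[of _ ?f]) auto
next
  case (add f g)
  then obtain f' g' where "f' \<in> bumps" "g' \<in> bumps" "\<And>t. (f has_vector_derivative f' t) (at t)"
    "\<And>t. (g has_vector_derivative g' t) (at t)" by auto
  then show ?case
    by (intro bexI[of _ "\<lambda>t. f' t + g' t"] allI has_vector_derivative_add bumps.add)
qed

lemma bumps_compact_support: "f \<in> bumps \<Longrightarrow> \<exists>R. \<forall>t. f t \<noteq> 0 \<longrightarrow> \<bar>t\<bar> \<le> R"
proof (induction rule: bumps.induct)
  case (base k i a j b x)
  have "\<bar>t\<bar> \<le> max \<bar>a\<bar> \<bar>b\<bar>" if "(flat i (k * (t - a)) * flat j (k * (b - t))) *\<^sub>R x \<noteq> 0" for t
  proof -
    have "\<not> k * (t - a) \<le> 0" "\<not> k * (b - t) \<le> 0" using that by (auto simp: flat_def)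
    then have "a < t" "t < b" using base by (auto simp: mult_le_0_iff)
    then show ?thesis by linarith
  qed
  then show ?case by blast
next
  case (add f g)
  then obtain R R' where "\<And>t. f t \<noteq> 0 \<longrightarrow> \<bar>t\<bar> \<le> R" "\<And>t. g t \<noteq> 0 \<longrightarrow> \<bar>t\<bar> \<le> R'" by blast
  then have "f t + g t \<noteq> 0 \<Longrightarrow> \<bar>t\<bar> \<le> max R R'" for t
    by (cases "f t = 0") (auto simp: le_max_iff_disj)
  then show ?case by blast
qed

lemma bumps_bounded:
  assumes f: "f \<in> bumps"
  obtains R B where "0 \<le> R" "0 \<le> B" "\<And>t. norm (f t) \<le> B * indicator {-R..R} t"
proof -
  obtain R0 where R0: "\<And>t. f t \<noteq> 0 \<Longrightarrow> \<bar>t\<bar> \<le> R0" using bumps_compact_support[OF f] by blast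
  define R where "R = max 0 R0"
  have R: "\<And>t. f t \<noteq> 0 \<Longrightarrow> \<bar>t\<bar> \<le> R" using R0 unfolding R_def by fastforce
  have "continuous_on {-R..R} f"
    using bumps_deriv[OF f] by (meson continuous_at_imp_continuous_on has_vector_derivative_continuous)
  then have "bounded (f ` {-R..R})" by (intro compact_imp_bounded compact_continuous_image) auto
  then obtain B where B: "0 < B" "\<And>t. t \<in> {-R..R} \<Longrightarrow> norm (f t) \<le> B" by (auto simp: bounded_pos)
  show thesis
  proof (rule that[of R B])
    show "norm (f t) \<le> B * indicator {-R..R} t" for t
      using B(2)[of t] R[of t] by (cases "f t = 0") (auto simp: indicator_def abs_le_iff \<open>0 < B\<close> less_imp_le)
  qed (use B in \<open>auto simp: R_def\<close>)
qed

lemma bumps_subset_schwartz: "bumps \<subseteq> schwartz"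
proof (rule schwartz_coinduct[OF bumps_deriv])
  fix f :: "real \<Rightarrow> 'a" and m assume "f \<in> bumps"
  then obtain R B where RB: "0 \<le> R" "0 \<le> B" "\<And>t. norm (f t) \<le> B * indicator {-R..R} t"
    using bumps_bounded by blast
  have "\<bar>t\<bar> ^ m * norm (f t) \<le> R ^ m * B" for t
  proof (cases "\<bar>t\<bar> \<le> R")
    case True
    have "B * indicator {-R..R} t \<le> B" using RB(2) by (auto simp: indicator_def)
    with RB(3)[of t] have "norm (f t) \<le> B" by linarith
    with True RB show ?thesis by (intro mult_mono power_mono) auto
  next
    case False
    then have "norm (f t) \<le> 0" using RB(3)[of t] by (auto simp: indicator_def abs_le_iff)
    then show ?thesis using RB by simp
  qed
  then show "bdd_above (range (\<lambda>t. \<bar>t\<bar> ^ m * norm (f t)))" by (auto simp: bdd_above_def)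
qed

subsection \<open>Density of the bump functions\<close>

text \<open>More general than \<open>weight\<close>: the density results are also applied with
  \<open>norm (d t)\<close> as the weight, for a locally integrable vector function d that may have
  zeros.\<close>

definition locally_integrable :: "(real \<Rightarrow> real) \<Rightarrow> bool" where
  "locally_integrable w \<longleftrightarrow> w \<in> borel_measurable lebesgue \<and>
     (\<forall>a b. (\<integral>\<^sup>+t\<in>{a..b}. ennreal (w t) \<partial>lebesgue) < \<infinity>)"

text \<open>Membership in the closure of \<open>bumps\<close>. Density is obtained by closing this
  predicate under the passage from intervals to Borel sets, Lebesgue sets, simple functions and
  finally all of \<open>Lpw p w\<close>.\<close>

definition bump_approximable :: "real \<Rightarrow> (real \<Rightarrow> real) \<Rightarrow> (real \<Rightarrow> 'x::real_normed_vector) \<Rightarrow> bool" where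
  "bump_approximable p w f \<longleftrightarrow> strongly_measurable f \<and>
     (\<forall>e>0. \<exists>g\<in>bumps. power_integral p w (\<lambda>t. f t - g t) < ennreal e)"

lemma bumps_strongly_measurable: "g \<in> bumps \<Longrightarrow> strongly_measurable g"
  using bumps_subset_schwartz schwartz_strongly_measurable by blast

lemma power_integral_bounded_support:
  fixes f :: "real \<Rightarrow> 'x::real_normed_vector"
  assumes w: "locally_integrable w" and p: "0 < p" and "0 \<le> B"
    and f: "\<And>t. norm (f t) \<le> B * indicator {-R..R} t"
  shows "power_integral p w f < \<infinity>"
proof -
  have [measurable]: "w \<in> borel_measurable lebesgue" using w by (simp add: locally_integrable_def)
  have [measurable]: "{-R..R} \<in> sets lebesgue" by simp
  have "ennreal (norm (f t) powr p) \<le> ennreal (B powr p) * indicator {-R..R} t" for t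
    using f[of t] p by (auto simp: indicator_def split: if_splits intro!: ennreal_leI powr_mono2)
  then have "power_integral p w f \<le>
      (\<integral>\<^sup>+t. ennreal (B powr p) * (ennreal (w t) * indicator {-R..R} t) \<partial>lebesgue)"
    unfolding power_integral_def by (intro nn_integral_mono) (metis mult.assoc mult.commute mult_right_mono zero_le)
  also have "\<dots> = ennreal (B powr p) * (\<integral>\<^sup>+t\<in>{-R..R}. ennreal (w t) \<partial>lebesgue)"
    by (rule nn_integral_cmult) measurable
  also have "\<dots> < \<infinity>" using w by (auto simp: locally_integrable_def ennreal_mult_less_top)
  finally show ?thesis .
qed

lemma bumps_power_integral:
  assumes "g \<in> bumps" "locally_integrable w" "0 < p"
  shows "power_integral p w g < \<infinity>"
  using bumps_bounded[OF assms(1)] power_integral_bounded_support[OF assms(2,3)] by metis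

lemma bump_approximable_close:
  fixes f :: "real \<Rightarrow> 'x::real_normed_vector"
  assumes p: "0 < p" and w: "locally_integrable w" and f: "strongly_measurable f"
    and close: "\<And>e. 0 < e \<Longrightarrow> \<exists>h. bump_approximable p w h \<and> power_integral p w (\<lambda>t. f t - h t) < ennreal e"
  shows "bump_approximable p w f"
  unfolding bump_approximable_def
proof (intro conjI allI impI f)
  fix e :: real assume e: "0 < e"
  \<comment> \<open>Chosen so that the quasi-triangle inequality with two errors d gives exactly
    e.\<close>
  define d where "d = e / (2 powr p * 2)"
  have d: "0 < d" using e by (simp add: d_def)
  obtain h where h: "bump_approximable p w h" "power_integral p w (\<lambda>t. f t - h t) < ennreal d" using close[OF d] by blast
  then obtain g where g: "g \<in> bumps" "power_integral p w (\<lambda>t. h t - g t) < ennreal d"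
    unfolding bump_approximable_def using d by blast
  have hm: "strongly_measurable h" using h by (simp add: bump_approximable_def)
  have "power_integral p w (\<lambda>t. f t - g t) \<le> ennreal (2 powr p) *
      (power_integral p w (\<lambda>t. f t - h t) + power_integral p w (\<lambda>t. h t - g t))"
  proof (rule power_integral_add_le)
    show "norm (f t - g t) \<le> norm (f t - h t) + norm (h t - g t)" for t
      using norm_triangle_ineq[of "f t - h t" "h t - g t"] by simp
    show "w \<in> borel_measurable lebesgue" using w by (simp add: locally_integrable_def)
  qed (use p f hm g bumps_strongly_measurable in \<open>auto intro!: strongly_measurable_diff\<close>)
  also have "\<dots> < ennreal (2 powr p) * (ennreal d + ennreal d)"
    by (intro ennreal_mult_strict_left_mono add_strict_mono h g) auto
  also have "\<dots> = ennreal e"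
    using d by (simp flip: ennreal_plus ennreal_mult) (simp add: d_def)
  finally show "\<exists>g\<in>bumps. power_integral p w (\<lambda>t. f t - g t) < ennreal e" using g by blast
qed

lemma bump_approximable_bumps: "g \<in> bumps \<Longrightarrow> bump_approximable p w g"
  unfolding bump_approximable_def
  by (auto intro!: bumps_strongly_measurable bexI[of _ g] simp: power_integral_def)

lemma bump_approximable_limit:
  fixes f :: "real \<Rightarrow> 'x::real_normed_vector"
  assumes p: "0 < p" and w: "locally_integrable w" and f: "strongly_measurable f"
    and h: "\<And>n. bump_approximable p w (h n)"
    and lim: "(\<lambda>n. power_integral p w (\<lambda>t. f t - h n t)) \<longlonglongrightarrow> 0"
  shows "bump_approximable p w f"
proof (rule bump_approximable_close[OF p w f])
  fix e :: real assume "0 < e"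
  then have "eventually (\<lambda>n. power_integral p w (\<lambda>t. f t - h n t) < ennreal e) sequentially"
    by (intro order_tendstoD[OF lim]) simp
  then obtain n where "power_integral p w (\<lambda>t. f t - h n t) < ennreal e"
    by (meson eventually_sequentially order_refl)
  with h show "\<exists>h. bump_approximable p w h \<and> power_integral p w (\<lambda>t. f t - h t) < ennreal e" by blast
qed

lemma bump_approximable_dominated:
  fixes f :: "real \<Rightarrow> 'x::real_normed_vector"
  assumes p: "0 < p" and w: "locally_integrable w"
    and h: "\<And>n. bump_approximable p w (h n)"
    and lim: "AE t in lebesgue. (\<lambda>n. h n t) \<longlonglongrightarrow> f t"
    and dom: "\<And>n t. norm (f t - h n t) \<le> norm (g t)"
    and g: "strongly_measurable g" "power_integral p w g < \<infinity>"
  shows "bump_approximable p w f"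
proof -
  have hm: "strongly_measurable (h n)" for n using h by (simp add: bump_approximable_def)
  have f: "strongly_measurable f" by (rule strongly_measurable_LIMSEQ[OF hm lim])
  have [measurable]: "w \<in> borel_measurable lebesgue" using w by (simp add: locally_integrable_def)
  have [measurable]: "(\<lambda>t. norm (f t - h n t)) \<in> borel_measurable lebesgue" for n
    by (intro strongly_measurable_norm strongly_measurable_diff f hm)
  have [measurable]: "(\<lambda>t. norm (g t)) \<in> borel_measurable lebesgue" by (rule strongly_measurable_norm[OF g(1)])
  have "(\<lambda>n. power_integral p w (\<lambda>t. f t - h n t)) \<longlonglongrightarrow> (\<integral>\<^sup>+(t::real). 0 \<partial>lebesgue)"
    unfolding power_integral_def
  proof (rule nn_integral_dominated_convergence[where w="\<lambda>t. ennreal (norm (g t) powr p) * ennreal (w t)"])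
    show "AE t in lebesgue. ennreal (norm (f t - h n t) powr p) * ennreal (w t)
        \<le> ennreal (norm (g t) powr p) * ennreal (w t)" for n
      using dom p by (intro AE_I2 mult_right_mono ennreal_leI powr_mono2) auto
    show "(\<integral>\<^sup>+t. ennreal (norm (g t) powr p) * ennreal (w t) \<partial>lebesgue) < \<infinity>"
      using g(2) by (simp add: power_integral_def)
    show "AE t in lebesgue. (\<lambda>n. ennreal (norm (f t - h n t) powr p) * ennreal (w t)) \<longlonglongrightarrow> 0"
      using lim
    proof eventually_elim
      case (elim t)
      have "(\<lambda>n. norm (f t - h n t)) \<longlonglongrightarrow> norm (f t - f t)" by (intro tendsto_intros elim)
      then have "(\<lambda>n. norm (f t - h n t) powr p) \<longlonglongrightarrow> 0 powr p"
        using p by (intro tendsto_powr') auto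
      then have "(\<lambda>n. ennreal (norm (f t - h n t) powr p)) \<longlonglongrightarrow> ennreal 0"
        using p by (intro tendsto_ennrealI) simp
      then have "(\<lambda>n. ennreal (norm (f t - h n t) powr p) * ennreal (w t)) \<longlonglongrightarrow> ennreal 0 * ennreal (w t)"
        by (intro tendsto_mult_ennreal tendsto_const) auto
      then show ?case by simp
    qed
  qed measurable
  then show ?thesis by (intro bump_approximable_limit[OF p w f h]) simp
qed

lemma bump_approximable_add:
  fixes f g :: "real \<Rightarrow> 'x::real_normed_vector"
  assumes p: "0 < p" and w: "locally_integrable w" and f: "bump_approximable p w f" and g: "bump_approximable p w g"
  shows "bump_approximable p w (\<lambda>t. f t + g t)"
  unfolding bump_approximable_def
proof (intro conjI allI impI)
  have m: "strongly_measurable f" "strongly_measurable g" using f g by (auto simp: bump_approximable_def)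
  then show "strongly_measurable (\<lambda>t. f t + g t)" by (rule strongly_measurable_add)
  fix e :: real assume e: "0 < e"
  define d where "d = e / (2 powr p * 2)"
  have d: "0 < d" using e by (simp add: d_def)
  obtain u v where uv: "u \<in> bumps" "v \<in> bumps" "power_integral p w (\<lambda>t. f t - u t) < ennreal d"
    "power_integral p w (\<lambda>t. g t - v t) < ennreal d"
    using f g d unfolding bump_approximable_def by meson
  have "power_integral p w (\<lambda>t. f t + g t - (u t + v t)) \<le> ennreal (2 powr p) *
      (power_integral p w (\<lambda>t. f t - u t) + power_integral p w (\<lambda>t. g t - v t))"
  proof (rule power_integral_add_le)
    show "norm (f t + g t - (u t + v t)) \<le> norm (f t - u t) + norm (g t - v t)" for t
      using norm_triangle_ineq[of "f t - u t" "g t - v t"] by (simp add: algebra_simps)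
    show "w \<in> borel_measurable lebesgue" using w by (simp add: locally_integrable_def)
  qed (use p m uv bumps_strongly_measurable in \<open>auto intro!: strongly_measurable_diff\<close>)
  also have "\<dots> < ennreal (2 powr p) * (ennreal d + ennreal d)"
    by (intro ennreal_mult_strict_left_mono add_strict_mono uv) auto
  also have "\<dots> = ennreal e"
    using d by (simp flip: ennreal_plus ennreal_mult) (simp add: d_def)
  finally show "\<exists>h\<in>bumps. power_integral p w (\<lambda>t. f t + g t - h t) < ennreal e"
    by (intro bexI[of _ "\<lambda>t. u t + v t"] bumps.add uv)
qed

lemma bumps_uminus: "f \<in> bumps \<Longrightarrow> (\<lambda>t. - f t) \<in> bumps"
proof (induction rule: bumps.induct)
  case (base k i a j b x)
  then show ?case using bumps.base[of k i a j b "- x"] by simp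
next
  case (add f g)
  then show ?case using bumps.add[of "\<lambda>t. - f t" "\<lambda>t. - g t"] by simp
qed

lemma bump_approximable_uminus:
  assumes f: "bump_approximable p w f" shows "bump_approximable p w (\<lambda>t. - f t)"
  unfolding bump_approximable_def
proof (intro conjI allI impI)
  show "strongly_measurable (\<lambda>t. - f t)"
    using f by (intro strongly_measurable_compose[of f uminus]) (auto simp: bump_approximable_def intro!: continuous_intros)
  fix e :: real assume "0 < e"
  then obtain g where g: "g \<in> bumps" "power_integral p w (\<lambda>t. f t - g t) < ennreal e"
    using f unfolding bump_approximable_def by blast
  have "power_integral p w (\<lambda>t. - f t - - g t) = power_integral p w (\<lambda>t. f t - g t)"
    by (intro power_integral_cong_norm AE_I2) (simp add: norm_minus_commute)
  with g have "power_integral p w (\<lambda>t. - f t - - g t) < ennreal e" by (simp only:)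
  then show "\<exists>h\<in>bumps. power_integral p w (\<lambda>t. - f t - h t) < ennreal e"
    using bumps_uminus[OF g(1)] by (intro bexI[of _ "\<lambda>t. - g t"])
qed

lemma bump_approximable_AE_eq:
  assumes f: "bump_approximable p w f" and eq: "AE t in lebesgue. f t = g t"
  shows "bump_approximable p w g"
proof -
  have "power_integral p w (\<lambda>t. g t - h t) = power_integral p w (\<lambda>t. f t - h t)" for h
    by (rule power_integral_cong_norm) (use eq in eventually_elim, simp)
  then show ?thesis using f eq strongly_measurable_AE_eq[of f g] unfolding bump_approximable_def by simp
qed

lemma bump_approximable_zero: "bump_approximable p w (\<lambda>t. 0)"
  using bump_approximable_bumps[OF bumps.base[of 1 0 0 0 0 0]] by simp

text \<open>\<open>flat 0\<close> has values in [0, 1], vanishes for s <= 0, and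
  \<open>flat 0 (k * s)\<close> tends to 1 for s > 0. Bumps of growing dilation therefore converge
  to the indicator at every point, endpoints included because the interval is open.\<close>

lemma bump_approximable_interval:
  assumes p: "0 < p" and w: "locally_integrable w"
  shows "bump_approximable p w (\<lambda>t. indicator {a<..<b} t *\<^sub>R x)"
proof -
  define h where "h n t = (flat 0 (real (Suc n) * (t - a)) * flat 0 (real (Suc n) * (b - t))) *\<^sub>R x" for n t
  let ?R = "max \<bar>a\<bar> \<bar>b\<bar>"
  have flat: "0 \<le> flat 0 s" "flat 0 s \<le> 1" for s by (auto simp: flat_def)
  have flat_lim: "(\<lambda>n. flat 0 (real (Suc n) * s)) \<longlonglongrightarrow> 1" if "0 < s" for s
  proof -
    have "(\<lambda>n. exp (- (1 / s * inverse (real (Suc n))))) \<longlonglongrightarrow> exp (- (1 / s * 0))"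
      by (intro tendsto_intros LIMSEQ_inverse_real_of_nat)
    moreover have "exp (- (1 / s * inverse (real (Suc n)))) = flat 0 (real (Suc n) * s)" for n
      using that by (simp add: flat_def mult_le_0_iff divide_inverse del: of_nat_Suc)
    ultimately show ?thesis by simp
  qed
  have flat_0: "flat 0 (real (Suc n) * s) = 0" if "s \<le> 0" for n s
    using that by (simp add: flat_def mult_nonneg_nonpos del: of_nat_Suc)
  show ?thesis
  proof (rule bump_approximable_dominated[OF p w, of h])
    show "bump_approximable p w (h n)" for n
      unfolding h_def by (intro bump_approximable_bumps bumps.base) simp
    show "AE t in lebesgue. (\<lambda>n. h n t) \<longlonglongrightarrow> indicator {a<..<b} t *\<^sub>R x"
    proof (rule AE_I2)
      fix t
      show "(\<lambda>n. h n t) \<longlonglongrightarrow> indicator {a<..<b} t *\<^sub>R x"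
      proof (cases "a < t \<and> t < b")
        case True
        then have "(\<lambda>n. h n t) \<longlonglongrightarrow> (1 * 1) *\<^sub>R x"
          unfolding h_def by (intro tendsto_intros flat_lim) auto
        with True show ?thesis by simp
      next
        case False
        then have "h n t = 0" for n using flat_0[of "t - a"] flat_0[of "b - t"] by (auto simp: h_def)
        with False show ?thesis by auto
      qed
    qed
    show "norm (indicator {a<..<b} t *\<^sub>R x - h n t) \<le> norm (indicat_real {a..b} t *\<^sub>R x)" for n t
    proof (cases "a < t \<and> t < b")
      case True
      define r where "r = flat 0 (real (Suc n) * (t - a)) * flat 0 (real (Suc n) * (b - t))"
      have r: "0 \<le> r" "r \<le> 1" unfolding r_def using flat by (auto intro!: mult_le_one)
      have "indicator {a<..<b} t *\<^sub>R x - h n t = (1 - r) *\<^sub>R x"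
        using True by (simp add: h_def r_def scaleR_diff_left)
      then have "norm (indicator {a<..<b} t *\<^sub>R x - h n t) = (1 - r) * norm x" using r by simp
      with r True show ?thesis by (simp add: mult_left_le_one_le)
    next
      case False
      then have "h n t = 0" for n using flat_0[of "t - a"] flat_0[of "b - t"] by (auto simp: h_def)
      with False show ?thesis by auto
    qed
    show "strongly_measurable (\<lambda>t. indicat_real {a..b} t *\<^sub>R x)"
      by (rule strongly_measurable_indicator_scaleR) simp
    show "power_integral p w (\<lambda>t. indicat_real {a..b} t *\<^sub>R x) < \<infinity>"
      by (rule power_integral_bounded_support[OF w p, of "norm x" _ ?R]) (auto simp: indicator_def)
  qed
qed

lemma bump_approximable_sum:
  assumes "0 < p" "locally_integrable w" "finite S" "\<And>i. i \<in> S \<Longrightarrow> bump_approximable p w (f i)"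
  shows "bump_approximable p w (\<lambda>t. \<Sum>i\<in>S. f i t)"
  using assms(3,4) by (induction S rule: finite_induct)
    (auto intro!: bump_approximable_zero bump_approximable_add assms(1,2))

text \<open>A Dynkin system argument from open intervals. The intersection with a bounded window is
  kept throughout because complements have to stay integrable against a weight that is only locally
  integrable.\<close>

lemma bump_approximable_borel:
  assumes p: "0 < p" and w: "locally_integrable w" and A: "A \<in> sets borel"
  shows "bump_approximable p w (\<lambda>t. indicator (A \<inter> {-real n<..<real n}) t *\<^sub>R x)"
proof -
  define I where "I = {-real n<..<real n}"
  define G where "G = range (\<lambda>(a, b). {a<..<b::real})"
  have "Int_stable G"
  proof (rule Int_stableI)
    fix A B assume "A \<in> G" "B \<in> G"
    then obtain a b c d where AB: "A = {a<..<b}" "B = {c<..<d}" unfolding G_def by auto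
    have "A \<inter> B = (\<lambda>(a, b). {a<..<b}) (max a c, min b d)" unfolding AB by auto
    then show "A \<inter> B \<in> G" unfolding G_def by blast
  qed
  moreover have "G \<subseteq> Pow UNIV" by simp
  moreover have "A \<in> sigma_sets UNIV G"
    using A unfolding G_def by (simp add: borel_eq_box box_real case_prod_beta')
  ultimately show ?thesis
    unfolding I_def[symmetric]
  proof (induction rule: sigma_sets_induct_disjoint)
    case (basic A)
    then obtain a b where "A = {a<..<b}" unfolding G_def by auto
    then have "A \<inter> I = {max a (- real n)<..<min b (real n)}" unfolding I_def by auto
    then show ?case using bump_approximable_interval[OF p w] by simp
  next
    case empty
    then show ?case using bump_approximable_zero by simp
  next
    case (compl A)
    have "bump_approximable p w (\<lambda>t. indicator I t *\<^sub>R x + - (indicator (A \<inter> I) t *\<^sub>R x))"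
      unfolding I_def
      by (intro bump_approximable_add[OF p w] bump_approximable_uminus bump_approximable_interval[OF p w])
        (use compl in \<open>simp add: I_def\<close>)
    moreover have "indicator I t *\<^sub>R x + - (indicator (A \<inter> I) t *\<^sub>R x) = indicator ((UNIV - A) \<inter> I) t *\<^sub>R x" for t
      by (auto simp: indicator_def)
    ultimately show ?case by simp
  next
    case (union A)
    define h where "h N t = (\<Sum>i<N. indicator (A i \<inter> I) t *\<^sub>R x)" for N t
    have h_eq: "h N t = indicator ((\<Union>i<N. A i) \<inter> I) t *\<^sub>R x" for N t
    proof -
      have "disjoint_family_on (\<lambda>i. A i \<inter> I) {..<N}"
        using union(1) by (auto simp: disjoint_family_on_def)
      then have "(indicator (\<Union>i<N. A i \<inter> I) t :: real) = (\<Sum>i<N. indicator (A i \<inter> I) t)"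
        by (subst indicator_UN_disjoint) auto
      moreover have "(\<Union>i<N. A i \<inter> I) = (\<Union>i<N. A i) \<inter> I" by blast
      ultimately show ?thesis unfolding h_def by (simp add: scaleR_sum_left)
    qed
    show ?case
    proof (rule bump_approximable_dominated[OF p w, of h])
      show "bump_approximable p w (h N)" for N
        unfolding h_def by (intro bump_approximable_sum[OF p w] union) auto
      show "AE t in lebesgue. (\<lambda>N. h N t) \<longlonglongrightarrow> indicator (\<Union> (range A) \<inter> I) t *\<^sub>R x"
      proof (rule AE_I2)
        fix t
        show "(\<lambda>N. h N t) \<longlonglongrightarrow> indicator (\<Union> (range A) \<inter> I) t *\<^sub>R x"
        proof (cases "t \<in> \<Union> (range A)")
          case True
          then obtain i where "t \<in> A i" by blast
          then have "h N t = indicator (\<Union> (range A) \<inter> I) t *\<^sub>R x" if "i < N" for N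
            using that unfolding h_eq by (auto simp: indicator_def)
          then show ?thesis by (intro tendsto_eventually) (auto simp: eventually_sequentially intro!: exI[of _ "Suc i"])
        next
          case False
          then show ?thesis unfolding h_eq by (auto simp: indicator_def)
        qed
      qed
      show "norm (indicator (\<Union> (range A) \<inter> I) t *\<^sub>R x - h N t) \<le> norm (indicat_real I t *\<^sub>R x)" for N t
        unfolding h_eq by (auto simp: indicator_def)
      show "strongly_measurable (\<lambda>t. indicat_real I t *\<^sub>R x)"
        by (rule strongly_measurable_indicator_scaleR) (simp add: I_def)
      show "power_integral p w (\<lambda>t. indicat_real I t *\<^sub>R x) < \<infinity>"
        by (rule power_integral_bounded_support[OF w p, of "norm x" _ n]) (auto simp: I_def indicator_def)
    qed
  qed
qed

lemma bump_approximable_indicator: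
  assumes p: "0 < p" and w: "locally_integrable w" and E: "E \<in> sets lebesgue" "E \<subseteq> {-real n<..<real n}"
  shows "bump_approximable p w (\<lambda>t. indicator E t *\<^sub>R x)"
proof -
  obtain S N N' where S: "E = S \<union> N" "N \<subseteq> N'" "N' \<in> null_sets lborel" "S \<in> sets lborel"
    using E(1) by (rule sets_completionE)
  have "AE t in lebesgue. t \<notin> N'" by (intro AE_not_in null_sets_completionI S)
  then have "AE t in lebesgue. indicator (S \<inter> {-real n<..<real n}) t *\<^sub>R x = indicator E t *\<^sub>R x"
    by eventually_elim (use S(1,2) E(2) in \<open>auto simp: indicator_def\<close>)
  moreover have "S \<in> sets borel" using S(4) by simp
  ultimately show ?thesis
    using bump_approximable_AE_eq[OF bump_approximable_borel[OF p w]] by fast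
qed

lemma bump_approximable_simple:
  fixes s :: "real \<Rightarrow> 'x::real_normed_vector"
  assumes p: "0 < p" and w: "locally_integrable w" and s: "simple_function lebesgue s"
    and supp: "\<And>t. s t \<noteq> 0 \<Longrightarrow> \<bar>t\<bar> < real n"
  shows "bump_approximable p w s"
proof -
  have fin: "finite (range s)" using simple_functionD(1)[OF s] by simp
  have E: "s -` {y} \<in> sets lebesgue" for y using simple_functionD(2)[OF s, of "{y}"] by simp
  have "bump_approximable p w (\<lambda>t. indicator (s -` {y}) t *\<^sub>R y)" for y
  proof (cases "y = 0")
    case True
    then show ?thesis using bump_approximable_zero by simp
  next
    case False
    then have "s -` {y} \<subseteq> {-real n<..<real n}" using supp by (force simp: abs_less_iff)
    then show ?thesis by (rule bump_approximable_indicator[OF p w E])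
  qed
  then have "bump_approximable p w (\<lambda>t. \<Sum>y\<in>range s. indicator (s -` {y}) t *\<^sub>R y)"
    by (intro bump_approximable_sum[OF p w fin])
  moreover have "(\<Sum>y\<in>range s. indicator (s -` {y}) t *\<^sub>R y) = s t" for t
  proof -
    have "(\<Sum>y\<in>range s. indicator (s -` {y}) t *\<^sub>R y) = (\<Sum>y\<in>range s. if y = s t then y else 0)"
      by (intro sum.cong) (auto simp: indicator_def)
    then show ?thesis using fin by simp
  qed
  ultimately show ?thesis by simp
qed

lemma bump_approximable_Lpw:
  fixes f :: "real \<Rightarrow> 'x::real_normed_vector"
  assumes p: "0 < p" and w: "locally_integrable w"
    and f: "strongly_measurable f" "power_integral p w f < \<infinity>"
  shows "bump_approximable p w f"
proof -
  obtain s where s: "\<And>n. simple_function lebesgue (s n)" "AE t in lebesgue. (\<lambda>n. s n t) \<longlonglongrightarrow> f t"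
    using f(1) unfolding strongly_measurable_def by blast
  have [measurable]: "(\<lambda>t. norm (f t)) \<in> borel_measurable lebesgue" by (rule strongly_measurable_norm[OF f(1)])
  have [measurable]: "(\<lambda>t. norm (s n t)) \<in> borel_measurable lebesgue" for n
    by (intro strongly_measurable_norm strongly_measurable_simple s)
  \<comment> \<open>The truncation yields the dominating function 3 |f| and bounded support. Any
    factor above 1 in place of 2 lets the condition hold eventually where f is nonzero; where f
    vanishes the truncated function is 0.\<close>
  define A where "A n = {t. norm (s n t) \<le> 2 * norm (f t) \<and> \<bar>t\<bar> < real n}" for n
  have A: "A n \<in> sets lebesgue" for n
  proof -
    have "{t \<in> space lebesgue. norm (s n t) \<le> 2 * norm (f t)} \<in> sets lebesgue" by measurable
    moreover have "{-real n<..<real n} \<in> sets lebesgue" by simp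
    moreover have "A n = {t \<in> space lebesgue. norm (s n t) \<le> 2 * norm (f t)} \<inter> {-real n<..<real n}"
      by (auto simp: A_def)
    ultimately show ?thesis by (simp only: sets.Int)
  qed
  define h where "h n t = indicat_real (A n) t *\<^sub>R s n t" for n t
  show ?thesis
  proof (rule bump_approximable_dominated[OF p w, of h])
    fix n
    have "simple_function lebesgue (h n)"
      unfolding h_def by (rule simple_function_compose2[where h="(*\<^sub>R)", OF simple_function_indicator[OF A] s(1)])
    then show "bump_approximable p w (h n)"
      by (rule bump_approximable_simple[OF p w, of _ n]) (auto simp: h_def A_def indicator_def split: if_splits)
  next
    show "AE t in lebesgue. (\<lambda>n. h n t) \<longlonglongrightarrow> f t"
      using s(2)
    proof eventually_elim
      case (elim t)
      show ?case
      proof (cases "f t = 0")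
        case True
        then have "h n t = 0" for n by (auto simp: h_def A_def indicator_def)
        with True show ?thesis by simp
      next
        case False
        have "(\<lambda>n. norm (s n t)) \<longlonglongrightarrow> norm (f t)" by (intro tendsto_norm elim)
        then have "eventually (\<lambda>n. norm (s n t) < 2 * norm (f t)) sequentially"
          using False by (intro order_tendstoD) auto
        moreover have "eventually (\<lambda>n. \<bar>t\<bar> < real n) sequentially"
          using filterlim_real_sequentially by (auto simp: filterlim_at_top_dense)
        ultimately have "eventually (\<lambda>n. s n t = h n t) sequentially"
          by eventually_elim (auto simp: h_def A_def indicator_def)
        then show ?thesis by (rule Lim_transform_eventually[OF elim])
      qed
    qed
    show "norm (f t - h n t) \<le> norm (3 *\<^sub>R f t)" for n t
    proof -
      have "norm (h n t) \<le> 2 * norm (f t)" by (auto simp: h_def A_def indicator_def)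
      then show ?thesis using norm_triangle_ineq4[of "f t" "h n t"] by simp
    qed
    show "strongly_measurable (\<lambda>t. 3 *\<^sub>R f t)"
      by (intro strongly_measurable_scaleR strongly_measurable_const f)
    have "power_integral p w (\<lambda>t. 3 *\<^sub>R f t) = ennreal (3 powr p) * power_integral p w f"
      by (rule power_integral_scale[OF f(1)]) (use w in \<open>auto simp: locally_integrable_def\<close>)
    then show "power_integral p w (\<lambda>t. 3 *\<^sub>R f t) < \<infinity>" using f(2) by (simp add: ennreal_mult_less_top)
  qed
qed

subsection \<open>Functions representing a distribution\<close>

lemma has_strong_integral_AE_eq:
  assumes f: "has_strong_integral f I" and eq: "AE t in lebesgue. f t = g t"
  shows "has_strong_integral g I"
proof -
  have "strongly_measurable g"
    using f eq strongly_measurable_AE_eq unfolding has_strong_integral_def by blast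
  moreover have "(\<integral>\<^sup>+t. ennreal (norm (f t - s i t)) \<partial>lebesgue) =
      (\<integral>\<^sup>+t. ennreal (norm (g t - s i t)) \<partial>lebesgue)" for s :: "nat \<Rightarrow> real \<Rightarrow> 'a" and i
    by (rule nn_integral_cong_AE) (use eq in eventually_elim, simp)
  ultimately show ?thesis using f unfolding has_strong_integral_def by simp
qed

lemma has_strong_integral_add:
  fixes f g :: "real \<Rightarrow> 'x::real_normed_vector"
  assumes f: "has_strong_integral f I" and g: "has_strong_integral g J"
  shows "has_strong_integral (\<lambda>t. f t + g t) (I + J)"
proof -
  obtain s where s: "strongly_measurable f" "\<And>i. Bochner_Integration.simple_bochner_integrable lebesgue (s i)"
    "(\<lambda>i. \<integral>\<^sup>+t. ennreal (norm (f t - s i t)) \<partial>lebesgue) \<longlonglongrightarrow> 0"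
    "(\<lambda>i. Bochner_Integration.simple_bochner_integral lebesgue (s i)) \<longlonglongrightarrow> I"
    using f unfolding has_strong_integral_def by blast
  obtain r where r: "strongly_measurable g" "\<And>i. Bochner_Integration.simple_bochner_integrable lebesgue (r i)"
    "(\<lambda>i. \<integral>\<^sup>+t. ennreal (norm (g t - r i t)) \<partial>lebesgue) \<longlonglongrightarrow> 0"
    "(\<lambda>i. Bochner_Integration.simple_bochner_integral lebesgue (r i)) \<longlonglongrightarrow> J"
    using g unfolding has_strong_integral_def by blast
  have sr: "strongly_measurable (s i)" "strongly_measurable (r i)" for i
    using s(2)[of i] r(2)[of i] by (auto elim!: simple_bochner_integrable.cases intro: strongly_measurable_simple)
  have [measurable]: "(\<lambda>t. norm (f t - s i t)) \<in> borel_measurable lebesgue"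
    "(\<lambda>t. norm (g t - r i t)) \<in> borel_measurable lebesgue" for i
    by (intro strongly_measurable_norm strongly_measurable_diff s(1) r(1) sr)+
  show ?thesis
    unfolding has_strong_integral_def
  proof (intro conjI exI[of _ "\<lambda>i t. s i t + r i t"] allI)
    show "strongly_measurable (\<lambda>t. f t + g t)" by (intro strongly_measurable_add s r)
    show "Bochner_Integration.simple_bochner_integrable lebesgue (\<lambda>t. s i t + r i t)" for i
      by (rule simple_bochner_integrable_compose2[where p="(+)"]) (auto intro: s r)
    show "(\<lambda>i. Bochner_Integration.simple_bochner_integral lebesgue (\<lambda>t. s i t + r i t)) \<longlonglongrightarrow> I + J"
      by (subst simple_bochner_integral_add[OF s(2) r(2)]) (intro tendsto_add s r)
    show "(\<lambda>i. \<integral>\<^sup>+t. ennreal (norm (f t + g t - (s i t + r i t))) \<partial>lebesgue) \<longlonglongrightarrow> 0"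
    proof (rule tendsto_sandwich[OF _ _ tendsto_const])
      show "(\<lambda>i. (\<integral>\<^sup>+t. ennreal (norm (f t - s i t)) \<partial>lebesgue) +
          (\<integral>\<^sup>+t. ennreal (norm (g t - r i t)) \<partial>lebesgue)) \<longlonglongrightarrow> 0"
        using tendsto_add[OF s(3) r(3)] by simp
      have "(\<integral>\<^sup>+t. ennreal (norm (f t + g t - (s i t + r i t))) \<partial>lebesgue) \<le>
          (\<integral>\<^sup>+t. ennreal (norm (f t - s i t)) + ennreal (norm (g t - r i t)) \<partial>lebesgue)" for i
        by (intro nn_integral_mono) (simp flip: ennreal_plus add: ennreal_leI norm_diff_triangle_ineq)
      also have "\<And>i. \<dots> i = (\<integral>\<^sup>+t. ennreal (norm (f t - s i t)) \<partial>lebesgue) +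
          (\<integral>\<^sup>+t. ennreal (norm (g t - r i t)) \<partial>lebesgue)"
        by (rule nn_integral_add) measurable
      finally show "\<forall>\<^sub>F i in sequentially. (\<integral>\<^sup>+t. ennreal (norm (f t + g t - (s i t + r i t))) \<partial>lebesgue)
          \<le> (\<integral>\<^sup>+t. ennreal (norm (f t - s i t)) \<partial>lebesgue) +
          (\<integral>\<^sup>+t. ennreal (norm (g t - r i t)) \<partial>lebesgue)" by simp
    qed simp
  qed
qed

lemma has_strong_integral_bounded_linear:
  fixes f :: "real \<Rightarrow> 'x::real_normed_vector" and L :: "'x \<Rightarrow> 'y::real_normed_vector"
  assumes f: "has_strong_integral f I" and L: "bounded_linear L"
  shows "has_strong_integral (\<lambda>t. L (f t)) (L I)"
proof -
  interpret L: bounded_linear L by fact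
  obtain K where K: "0 < K" "\<And>x. norm (L x) \<le> norm x * K" using L.pos_bounded by blast
  obtain s where s: "strongly_measurable f" "\<And>i. Bochner_Integration.simple_bochner_integrable lebesgue (s i)"
    "(\<lambda>i. \<integral>\<^sup>+t. ennreal (norm (f t - s i t)) \<partial>lebesgue) \<longlonglongrightarrow> 0"
    "(\<lambda>i. Bochner_Integration.simple_bochner_integral lebesgue (s i)) \<longlonglongrightarrow> I"
    using f unfolding has_strong_integral_def by blast
  have "strongly_measurable (s i)" for i
    using s(2)[of i] by (auto elim!: simple_bochner_integrable.cases intro: strongly_measurable_simple)
  then have [measurable]: "(\<lambda>t. norm (f t - s i t)) \<in> borel_measurable lebesgue" for i
    by (intro strongly_measurable_norm strongly_measurable_diff s)
  show ?thesis
    unfolding has_strong_integral_def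
  proof (intro conjI exI[of _ "\<lambda>i t. L (s i t)"] allI)
    show "strongly_measurable (\<lambda>t. L (f t))"
      by (rule strongly_measurable_compose[OF s(1)]) (rule L.continuous_on[OF continuous_on_id])
    show "Bochner_Integration.simple_bochner_integrable lebesgue (\<lambda>t. L (s i t))" for i
      by (rule simple_bochner_integrable_compose2[where p="\<lambda>x y. L x", OF _ s(2) s(2)]) (simp add: L.zero)
    show "(\<lambda>i. Bochner_Integration.simple_bochner_integral lebesgue (\<lambda>t. L (s i t))) \<longlonglongrightarrow> L I"
      by (subst simple_bochner_integral_linear[OF L.linear s(2)]) (intro L.tendsto s)
    show "(\<lambda>i. \<integral>\<^sup>+t. ennreal (norm (L (f t) - L (s i t))) \<partial>lebesgue) \<longlonglongrightarrow> 0"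
    proof (rule tendsto_sandwich[OF _ _ tendsto_const])
      show "(\<lambda>i. ennreal K * (\<integral>\<^sup>+t. ennreal (norm (f t - s i t)) \<partial>lebesgue)) \<longlonglongrightarrow> 0"
        using ennreal_tendsto_cmult[OF _ s(3), of "ennreal K"] by simp
      have "(\<integral>\<^sup>+t. ennreal (norm (L (f t) - L (s i t))) \<partial>lebesgue) \<le>
          (\<integral>\<^sup>+t. ennreal K * ennreal (norm (f t - s i t)) \<partial>lebesgue)" for i
        using K by (intro nn_integral_mono)
          (simp flip: ennreal_mult L.diff add: ennreal_leI mult.commute[of K])
      also have "\<And>i. \<dots> i = ennreal K * (\<integral>\<^sup>+t. ennreal (norm (f t - s i t)) \<partial>lebesgue)"
        by (rule nn_integral_cmult) measurable
      finally show "\<forall>\<^sub>F i in sequentially. (\<integral>\<^sup>+t. ennreal (norm (L (f t) - L (s i t))) \<partial>lebesgue)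
          \<le> ennreal K * (\<integral>\<^sup>+t. ennreal (norm (f t - s i t)) \<partial>lebesgue)" by simp
    qed simp
  qed
qed

lemma represents_add:
  assumes "represents f u" "represents g v" "\<And>\<phi>. \<phi> \<in> schwartz \<Longrightarrow> z \<phi> = u \<phi> + v \<phi>"
  shows "represents (\<lambda>t. f t + g t) z"
  unfolding represents_def
proof
  fix \<phi> :: "real \<Rightarrow> complex" assume "\<phi> \<in> schwartz"
  then show "has_strong_integral (\<lambda>t. scaleC (\<phi> t) (f t + g t)) (z \<phi>)"
    using assms has_strong_integral_add[of "\<lambda>t. scaleC (\<phi> t) (f t)" "u \<phi>" "\<lambda>t. scaleC (\<phi> t) (g t)" "v \<phi>"]
    unfolding represents_def by (simp add: scaleC_add_right)
qed

lemma represents_scaleC: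
  assumes "represents f u" "\<And>\<phi>. \<phi> \<in> schwartz \<Longrightarrow> z \<phi> = scaleC c (u \<phi>)"
  shows "represents (\<lambda>t. scaleC c (f t)) z"
  unfolding represents_def
proof
  fix \<phi> :: "real \<Rightarrow> complex" assume "\<phi> \<in> schwartz"
  then have "has_strong_integral (\<lambda>t. scaleC c (scaleC (\<phi> t) (f t))) (z \<phi>)"
    using assms has_strong_integral_bounded_linear[OF _ bounded_linear_scaleC, of "\<lambda>t. scaleC (\<phi> t) (f t)" "u \<phi>" c]
    unfolding represents_def by simp
  then show "has_strong_integral (\<lambda>t. scaleC (\<phi> t) (scaleC c (f t))) (z \<phi>)"
    by (simp add: scaleC_scaleC mult.commute)
qed

lemma represents_AE_eq:
  assumes "represents f u" and eq: "AE t in lebesgue. f t = g t"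
  shows "represents g u"
  unfolding represents_def
proof
  fix \<phi> :: "real \<Rightarrow> complex" assume "\<phi> \<in> schwartz"
  then have "has_strong_integral (\<lambda>t. scaleC (\<phi> t) (f t)) (u \<phi>)" using assms(1) by (simp add: represents_def)
  then show "has_strong_integral (\<lambda>t. scaleC (\<phi> t) (g t)) (u \<phi>)"
    by (rule has_strong_integral_AE_eq) (use eq in eventually_elim, simp)
qed

lemma bump_approximableD:
  "bump_approximable p w f \<Longrightarrow> 0 < e \<Longrightarrow> \<exists>g\<in>bumps. power_integral p w (\<lambda>t. f t - g t) < ennreal e"
  by (simp add: bump_approximable_def)

lemma locally_integrable_norm: "d \<in> L1_loc \<Longrightarrow> locally_integrable (\<lambda>t. norm (d t))"
  by (auto simp: locally_integrable_def L1_loc_def intro: strongly_measurable_norm)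

text \<open>By essential separability, countably many balls around points y with radius |y| / 2
  cover the nonzero values of d up to a null set, so one of them has a preimage of positive measure.
  The bound on |t| makes that measure finite.\<close>

lemma nonzero_AE_obtains_ball:
  fixes d :: "real \<Rightarrow> 'x::real_normed_vector"
  assumes d: "strongly_measurable d" and nz: "\<not> (AE t in lebesgue. d t = 0)"
  obtains y and n :: nat where "y \<noteq> 0" "{t. norm (d t - y) < norm y / 2 \<and> \<bar>t\<bar> < real n} \<in> sets lebesgue"
    "emeasure lebesgue {t. norm (d t - y) < norm y / 2 \<and> \<bar>t\<bar> < real n} \<noteq> 0"
proof -
  define E where "E y n = {t. norm (d t - y) < norm y / 2 \<and> \<bar>t\<bar> < real n}" for y n
  obtain D where D: "countable D" "AE t in lebesgue. d t \<in> closure D"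
    using strongly_measurable_separable[OF d] by blast
  have E: "E y n \<in> sets lebesgue" for y n
  proof -
    have [measurable]: "(\<lambda>t. norm (d t - y)) \<in> borel_measurable lebesgue"
      by (intro strongly_measurable_norm strongly_measurable_diff d strongly_measurable_const)
    have "{t \<in> space lebesgue. norm (d t - y) < norm y / 2} \<in> sets lebesgue" by measurable
    moreover have "{-real n<..<real n} \<in> sets lebesgue" by simp
    moreover have "E y n = {t \<in> space lebesgue. norm (d t - y) < norm y / 2} \<inter> {-real n<..<real n}"
      by (auto simp: E_def)
    ultimately show ?thesis by (simp only: sets.Int)
  qed
  have "\<exists>y\<in>D. \<exists>n. emeasure lebesgue (E y n) \<noteq> 0"
  proof (rule ccontr)
    assume "\<not> ?thesis"
    then have "E y n \<in> null_sets lebesgue" if "y \<in> D" for y n using that E by (auto simp: null_sets_def)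
    then have "AE t in lebesgue. t \<notin> E y n" if "y \<in> D" for y n using that by (intro AE_not_in)
    then have "AE t in lebesgue. \<forall>y\<in>D. \<forall>n. t \<notin> E y n"
      using D(1) by (simp add: AE_ball_countable AE_all_countable)
    then have "AE t in lebesgue. d t = 0"
      using D(2)
    proof eventually_elim
      case (elim t)
      show ?case
      proof (rule ccontr)
        assume nz: "d t \<noteq> 0"
        \<comment> \<open>With |d - y| < |d| / 3 one has |y| > 2 |d| / 3, hence |d - y| < |y| / 2;
          this is where the third comes from.\<close>
        then obtain y where y: "y \<in> D" "dist y (d t) < norm (d t) / 3"
          using elim(2) unfolding closure_approachable by (metis divide_pos_pos zero_less_norm_iff zero_less_numeral)
        have "norm (d t) \<le> norm (d t - y) + norm y" using norm_triangle_ineq[of "d t - y" y] by simp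
        with y have "norm (d t - y) < norm y / 2" by (simp add: dist_norm norm_minus_commute)
        moreover obtain n where "\<bar>t\<bar> < real n" using reals_Archimedean2 by blast
        ultimately have "t \<in> E y n" by (simp add: E_def)
        with elim(1) y(1) show False by blast
      qed
    qed
    with nz show False by contradiction
  qed
  then obtain y n where yn: "emeasure lebesgue (E y n) \<noteq> 0" by blast
  have "y \<noteq> 0"
  proof
    assume "y = 0"
    then have "E y n = {}" by (auto simp: E_def)
    with yn show False by simp
  qed
  then show thesis using that[OF _ E[of y n, unfolded E_def] yn[unfolded E_def]] by blast
qed

lemma simple_bochner_integral_indicator_scaleR:
  fixes E :: "real set"
  assumes E: "E \<in> sets lebesgue" "emeasure lebesgue E < \<infinity>"
  shows "Bochner_Integration.simple_bochner_integrable lebesgue (\<lambda>t. indicator E t *\<^sub>R (y::'x::real_normed_vector))"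
    and "Bochner_Integration.simple_bochner_integral lebesgue (\<lambda>t. indicator E t *\<^sub>R y) = measure lebesgue E *\<^sub>R y"
proof -
  have i: "Bochner_Integration.simple_bochner_integrable lebesgue (indicator E :: real \<Rightarrow> real)"
    using E by (intro simple_bochner_integrable.intros simple_function_indicator) (simp_all add: indicator_eq_0_iff)
  show "Bochner_Integration.simple_bochner_integrable lebesgue (\<lambda>t. indicator E t *\<^sub>R y)"
    by (rule simple_bochner_integrable_compose2[where p="\<lambda>a b. a *\<^sub>R y", OF _ i i]) simp
  have "linear (\<lambda>a::real. a *\<^sub>R y)" by (rule bounded_linear.linear[OF bounded_linear_scaleR_left])
  from simple_bochner_integral_linear[OF this i]
  show "Bochner_Integration.simple_bochner_integral lebesgue (\<lambda>t. indicator E t *\<^sub>R y) = measure lebesgue E *\<^sub>R y"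
    using simple_bochner_integrable_eq_integral[OF i] E by simp
qed

text \<open>On a set \<open>E\<close> of positive measure where \<open>d\<close> is close to some \<open>y \<noteq> 0\<close>, test with a bump
  function approximating the indicator of \<open>E\<close> in \<open>L\<^sup>1(|d| dt)\<close>.\<close>

lemma represents_zero:
  fixes d :: "real \<Rightarrow> 'y::complex_banach"
  assumes d: "d \<in> L1_loc" and rep: "represents d u" and zero: "\<And>\<phi>. \<phi> \<in> schwartz \<Longrightarrow> u \<phi> = 0"
  shows "AE t in lebesgue. d t = 0"
proof (rule ccontr)
  assume nz: "\<not> ?thesis"
  have dm: "strongly_measurable d" using d by (simp add: L1_loc_def)
  obtain y and n :: nat where y: "y \<noteq> 0" and E': "{t. norm (d t - y) < norm y / 2 \<and> \<bar>t\<bar> < real n} \<in> sets lebesgue"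
    "emeasure lebesgue {t. norm (d t - y) < norm y / 2 \<and> \<bar>t\<bar> < real n} \<noteq> 0"
    by (rule nonzero_AE_obtains_ball[OF dm nz])
  define E where "E = {t. norm (d t - y) < norm y / 2 \<and> \<bar>t\<bar> < real n}"
  note E = E'[folded E_def]
  have Esub: "E \<subseteq> {-real n<..<real n}" by (auto simp: E_def)
  have "emeasure lebesgue E \<le> emeasure lebesgue {-real n<..<real n}" using Esub by (intro emeasure_mono) auto
  then have Efin: "emeasure lebesgue E < \<infinity>" by (auto simp: less_top[symmetric] top_unique)
  define m where "m = measure lebesgue E"
  have m: "emeasure lebesgue E = ennreal m" using Efin by (simp add: m_def emeasure_eq_ennreal_measure)
  have "0 < m" using E(2) m by (metis ennreal_0 less_eq_real_def m_def measure_nonneg)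
  \<comment> \<open>The deviation of d from y costs |y| m / 2 and three errors e are added, in total
    7/8 of |y| m, less than the norm of the integral of \<open>r\<close>.\<close>
  define e where "e = norm y * m / 8"
  have e: "0 < e" using y \<open>0 < m\<close> by (simp add: e_def)
  have approx: "bump_approximable 1 (\<lambda>t. norm (d t)) (\<lambda>t. indicator E t *\<^sub>R (1::complex))"
    by (rule bump_approximable_indicator[OF _ locally_integrable_norm[OF d] E(1) Esub]) simp
  obtain \<phi> where \<phi>: "\<phi> \<in> bumps"
    "power_integral 1 (\<lambda>t. norm (d t)) (\<lambda>t. indicator E t *\<^sub>R (1::complex) - \<phi> t) < ennreal e"
    using bump_approximableD[OF approx e] by blast
  have \<phi>s: "\<phi> \<in> schwartz" using \<phi>(1) bumps_subset_schwartz by blast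
  then have "has_strong_integral (\<lambda>t. scaleC (\<phi> t) (d t)) 0"
    using rep zero by (simp add: represents_def)
  then obtain s where s: "strongly_measurable (\<lambda>t. scaleC (\<phi> t) (d t))"
    "\<And>i. Bochner_Integration.simple_bochner_integrable lebesgue (s i)"
    "(\<lambda>i. \<integral>\<^sup>+t. ennreal (norm (scaleC (\<phi> t) (d t) - s i t)) \<partial>lebesgue) \<longlonglongrightarrow> 0"
    "(\<lambda>i. Bochner_Integration.simple_bochner_integral lebesgue (s i)) \<longlonglongrightarrow> 0"
    unfolding has_strong_integral_def by blast
  have "eventually (\<lambda>i. (\<integral>\<^sup>+t. ennreal (norm (scaleC (\<phi> t) (d t) - s i t)) \<partial>lebesgue) < ennreal e \<and>
      norm (Bochner_Integration.simple_bochner_integral lebesgue (s i)) < e) sequentially"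
    using order_tendstoD(2)[OF s(3), of "ennreal e"] order_tendstoD(2)[OF tendsto_norm[OF s(4)], of e] e
    by (simp add: eventually_conj_iff)
  from eventually_happens'[OF sequentially_bot this]
  obtain i where i: "(\<integral>\<^sup>+t. ennreal (norm (scaleC (\<phi> t) (d t) - s i t)) \<partial>lebesgue) < ennreal e"
    "norm (Bochner_Integration.simple_bochner_integral lebesgue (s i)) < e"
    by (elim exE conjE)
  define r where "r t = indicat_real E t *\<^sub>R y" for t
  have r: "Bochner_Integration.simple_bochner_integrable lebesgue r"
    "Bochner_Integration.simple_bochner_integral lebesgue r = m *\<^sub>R y"
    using simple_bochner_integral_indicator_scaleR[OF E(1) Efin, of y] by (simp_all add: r_def[abs_def] m_def)
  have sm: "strongly_measurable (s i)"
    using s(2)[of i] by (auto elim!: simple_bochner_integrable.cases intro: strongly_measurable_simple)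
  have [measurable]: "(\<lambda>t. norm (scaleC (\<phi> t) (d t) - s i t)) \<in> borel_measurable lebesgue"
    by (rule strongly_measurable_norm[OF strongly_measurable_diff[OF s(1) sm]])
  have [measurable]: "(\<lambda>t. norm (d t)) \<in> borel_measurable lebesgue" by (rule strongly_measurable_norm[OF dm])
  have [measurable]: "E \<in> sets lebesgue" by (rule E)
  have [measurable]: "(\<lambda>t. norm (indicator E t *\<^sub>R (1::complex) - \<phi> t)) \<in> borel_measurable lebesgue"
    by (intro strongly_measurable_norm strongly_measurable_diff strongly_measurable_indicator_scaleR
        bumps_strongly_measurable \<phi> E)
  \<comment> \<open>The path runs from y on E to d on E, then to the product of the test function
    with d, then to the simple function: closeness of d to y, approximation in L^1(|d| dt), and the
    definition of the strong integral.\<close>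
  have pointwise: "norm (r t - s i t) \<le> norm y / 2 * indicator E t +
      norm (indicator E t *\<^sub>R 1 - \<phi> t) * norm (d t) + norm (scaleC (\<phi> t) (d t) - s i t)" for t
  proof -
    have "scaleC (indicator E t *\<^sub>R 1 - \<phi> t) (d t) = indicat_real E t *\<^sub>R d t - scaleC (\<phi> t) (d t)"
      using scaleC_add_left[of "indicator E t *\<^sub>R 1 - \<phi> t" "\<phi> t" "d t"] scaleC_of_real[of "indicat_real E t" "d t"]
      by (simp add: algebra_simps scaleR_conv_of_real)
    then have "r t - s i t = (r t - indicat_real E t *\<^sub>R d t) + scaleC (indicator E t *\<^sub>R 1 - \<phi> t) (d t) +
        (scaleC (\<phi> t) (d t) - s i t)" by simp
    also have "norm \<dots> \<le> norm (r t - indicat_real E t *\<^sub>R d t) + norm (scaleC (indicator E t *\<^sub>R 1 - \<phi> t) (d t)) +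
        norm (scaleC (\<phi> t) (d t) - s i t)"
      by (intro norm_triangle_le add_mono order_refl)
    also have "norm (r t - indicat_real E t *\<^sub>R d t) \<le> norm y / 2 * indicator E t"
      by (auto simp: r_def E_def indicator_def norm_minus_commute)
    finally show ?thesis by (simp add: norm_scaleC)
  qed
  have "ennreal (norm (m *\<^sub>R y - Bochner_Integration.simple_bochner_integral lebesgue (s i))) =
      ennreal (norm (Bochner_Integration.simple_bochner_integral lebesgue (\<lambda>t. r t - s i t)))"
    by (subst simple_bochner_integral_diff[OF r(1) s(2)]) (simp add: r(2))
  also have "\<dots> \<le> ennreal (Bochner_Integration.simple_bochner_integral lebesgue (\<lambda>t. norm (r t - s i t)))"
    by (intro ennreal_leI simple_bochner_integral_norm_bound simple_bochner_integrable_compose2[where p="(-)"] r s) simp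
  also have "\<dots> = (\<integral>\<^sup>+t. ennreal (norm (r t - s i t)) \<partial>lebesgue)"
    by (rule simple_bochner_integral_eq_nn_integral)
      (auto intro!: simple_bochner_integrable_compose2[where p="\<lambda>x y. norm (x - y)"] r s)
  also have "\<dots> \<le> (\<integral>\<^sup>+t. ennreal (norm y / 2) * indicator E t +
      ennreal (norm (indicator E t *\<^sub>R 1 - \<phi> t) powr 1) * ennreal (norm (d t)) +
      ennreal (norm (scaleC (\<phi> t) (d t) - s i t)) \<partial>lebesgue)"
  proof (rule nn_integral_mono)
    fix t
    show "ennreal (norm (r t - s i t)) \<le> ennreal (norm y / 2) * indicator E t +
      ennreal (norm (indicator E t *\<^sub>R 1 - \<phi> t) powr 1) * ennreal (norm (d t)) +
      ennreal (norm (scaleC (\<phi> t) (d t) - s i t))"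
      using ennreal_leI[OF pointwise[of t]]
      by (cases "t \<in> E") (simp_all add: ennreal_mult ennreal_plus)
  qed
  also have "\<dots> = ennreal (norm y / 2) * emeasure lebesgue E +
      power_integral 1 (\<lambda>t. norm (d t)) (\<lambda>t. indicator E t *\<^sub>R 1 - \<phi> t) +
      (\<integral>\<^sup>+t. ennreal (norm (scaleC (\<phi> t) (d t) - s i t)) \<partial>lebesgue)"
    unfolding power_integral_def by (simp add: nn_integral_add nn_integral_cmult_indicator)
  also have "\<dots> \<le> ennreal (norm y / 2 * m) + ennreal e + ennreal e"
    using \<phi>(2) i(1) \<open>0 < m\<close> by (intro add_mono) (auto simp: m simp flip: ennreal_mult')
  also have "\<dots> = ennreal (norm y / 2 * m + e + e)" using e \<open>0 < m\<close> by (simp flip: ennreal_plus)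
  finally have "norm (m *\<^sub>R y - Bochner_Integration.simple_bochner_integral lebesgue (s i)) \<le> norm y / 2 * m + e + e"
    using e \<open>0 < m\<close> by (subst (asm) ennreal_le_iff) auto
  then have "norm (m *\<^sub>R y) \<le> norm y / 2 * m + e + e + e"
    using i(2) norm_triangle_sub[of "m *\<^sub>R y" "Bochner_Integration.simple_bochner_integral lebesgue (s i)"] by linarith
  then have "m * norm y \<le> m * norm y / 2 + 3 * (m * norm y / 8)" using \<open>0 < m\<close> by (simp add: e_def mult.commute)
  moreover have "0 < m * norm y" using y \<open>0 < m\<close> by simp
  ultimately show False by linarith
qed

lemma L1_loc_diff:
  assumes f: "f \<in> L1_loc" and g: "g \<in> L1_loc" shows "(\<lambda>t. f t - g t) \<in> L1_loc"
proof -
  have m: "strongly_measurable f" "strongly_measurable g" using f g by (auto simp: L1_loc_def)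
  then have [measurable]: "(\<lambda>t. norm (f t)) \<in> borel_measurable lebesgue" "(\<lambda>t. norm (g t)) \<in> borel_measurable lebesgue"
    by (auto intro: strongly_measurable_norm)
  have "(\<integral>\<^sup>+t\<in>{a..b}. ennreal (norm (f t - g t)) \<partial>lebesgue) < \<infinity>" for a b
  proof -
    have [measurable]: "{a..b} \<in> sets lebesgue" by simp
    have "(\<integral>\<^sup>+t\<in>{a..b}. ennreal (norm (f t - g t)) \<partial>lebesgue) \<le>
        (\<integral>\<^sup>+t. ennreal (norm (f t)) * indicator {a..b} t + ennreal (norm (g t)) * indicator {a..b} t \<partial>lebesgue)"
      by (intro nn_integral_mono) (auto simp: indicator_def norm_triangle_ineq4 simp flip: ennreal_plus intro!: ennreal_leI)
    also have "\<dots> = (\<integral>\<^sup>+t\<in>{a..b}. ennreal (norm (f t)) \<partial>lebesgue) + (\<integral>\<^sup>+t\<in>{a..b}. ennreal (norm (g t)) \<partial>lebesgue)"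
      by (rule nn_integral_add) measurable
    also have "\<dots> < \<infinity>" using f g by (simp add: L1_loc_def)
    finally show ?thesis .
  qed
  with m show ?thesis by (simp add: L1_loc_def strongly_measurable_diff)
qed

lemma represents_unique:
  fixes f g :: "real \<Rightarrow> 'y::complex_banach"
  assumes "f \<in> L1_loc" "g \<in> L1_loc" and f: "represents f u" and g: "represents g u"
  shows "AE t in lebesgue. f t = g t"
proof -
  have minus: "scaleC (-1) x = - x" for x :: 'y
    using scaleC_of_real[of "-1" x] by simp
  have "represents (\<lambda>t. scaleC (-1) (g t)) (\<lambda>\<phi>. scaleC (-1) (u \<phi>))" using g by (rule represents_scaleC) simp
  with f have "represents (\<lambda>t. f t + scaleC (-1) (g t)) (\<lambda>\<phi>. u \<phi> + scaleC (-1) (u \<phi>))" by (rule represents_add) simp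
  then have "represents (\<lambda>t. f t - g t) (\<lambda>\<phi>. 0)" by (simp add: minus)
  then have "AE t in lebesgue. f t - g t = 0" by (intro represents_zero[OF L1_loc_diff[OF assms(1,2)]]) auto
  then show ?thesis by eventually_elim simp
qed

subsection \<open>Muckenhoupt weights\<close>

lemma AE_lebesgue_ex_in_interval:
  assumes "AE t in lebesgue. P t" and ab: "a < (b::real)"
  obtains t where "a \<le> t" "t \<le> b" "P t"
proof (rule ccontr)
  assume no: "\<not> thesis"
  have "AE t in lebesgue. t \<notin> {a..b}" using assms(1)
  proof eventually_elim
    case (elim t)
    with no that[of t] show ?case by auto
  qed
  then have "emeasure lebesgue {a..b} = 0"
    by (subst (asm) AE_iff_measurable[of "{a..b}"]) auto
  with ab show False by simp
qed

lemma ennreal_powr_mono: "x \<le> y \<Longrightarrow> 0 \<le> r \<Longrightarrow> ennreal_powr x r \<le> ennreal_powr y r"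
  by (auto simp: ennreal_powr_def less_top top_unique intro!: ennreal_leI powr_mono2 enn2real_mono)

lemma ennreal_powr_ennreal: "0 \<le> x \<Longrightarrow> ennreal_powr (ennreal x) r = ennreal (x powr r)"
  by (simp add: ennreal_powr_def)

lemma ennreal_powr_add_le:
  assumes "0 \<le> r"
  shows "ennreal_powr (x + y) r \<le> ennreal (2 powr r) * (ennreal_powr x r + ennreal_powr y r)"
proof (cases "x = \<infinity> \<or> y = \<infinity>")
  case True
  then show ?thesis by (auto simp: ennreal_powr_def ennreal_mult_top)
next
  case False
  then obtain a b where "x = ennreal a" "0 \<le> a" "y = ennreal b" "0 \<le> b"
    by (cases x; cases y) auto
  then show ?thesis
    using powr_add_le[of a b r] assms
    by (simp add: ennreal_powr_ennreal flip: ennreal_plus ennreal_mult)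
qed

lemma conj_exponent_eq: "1 < p \<Longrightarrow> 1 - conj_exponent p = - (1 / (p - 1))"
  by (simp add: conj_exponent_def field_simps)

lemma weight_locally_integrable: "weight w \<Longrightarrow> locally_integrable w"
proof -
  assume w: "weight w"
  have "(\<integral>\<^sup>+t\<in>{a..b}. ennreal (w t) \<partial>lebesgue) < \<infinity>" for a b
  proof (rule le_less_trans)
    show "(\<integral>\<^sup>+t\<in>{a..b}. ennreal (w t) \<partial>lebesgue) \<le> (\<integral>\<^sup>+t\<in>{a..b}. ennreal (norm (w t)) \<partial>lebesgue)"
      by (intro nn_integral_mono mult_right_mono ennreal_leI) auto
  qed (use w in \<open>simp add: weight_def L1_loc_def\<close>)
  with w show ?thesis by (simp add: weight_def locally_integrable_def)
qed

lemma Ap_locally_integrable: "w \<in> Ap p \<Longrightarrow> locally_integrable w"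
  by (simp add: Ap_def weight_locally_integrable)

lemma Ap_borel [measurable_dest]: "w \<in> Ap p \<Longrightarrow> w \<in> borel_measurable lebesgue"
  by (simp add: Ap_def weight_def)

lemma Ap_pos: "w \<in> Ap p \<Longrightarrow> AE t in lebesgue. 0 < w t"
  by (simp add: Ap_def weight_def)

lemma weightI:
  assumes m: "w \<in> borel_measurable lebesgue" and pos: "AE t in lebesgue. 0 < w t"
    and int: "\<And>a b. a < b \<Longrightarrow> (\<integral>\<^sup>+t\<in>{a..b}. ennreal (w t) \<partial>lebesgue) < \<infinity>"
  shows "weight w"
proof -
  have "(\<integral>\<^sup>+t\<in>{a..b}. ennreal (norm (w t)) \<partial>lebesgue) < \<infinity>" for a b
  proof -
    have "(\<integral>\<^sup>+t\<in>{a..b}. ennreal (norm (w t)) \<partial>lebesgue) \<le> (\<integral>\<^sup>+t\<in>{a..max (a + 1) b}. ennreal (w t) \<partial>lebesgue)"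
      by (rule nn_integral_mono_AE) (use pos in eventually_elim, auto simp: indicator_def)
    also have "\<dots> < \<infinity>" by (rule int) simp
    finally show ?thesis .
  qed
  with m pos show ?thesis by (simp add: weight_def L1_loc_def strongly_measurable_iff_borel)
qed

lemma nn_integral_interval_pos:
  assumes m: "w \<in> borel_measurable lebesgue" and pos: "AE t in lebesgue. 0 < w t" and ab: "a < (b::real)"
  shows "0 < (\<integral>\<^sup>+t\<in>{a..b}. ennreal (w t) \<partial>lebesgue)"
proof (rule ccontr)
  assume "\<not> ?thesis"
  then have "(\<integral>\<^sup>+t\<in>{a..b}. ennreal (w t) \<partial>lebesgue) = 0" by (simp add: zero_less_iff_neq_zero)
  moreover have [measurable]: "{a..b} \<in> sets lebesgue" by simp
  have "(\<lambda>t. ennreal (w t) * indicator {a..b} t) \<in> borel_measurable lebesgue" using m by measurable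
  ultimately have "AE t in lebesgue. ennreal (w t) * indicator {a..b} t = 0"
    by (simp add: nn_integral_0_iff_AE)
  with pos have "AE t in lebesgue. 0 < w t \<and> ennreal (w t) * indicator {a..b} t = 0" by eventually_elim simp
  then obtain t where "a \<le> t" "t \<le> b" "0 < w t \<and> ennreal (w t) * indicator {a..b} t = 0"
    using ab by (rule AE_lebesgue_ex_in_interval)
  then show False by (auto simp: ennreal_eq_0_iff)
qed

lemma Ap_const_boundI:
  assumes "\<And>a b. a < b \<Longrightarrow> ((\<integral>\<^sup>+t\<in>{a..b}. ennreal (w t) \<partial>lebesgue) / ennreal (b - a)) *
        ennreal_powr ((\<integral>\<^sup>+t\<in>{a..b}. ennreal (w t powr (1 - conj_exponent p)) \<partial>lebesgue) / ennreal (b - a)) (p - 1) \<le> B"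
  shows "Ap_const p w \<le> B"
  unfolding Ap_const_def by (rule SUP_least) (use assms in auto)

lemma Ap_const_upper:
  assumes "a < b"
  shows "((\<integral>\<^sup>+t\<in>{a..b}. ennreal (w t) \<partial>lebesgue) / ennreal (b - a)) *
        ennreal_powr ((\<integral>\<^sup>+t\<in>{a..b}. ennreal (w t powr (1 - conj_exponent p)) \<partial>lebesgue) / ennreal (b - a)) (p - 1)
        \<le> Ap_const p w"
  unfolding Ap_const_def by (rule SUP_upper2[of "(a, b)"]) (use assms in auto)

lemma Ap_one: "1 < p \<Longrightarrow> (\<lambda>_. 1) \<in> Ap p"
proof -
  assume p: "1 < p"
  have int: "(\<integral>\<^sup>+t\<in>{a..b}. ennreal 1 \<partial>lebesgue) = ennreal (b - a)" if "a < b" for a b :: real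
    using that by simp
  have "Ap_const p (\<lambda>_. 1) \<le> 1"
  proof (rule Ap_const_boundI)
    fix a b :: real assume ab: "a < b"
    have "ennreal (b - a) / ennreal (b - a) = 1" using ab by (simp add: divide_ennreal)
    moreover have "ennreal_powr 1 (p - 1) = 1" using ennreal_powr_ennreal[of 1 "p - 1"] by simp
    ultimately show "((\<integral>\<^sup>+t\<in>{a..b}. ennreal 1 \<partial>lebesgue) / ennreal (b - a)) *
        ennreal_powr ((\<integral>\<^sup>+t\<in>{a..b}. ennreal (1 powr (1 - conj_exponent p)) \<partial>lebesgue) / ennreal (b - a)) (p - 1) \<le> 1"
      using int[OF ab] by simp
  qed
  moreover have "weight (\<lambda>_. 1)" by (rule weightI) (simp_all add: int)
  ultimately show ?thesis by (auto simp: Ap_def intro: le_less_trans)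
qed

text \<open>A negative power of a minimum is one of the two powers, hence at most their sum. The
  average of the minimum is at most either average, so after expanding the sum each dual factor can
  be paired with the average of its own weight.\<close>

lemma Ap_min:
  assumes p: "1 < p" and w: "w \<in> Ap p" and v: "v \<in> Ap p"
  shows "(\<lambda>t. min (w t) (v t)) \<in> Ap p"
proof -
  have [measurable]: "w \<in> borel_measurable lebesgue" "v \<in> borel_measurable lebesgue"
    using w v by (auto intro: Ap_borel)
  have "weight (\<lambda>t. min (w t) (v t))"
  proof (rule weightI)
    show "AE t in lebesgue. 0 < min (w t) (v t)"
      using Ap_pos[OF w] Ap_pos[OF v] by eventually_elim simp
    fix a b :: real
    have "(\<integral>\<^sup>+t\<in>{a..b}. ennreal (min (w t) (v t)) \<partial>lebesgue) \<le> (\<integral>\<^sup>+t\<in>{a..b}. ennreal (w t) \<partial>lebesgue)"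
      by (intro nn_integral_mono mult_right_mono ennreal_leI) auto
    also have "\<dots> < \<infinity>" using Ap_locally_integrable[OF w] by (simp add: locally_integrable_def)
    finally show "(\<integral>\<^sup>+t\<in>{a..b}. ennreal (min (w t) (v t)) \<partial>lebesgue) < \<infinity>" .
  qed measurable
  moreover have "Ap_const p (\<lambda>t. min (w t) (v t)) \<le> ennreal (2 powr (p - 1)) * (Ap_const p w + Ap_const p v)"
  proof (rule Ap_const_boundI)
    fix a b :: real assume ab: "a < b"
    have [measurable]: "{a..b} \<in> sets lebesgue" by simp
    let ?q = "1 - conj_exponent p"
    define A where "A u = (\<integral>\<^sup>+t\<in>{a..b}. ennreal (u t) \<partial>lebesgue) / ennreal (b - a)" for u
    define S where "S u = ennreal_powr ((\<integral>\<^sup>+t\<in>{a..b}. ennreal (u t powr ?q) \<partial>lebesgue) / ennreal (b - a)) (p - 1)" for u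
    let ?m = "\<lambda>t. min (w t) (v t)"
    have Aw: "A ?m \<le> A w" and Av: "A ?m \<le> A v"
      unfolding A_def by (intro divide_right_mono_ennreal nn_integral_mono mult_right_mono ennreal_leI; simp)+
    have "S ?m \<le> ennreal_powr (((\<integral>\<^sup>+t\<in>{a..b}. ennreal (w t powr ?q) \<partial>lebesgue) +
        (\<integral>\<^sup>+t\<in>{a..b}. ennreal (v t powr ?q) \<partial>lebesgue)) / ennreal (b - a)) (p - 1)"
      unfolding S_def
    proof (intro ennreal_powr_mono divide_right_mono_ennreal)
      have "(\<integral>\<^sup>+t\<in>{a..b}. ennreal (?m t powr ?q) \<partial>lebesgue) \<le>
          (\<integral>\<^sup>+t. ennreal (w t powr ?q) * indicator {a..b} t + ennreal (v t powr ?q) * indicator {a..b} t \<partial>lebesgue)"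
      proof (rule nn_integral_mono)
        fix t
        have "ennreal (?m t powr ?q) \<le> ennreal (w t powr ?q) + ennreal (v t powr ?q)"
          by (auto simp: min_def)
        then show "ennreal (?m t powr ?q) * indicator {a..b} t \<le>
            ennreal (w t powr ?q) * indicator {a..b} t + ennreal (v t powr ?q) * indicator {a..b} t"
          by (auto simp: indicator_def)
      qed
      also have "\<dots> = (\<integral>\<^sup>+t\<in>{a..b}. ennreal (w t powr ?q) \<partial>lebesgue) + (\<integral>\<^sup>+t\<in>{a..b}. ennreal (v t powr ?q) \<partial>lebesgue)"
        by (rule nn_integral_add) measurable
      finally show "(\<integral>\<^sup>+t\<in>{a..b}. ennreal (?m t powr ?q) \<partial>lebesgue) \<le>
        (\<integral>\<^sup>+t\<in>{a..b}. ennreal (w t powr ?q) \<partial>lebesgue) + (\<integral>\<^sup>+t\<in>{a..b}. ennreal (v t powr ?q) \<partial>lebesgue)" .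
    qed (use p in simp)
    also have "\<dots> \<le> ennreal (2 powr (p - 1)) * (S w + S v)"
      unfolding S_def add_divide_distrib_ennreal using p by (intro ennreal_powr_add_le) simp
    finally have "A ?m * S ?m \<le> A ?m * (ennreal (2 powr (p - 1)) * (S w + S v))" by (rule mult_left_mono) simp
    also have "\<dots> = ennreal (2 powr (p - 1)) * (A ?m * S w + A ?m * S v)" by (simp add: algebra_simps)
    also have "\<dots> \<le> ennreal (2 powr (p - 1)) * (A w * S w + A v * S v)"
      by (intro mult_left_mono add_mono mult_right_mono Aw Av) auto
    also have "\<dots> \<le> ennreal (2 powr (p - 1)) * (Ap_const p w + Ap_const p v)"
      unfolding A_def S_def by (intro mult_left_mono add_mono Ap_const_upper ab) auto
    finally show "((\<integral>\<^sup>+t\<in>{a..b}. ennreal (?m t) \<partial>lebesgue) / ennreal (b - a)) *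
        ennreal_powr ((\<integral>\<^sup>+t\<in>{a..b}. ennreal (?m t powr ?q) \<partial>lebesgue) / ennreal (b - a)) (p - 1)
        \<le> ennreal (2 powr (p - 1)) * (Ap_const p w + Ap_const p v)"
      unfolding A_def S_def .
  qed
  moreover have "ennreal (2 powr (p - 1)) * (Ap_const p w + Ap_const p v) < \<infinity>"
    using w v by (simp add: Ap_def ennreal_mult_less_top)
  ultimately show ?thesis unfolding Ap_def by auto
qed

text \<open>On a nondegenerate interval the average of w is positive, so a finite product in the A_p
  condition forces the dual factor to be finite.\<close>

lemma Ap_conj_locally_integrable:
  assumes p: "1 < p" and w: "w \<in> Ap p"
  shows "(\<integral>\<^sup>+t\<in>{a..b}. ennreal (w t powr (1 - conj_exponent p)) \<partial>lebesgue) < \<infinity>"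
proof -
  let ?q = "1 - conj_exponent p"
  \<comment> \<open>The interval from a to b may be empty or a point, while the A_p condition speaks
    of a < c.\<close>
  define c where "c = max (a + 1) b"
  have c: "a < c" "{a..b} \<subseteq> {a..c}" by (auto simp: c_def)
  let ?A = "(\<integral>\<^sup>+t\<in>{a..c}. ennreal (w t) \<partial>lebesgue) / ennreal (c - a)"
  let ?I = "\<integral>\<^sup>+t\<in>{a..c}. ennreal (w t powr ?q) \<partial>lebesgue"
  have "?A * ennreal_powr (?I / ennreal (c - a)) (p - 1) < \<infinity>"
    using Ap_const_upper[OF c(1), of w p] w by (auto simp: Ap_def intro: le_less_trans)
  moreover have "?A \<noteq> 0"
    using nn_integral_interval_pos[OF Ap_borel[OF w] Ap_pos[OF w] c(1)] by (simp add: ennreal_divide_eq_0_iff)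
  ultimately have "ennreal_powr (?I / ennreal (c - a)) (p - 1) \<noteq> \<infinity>" by (auto simp: ennreal_mult_top)
  then have "?I / ennreal (c - a) \<noteq> \<infinity>" by (auto simp: ennreal_powr_def)
  then have "?I \<noteq> \<infinity>" using c by (auto simp: ennreal_top_divide)
  moreover have "(\<integral>\<^sup>+t\<in>{a..b}. ennreal (w t powr ?q) \<partial>lebesgue) \<le> ?I"
    using c by (intro nn_integral_mono mult_left_mono) (auto simp: indicator_def)
  ultimately show ?thesis by (simp add: less_top[symmetric]) (metis top_unique)
qed

text \<open>A pointwise substitute for Hoelder's inequality: one of the summands alone dominates, according to
  the side of the threshold \<open>w\<^bsup>-1/(p-1)\<^esup>\<close> on which \<open>x\<close> lies.\<close>

lemma le_powr_weight_add:
  fixes x w p :: real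
  assumes p: "1 < p" and w: "0 < w" and x: "0 \<le> x"
  shows "x \<le> x powr p * w + w powr (1 - conj_exponent p)"
proof (cases "x \<le> w powr (1 - conj_exponent p)")
  case True
  then show ?thesis using w by (simp add: add_increasing)
next
  case False
  then have x0: "0 < x" using w by (metis not_le order_le_less_trans powr_ge_zero)
  have "(w powr (1 - conj_exponent p)) powr (p - 1) \<le> x powr (p - 1)" using False p by (intro powr_mono2) auto
  also have "(w powr (1 - conj_exponent p)) powr (p - 1) = 1 / w"
  proof -
    have "(1 - conj_exponent p) * (p - 1) = - 1" using p by (simp add: conj_exponent_eq)
    then show ?thesis using w by (simp add: powr_powr powr_minus_divide)
  qed
  finally have "1 \<le> x powr (p - 1) * w" using w by (simp add: field_simps)
  then have "x * 1 \<le> x * (x powr (p - 1) * w)" using x by (intro mult_left_mono) auto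
  also have "\<dots> = x powr p * w" using x0 by (simp add: powr_mult_base mult.assoc[symmetric])
  finally show ?thesis by (simp add: add_increasing2)
qed

text \<open>By \<open>le_powr_weight_add\<close>, |f| is at most |f|^p w plus the dual weight; the
  first is integrable on the line and the second is locally integrable by the A_p condition.\<close>

lemma Lpw_subset_L1_loc:
  assumes p: "1 < p" and w: "w \<in> Ap p" and f: "f \<in> Lpw p w"
  shows "f \<in> L1_loc"
proof -
  have fm: "strongly_measurable f" and fi: "power_integral p w f < \<infinity>" using f by (auto simp: Lpw_iff)
  have [measurable]: "(\<lambda>t. norm (f t)) \<in> borel_measurable lebesgue" by (rule strongly_measurable_norm[OF fm])
  have [measurable]: "w \<in> borel_measurable lebesgue" by (rule Ap_borel[OF w])
  have "(\<integral>\<^sup>+t\<in>{a..b}. ennreal (norm (f t)) \<partial>lebesgue) < \<infinity>" for a b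
  proof -
    let ?q = "1 - conj_exponent p"
    have [measurable]: "{a..b} \<in> sets lebesgue" by simp
    have "(\<integral>\<^sup>+t\<in>{a..b}. ennreal (norm (f t)) \<partial>lebesgue) \<le>
        (\<integral>\<^sup>+t. ennreal (norm (f t) powr p) * ennreal (w t) + ennreal (w t powr ?q) * indicator {a..b} t \<partial>lebesgue)"
    proof (rule nn_integral_mono_AE)
      show "AE t in lebesgue. ennreal (norm (f t)) * indicator {a..b} t \<le>
          ennreal (norm (f t) powr p) * ennreal (w t) + ennreal (w t powr ?q) * indicator {a..b} t"
        using Ap_pos[OF w]
      proof eventually_elim
        case (elim t)
        have "ennreal (norm (f t)) \<le> ennreal (norm (f t) powr p) * ennreal (w t) + ennreal (w t powr ?q)"
          using le_powr_weight_add[OF p elim, of "norm (f t)"] elim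
          by (simp flip: ennreal_plus ennreal_mult add: ennreal_leI)
        then show ?case by (auto simp: indicator_def)
      qed
    qed
    also have "\<dots> = power_integral p w f + (\<integral>\<^sup>+t\<in>{a..b}. ennreal (w t powr ?q) \<partial>lebesgue)"
      unfolding power_integral_def by (rule nn_integral_add) measurable
    also have "\<dots> < \<infinity>" using fi Ap_conj_locally_integrable[OF p w] by simp
    finally show ?thesis .
  qed
  with fm show ?thesis by (simp add: L1_loc_def)
qed

section \<open>A_1 weights and the construction of A_p weights from them\<close>

definition A1_bound :: "real \<Rightarrow> (real \<Rightarrow> real) \<Rightarrow> bool" where
  "A1_bound C v \<longleftrightarrow> v \<in> borel_measurable lebesgue \<and> (\<forall>t. 0 \<le> v t) \<and>
     (AE t in lebesgue. \<forall>a b. a < b \<longrightarrow> a \<le> t \<longrightarrow> t \<le> b \<longrightarrow>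
        (\<integral>\<^sup>+s\<in>{a..b}. ennreal (v s) \<partial>lebesgue) \<le> ennreal (C * (b - a) * v t))"

text \<open>\<open>A1_bound\<close> says M v <= C v with one null set for all intervals. If v
  vanished at a point outside that set, its integrals over all intervals centred there would vanish,
  and so would v almost everywhere.\<close>

lemma A1_bound_pos:
  assumes v: "A1_bound C v" and nz: "\<not> (AE t in lebesgue. v t = 0)"
  shows "AE t in lebesgue. 0 < v t"
proof -
  have [measurable]: "v \<in> borel_measurable lebesgue" and nn: "\<And>t. 0 \<le> v t" using v by (auto simp: A1_bound_def)
  have AE: "AE t in lebesgue. \<forall>a b. a < b \<longrightarrow> a \<le> t \<longrightarrow> t \<le> b \<longrightarrow>
        (\<integral>\<^sup>+s\<in>{a..b}. ennreal (v s) \<partial>lebesgue) \<le> ennreal (C * (b - a) * v t)"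
    using v by (simp add: A1_bound_def)
  have nonzero: "v t \<noteq> 0" if t: "\<forall>a b. a < b \<longrightarrow> a \<le> t \<longrightarrow> t \<le> b \<longrightarrow>
        (\<integral>\<^sup>+s\<in>{a..b}. ennreal (v s) \<partial>lebesgue) \<le> ennreal (C * (b - a) * v t)" for t
  proof
    assume "v t = 0"
    have "AE s in lebesgue. ennreal (v s) * indicator {t - real (Suc n)..t + real (Suc n)} s = 0" for n
    proof -
      have [measurable]: "{t - real (Suc n)..t + real (Suc n)} \<in> sets lebesgue" by simp
      have "(\<integral>\<^sup>+s\<in>{t - real (Suc n)..t + real (Suc n)}. ennreal (v s) \<partial>lebesgue) = 0"
        using t[rule_format, of "t - real (Suc n)" "t + real (Suc n)"] \<open>v t = 0\<close> by simp
      then show ?thesis by (subst (asm) nn_integral_0_iff_AE) measurable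
    qed
    then have "AE s in lebesgue. \<forall>n. ennreal (v s) * indicator {t - real (Suc n)..t + real (Suc n)} s = 0"
      unfolding AE_all_countable by (rule allI)
    then have "AE s in lebesgue. v s = 0"
    proof eventually_elim
      case (elim s)
      obtain n where "\<bar>s - t\<bar> < real n" using reals_Archimedean2 by blast
      then have "s \<in> {t - real (Suc n)..t + real (Suc n)}" by auto
      then show ?case using elim[rule_format, of n] nn[of s] by (simp add: ennreal_eq_0_iff del: of_nat_Suc)
    qed
    with nz show False by contradiction
  qed
  show ?thesis using AE
  proof eventually_elim
    case (elim t)
    show ?case using nonzero[OF elim] nn[of t] by linarith
  qed
qed

text \<open>V is the average of v over the interval. The last conclusion is a lower bound v >= V /
  C, the form in which negative powers of v can be estimated.\<close>

lemma A1_bound_average: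
  assumes v: "A1_bound C v" and pos: "AE t in lebesgue. 0 < v t" and ab: "a < b"
  obtains V where "0 < V" "(\<integral>\<^sup>+s\<in>{a..b}. ennreal (v s) \<partial>lebesgue) = ennreal (V * (b - a))"
    "AE t in lebesgue. t \<in> {a..b} \<longrightarrow> V \<le> C * v t"
proof -
  let ?I = "\<integral>\<^sup>+s\<in>{a..b}. ennreal (v s) \<partial>lebesgue"
  have AE: "AE t in lebesgue. t \<in> {a..b} \<longrightarrow> ?I \<le> ennreal (C * (b - a) * v t)"
    using v ab unfolding A1_bound_def by (auto elim: eventually_mono)
  then obtain t where t: "a \<le> t" "t \<le> b" "t \<in> {a..b} \<longrightarrow> ?I \<le> ennreal (C * (b - a) * v t)"
    using ab by (rule AE_lebesgue_ex_in_interval)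
  then have "?I \<noteq> \<infinity>" by (auto simp: top_unique)
  moreover have "0 < ?I" using v by (intro nn_integral_interval_pos[OF _ pos ab]) (simp add: A1_bound_def)
  ultimately obtain r where r: "?I = ennreal r" "0 < r" by (cases ?I) auto
  have "AE t in lebesgue. t \<in> {a..b} \<longrightarrow> r / (b - a) \<le> C * v t"
    using AE
  proof (eventually_elim, intro impI)
    fix t assume "t \<in> {a..b} \<longrightarrow> ?I \<le> ennreal (C * (b - a) * v t)" "t \<in> {a..b}"
    then have "ennreal r \<le> ennreal (C * (b - a) * v t)" using r by simp
    then have "r \<le> C * (b - a) * v t" using r(2)
      by (metis ennreal_le_iff2 linorder_not_le)
    then show "r / (b - a) \<le> C * v t" using ab by (simp add: field_simps)
  qed
  with r ab show thesis by (intro that[of "r / (b - a)"]) auto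
qed

text \<open>The elementary half of Jones' factorization. On an interval with averages V and U, the
  lower bounds give v^(1-p) <= (V/C)^(1-p) and u^(1-p') <= (U/D)^(1-p'), both exponents being
  negative. What remains is u in one integral and, because (1-p)(1-p') = 1, v in the other. All
  powers of U and V cancel and only C^(p-1) D is left.\<close>

lemma Ap_of_A1:
  assumes p: "1 < p" and v: "A1_bound C v" "AE t in lebesgue. 0 < v t"
    and u: "A1_bound D u" "AE t in lebesgue. 0 < u t" and CD: "0 < C" "0 < D"
  defines "w \<equiv> \<lambda>t. v t powr (1 - p) * u t"
  shows "w \<in> Ap p" "Ap_const p w \<le> ennreal (C powr (p - 1) * D)"
proof -
  have [measurable]: "v \<in> borel_measurable lebesgue" "u \<in> borel_measurable lebesgue"
    using v u by (auto simp: A1_bound_def)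
  let ?q = "1 - conj_exponent p"
  have key: "(\<integral>\<^sup>+t\<in>{a..b}. ennreal (w t) \<partial>lebesgue) < \<infinity> \<and>
      ((\<integral>\<^sup>+t\<in>{a..b}. ennreal (w t) \<partial>lebesgue) / ennreal (b - a)) *
        ennreal_powr ((\<integral>\<^sup>+t\<in>{a..b}. ennreal (w t powr ?q) \<partial>lebesgue) / ennreal (b - a)) (p - 1)
        \<le> ennreal (C powr (p - 1) * D)" if ab: "a < b" for a b
  proof -
    have [measurable]: "{a..b} \<in> sets lebesgue" by simp
    obtain V where V: "0 < V" "(\<integral>\<^sup>+s\<in>{a..b}. ennreal (v s) \<partial>lebesgue) = ennreal (V * (b - a))"
      "AE t in lebesgue. t \<in> {a..b} \<longrightarrow> V \<le> C * v t"
      using A1_bound_average[OF v ab] by blast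
    obtain U where U: "0 < U" "(\<integral>\<^sup>+s\<in>{a..b}. ennreal (u s) \<partial>lebesgue) = ennreal (U * (b - a))"
      "AE t in lebesgue. t \<in> {a..b} \<longrightarrow> U \<le> D * u t"
      using A1_bound_average[OF u ab] by blast
    define c where "c = (V / C) powr (1 - p)"
    define d where "d = (U / D) powr ?q"
    have "(\<integral>\<^sup>+t\<in>{a..b}. ennreal (w t) \<partial>lebesgue) \<le> (\<integral>\<^sup>+t. ennreal c * (ennreal (u t) * indicator {a..b} t) \<partial>lebesgue)"
    proof (rule nn_integral_mono_AE)
      show "AE t in lebesgue. ennreal (w t) * indicator {a..b} t \<le> ennreal c * (ennreal (u t) * indicator {a..b} t)"
        using V(3) v(2) u(2)
      proof eventually_elim
        case (elim t)
        show ?case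
        proof (cases "t \<in> {a..b}")
          case True
          have "V / C \<le> v t" using True elim CD by (simp add: field_simps)
          then have "v t powr (1 - p) \<le> c"
            unfolding c_def using V(1) CD p by (intro powr_mono2') auto
          then have "w t \<le> c * u t" unfolding w_def using elim by (intro mult_right_mono) auto
          moreover have "0 \<le> c" by (simp add: c_def)
          ultimately show ?thesis using True elim by (simp flip: ennreal_mult add: ennreal_leI)
        qed simp
      qed
    qed
    also have "\<dots> = ennreal c * (\<integral>\<^sup>+t\<in>{a..b}. ennreal (u t) \<partial>lebesgue)" by (rule nn_integral_cmult) measurable
    also have "\<dots> = ennreal (c * U * (b - a))"
      using U ab by (simp add: c_def ennreal_mult[symmetric] mult.assoc)
    finally have I1: "(\<integral>\<^sup>+t\<in>{a..b}. ennreal (w t) \<partial>lebesgue) \<le> ennreal (c * U * (b - a))" .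
    have "(\<integral>\<^sup>+t\<in>{a..b}. ennreal (w t powr ?q) \<partial>lebesgue) \<le> (\<integral>\<^sup>+t. ennreal d * (ennreal (v t) * indicator {a..b} t) \<partial>lebesgue)"
    proof (rule nn_integral_mono_AE)
      show "AE t in lebesgue. ennreal (w t powr ?q) * indicator {a..b} t \<le> ennreal d * (ennreal (v t) * indicator {a..b} t)"
        using U(3) v(2) u(2)
      proof eventually_elim
        case (elim t)
        show ?case
        proof (cases "t \<in> {a..b}")
          case True
          have "U / D \<le> u t" using True elim CD by (simp add: field_simps)
          then have ud: "u t powr ?q \<le> d"
            unfolding d_def using U(1) CD p by (intro powr_mono2') (auto simp: conj_exponent_eq)
          have "(1 - p) * ?q = 1" using p by (simp add: conj_exponent_eq field_simps)
          then have "w t powr ?q = v t * u t powr ?q"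
            unfolding w_def using elim by (simp add: powr_mult powr_powr)
          also have "\<dots> \<le> v t * d" using ud elim by (intro mult_left_mono) auto
          finally have "w t powr ?q \<le> d * v t" by (simp add: mult.commute)
          moreover have "0 \<le> d" by (simp add: d_def)
          ultimately show ?thesis using True elim by (simp flip: ennreal_mult add: ennreal_leI)
        qed simp
      qed
    qed
    also have "\<dots> = ennreal d * (\<integral>\<^sup>+t\<in>{a..b}. ennreal (v t) \<partial>lebesgue)" by (rule nn_integral_cmult) measurable
    also have "\<dots> = ennreal (d * V * (b - a))"
      using V ab by (simp add: d_def ennreal_mult[symmetric] mult.assoc)
    finally have I2: "(\<integral>\<^sup>+t\<in>{a..b}. ennreal (w t powr ?q) \<partial>lebesgue) \<le> ennreal (d * V * (b - a))" .
    have "0 \<le> c" "0 \<le> d" by (simp_all add: c_def d_def)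
    have "ennreal (c * U * (b - a)) / ennreal (b - a) = ennreal (c * U)"
      using ab U \<open>0 \<le> c\<close> by (subst divide_ennreal) auto
    with I1 have J1: "(\<integral>\<^sup>+t\<in>{a..b}. ennreal (w t) \<partial>lebesgue) / ennreal (b - a) \<le> ennreal (c * U)"
      by (metis divide_right_mono_ennreal)
    have "ennreal (d * V * (b - a)) / ennreal (b - a) = ennreal (d * V)"
      using ab V \<open>0 \<le> d\<close> by (subst divide_ennreal) auto
    with I2 have J2: "(\<integral>\<^sup>+t\<in>{a..b}. ennreal (w t powr ?q) \<partial>lebesgue) / ennreal (b - a) \<le> ennreal (d * V)"
      by (metis divide_right_mono_ennreal)
    have "((\<integral>\<^sup>+t\<in>{a..b}. ennreal (w t) \<partial>lebesgue) / ennreal (b - a)) *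
        ennreal_powr ((\<integral>\<^sup>+t\<in>{a..b}. ennreal (w t powr ?q) \<partial>lebesgue) / ennreal (b - a)) (p - 1)
        \<le> ennreal (c * U) * ennreal_powr (ennreal (d * V)) (p - 1)"
      using p by (intro mult_mono J1 ennreal_powr_mono J2) auto
    also have "\<dots> = ennreal (c * U * (d * V) powr (p - 1))"
      using U V \<open>0 \<le> c\<close> \<open>0 \<le> d\<close> by (subst ennreal_powr_ennreal) (simp_all flip: ennreal_mult)
    also have "(d * V) powr (p - 1) = D / U * V powr (p - 1)"
    proof -
      have "?q * (p - 1) = - 1" using p by (simp add: conj_exponent_eq)
      then have "d powr (p - 1) = D / U"
        unfolding d_def powr_powr using U CD by (simp add: powr_minus_divide)
      then show ?thesis using \<open>0 \<le> d\<close> V by (simp add: powr_mult)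
    qed
    also have "c * U * (D / U * V powr (p - 1)) = C powr (p - 1) * D"
    proof -
      have "c = C powr (p - 1) / V powr (p - 1)"
        using V CD by (simp add: c_def powr_divide powr_diff field_simps)
      then show ?thesis using U V CD by simp
    qed
    finally show ?thesis using I1 by (auto intro: le_less_trans)
  qed
  show bound: "Ap_const p w \<le> ennreal (C powr (p - 1) * D)" by (rule Ap_const_boundI) (use key in blast)
  have "weight w"
  proof (rule weightI)
    show "AE t in lebesgue. 0 < w t" using v(2) u(2) by eventually_elim (simp add: w_def)
  qed (use key in \<open>auto simp: w_def\<close>)
  with bound show "w \<in> Ap p" by (auto simp: Ap_def intro: le_less_trans)
qed

subsection \<open>Banach function spaces\<close>

definition interval_indicator :: "nat \<Rightarrow> real \<Rightarrow> real" where
  "interval_indicator n = indicator {- real n..real n}"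

lemma interval_indicator_borel [measurable]: "interval_indicator n \<in> borel_measurable lebesgue"
  unfolding interval_indicator_def by (rule borel_measurable_indicator) simp

lemma interval_indicator_bounds: "0 \<le> interval_indicator n t" "interval_indicator n t \<le> 1"
  by (auto simp: interval_indicator_def indicator_def)

lemma AE_all_intervals:
  assumes "\<And>n. AE t in lebesgue. t \<in> {- real n..real n} \<longrightarrow> P t"
  shows "AE t in lebesgue. P t"
proof -
  have "AE t in lebesgue. \<forall>n. t \<in> {- real n..real n} \<longrightarrow> P t"
    unfolding AE_all_countable by (rule allI) (rule assms)
  then show ?thesis
  proof eventually_elim
    case (elim t)
    obtain n where "\<bar>t\<bar> \<le> real n" using real_arch_simple by blast
    then show ?case using elim[rule_format, of n] by (auto simp: abs_le_iff)
  qed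
qed

lemma AE_zero_of_intervals:
  fixes f :: "real \<Rightarrow> 'x::real_normed_vector"
  assumes f: "(\<lambda>t. norm (f t)) \<in> borel_measurable lebesgue"
    and int: "\<And>n. (\<integral>\<^sup>+s\<in>{-real n..real n}. ennreal (norm (f s)) \<partial>lebesgue) = 0"
  shows "AE t in lebesgue. f t = 0"
proof (rule AE_all_intervals)
  fix n
  note f[measurable]
  have [measurable]: "{-real n..real n} \<in> sets lebesgue" by simp
  have "AE t in lebesgue. ennreal (norm (f t)) * indicator {-real n..real n} t = 0"
    using int[of n] by (subst (asm) nn_integral_0_iff_AE) measurable
  then show "AE t in lebesgue. t \<in> {-real n..real n} \<longrightarrow> f t = 0"
    by eventually_elim (auto simp: indicator_def)
qed

lemma maximal_function_average_le:
  assumes "a < b" "a \<le> t" "t \<le> b"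
  shows "(\<integral>\<^sup>+s\<in>{a..b}. ennreal (cmod (g s)) \<partial>lebesgue) \<le> ennreal (b - a) * maximal_function g t"
proof -
  have "(\<integral>\<^sup>+s\<in>{a..b}. ennreal (cmod (g s)) \<partial>lebesgue) / ennreal (b - a) \<le> maximal_function g t"
    unfolding maximal_function_def by (rule SUP_upper2[of "(a, b)"]) (use assms in auto)
  then have "ennreal (b - a) * ((\<integral>\<^sup>+s\<in>{a..b}. ennreal (cmod (g s)) \<partial>lebesgue) / ennreal (b - a))
      \<le> ennreal (b - a) * maximal_function g t" by (rule mult_left_mono) simp
  then show ?thesis using assms
    by (simp add: ennreal_times_divide ennreal_mult_divide_eq mult.commute[of "ennreal (b - a)"])
qed

section \<open>Order and norm properties of vector-valued functions over a Banach function
  space\<close>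

context banach_function_space
begin

lemma vector_valued_ideal:
  assumes g: "g \<in> vector_valued \<Phi>" and f: "strongly_measurable f"
    and le: "AE t in lebesgue. norm (f t) \<le> norm (g t)"
  shows "f \<in> vector_valued \<Phi>" "vector_norm N f \<le> vector_norm N g"
proof -
  have "(\<lambda>t. complex_of_real (norm (f t))) \<in> borel_measurable lebesgue"
    using strongly_measurable_norm[OF f] by measurable
  then have "(\<lambda>t. complex_of_real (norm (f t))) \<in> \<Phi> \<and>
      N (\<lambda>t. complex_of_real (norm (f t))) \<le> N (\<lambda>t. complex_of_real (norm (g t)))"
    by (rule ideal) (use g le in \<open>auto simp: vector_valued_def\<close>)
  then show "f \<in> vector_valued \<Phi>" "vector_norm N f \<le> vector_norm N g"
    using f by (auto simp: vector_valued_def vector_norm_def)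
qed

lemma vector_norm_nonneg: "f \<in> vector_valued \<Phi> \<Longrightarrow> 0 \<le> vector_norm N f"
  by (simp add: vector_valued_def vector_norm_def norm_nonneg)

lemma vector_norm_eq_0:
  "f \<in> vector_valued \<Phi> \<Longrightarrow> vector_norm N f = 0 \<longleftrightarrow> (AE t in lebesgue. f t = 0)"
  by (simp add: vector_valued_def vector_norm_def norm_eq_0)

lemma vector_valued_add_le:
  assumes f: "f \<in> vector_valued \<Phi>" and g: "g \<in> vector_valued \<Phi>" and h: "strongly_measurable h"
    and le: "AE t in lebesgue. norm (h t) \<le> norm (f t) + norm (g t)"
  shows "h \<in> vector_valued \<Phi>" "vector_norm N h \<le> vector_norm N f + vector_norm N g"
proof -
  let ?F = "\<lambda>t. complex_of_real (norm (f t))" and ?G = "\<lambda>t. complex_of_real (norm (g t))"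
  have FG: "?F \<in> \<Phi>" "?G \<in> \<Phi>" using f g by (auto simp: vector_valued_def)
  then have FG': "(\<lambda>t. ?F t + ?G t) \<in> \<Phi>" using subspace by (simp add: fun_subspace_def)
  have hm: "(\<lambda>t. complex_of_real (norm (h t))) \<in> borel_measurable lebesgue"
    using strongly_measurable_norm[OF h] by measurable
  have "cmod (?F t + ?G t) = norm (f t) + norm (g t)" for t
    by (metis abs_of_nonneg add_nonneg_nonneg norm_ge_zero norm_of_real of_real_add)
  then have "(\<lambda>t. complex_of_real (norm (h t))) \<in> \<Phi> \<and>
      N (\<lambda>t. complex_of_real (norm (h t))) \<le> N (\<lambda>t. ?F t + ?G t)"
    by (intro ideal[OF hm FG']) (use le in simp)
  then show "h \<in> vector_valued \<Phi>" "vector_norm N h \<le> vector_norm N f + vector_norm N g"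
    using h norm_triangle[OF FG] by (auto simp: vector_valued_def vector_norm_def)
qed

lemma vector_valued_scale:
  assumes f: "f \<in> vector_valued \<Phi>" and h: "strongly_measurable h"
    and eq: "\<And>t. norm (h t) = c * norm (f t)" and c: "0 \<le> c"
  shows "h \<in> vector_valued \<Phi>" "vector_norm N h = c * vector_norm N f"
proof -
  let ?F = "\<lambda>t. complex_of_real (norm (f t))"
  have F: "?F \<in> \<Phi>" using f by (simp add: vector_valued_def)
  then have "(\<lambda>t. complex_of_real c * ?F t) \<in> \<Phi>"
    using subspace by (simp add: fun_subspace_def scaleC_complex_def)
  moreover have "(\<lambda>t. complex_of_real c * ?F t) = (\<lambda>t. complex_of_real (norm (h t)))" by (simp add: eq)
  ultimately show "h \<in> vector_valued \<Phi>" "vector_norm N h = c * vector_norm N f"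
    using h c norm_scale[OF F, of "complex_of_real c"] by (auto simp: vector_valued_def vector_norm_def)
qed

lemma vector_valued_zero: "(\<lambda>t. 0) \<in> vector_valued \<Phi>"
  using subspace by (simp add: vector_valued_def fun_subspace_def strongly_measurable_const)

lemma vector_valued_sum:
  fixes G :: "'i \<Rightarrow> real \<Rightarrow> real"
  assumes "finite S" "\<And>k. k \<in> S \<Longrightarrow> G k \<in> vector_valued \<Phi>"
  shows "(\<lambda>t. \<Sum>k\<in>S. G k t) \<in> vector_valued \<Phi> \<and>
    vector_norm N (\<lambda>t. \<Sum>k\<in>S. G k t) \<le> (\<Sum>k\<in>S. vector_norm N (G k))"
  using assms
proof (induction S rule: finite_induct)
  case empty
  then show ?case using vector_valued_zero vector_norm_eq_0[OF vector_valued_zero[where 'a=real]] by simp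
next
  case (insert k S)
  have IH: "(\<lambda>t. \<Sum>k\<in>S. G k t) \<in> vector_valued \<Phi>"
    "vector_norm N (\<lambda>t. \<Sum>k\<in>S. G k t) \<le> (\<Sum>k\<in>S. vector_norm N (G k))" using insert by auto
  have k: "G k \<in> vector_valued \<Phi>" using insert by simp
  have sm: "strongly_measurable (\<lambda>t. G k t + (\<Sum>k\<in>S. G k t))"
    using k IH(1) by (intro strongly_measurable_add) (auto simp: vector_valued_def)
  have le: "AE t in lebesgue. norm (G k t + (\<Sum>k\<in>S. G k t)) \<le> norm (G k t) + norm (\<Sum>k\<in>S. G k t)"
    by (intro AE_I2 norm_triangle_ineq)
  show ?case
    using vector_valued_add_le[OF k IH(1) sm le] IH(2) insert(1,2) by simp
qed

lemma fatou_bounded: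
  fixes G :: "nat \<Rightarrow> real \<Rightarrow> real" and h :: "real \<Rightarrow> real"
  assumes G: "\<And>n. G n \<in> vector_valued \<Phi>" "\<And>n t. 0 \<le> G n t"
    and inc: "AE t in lebesgue. \<forall>n. G n t \<le> G (Suc n) t" and lim: "AE t in lebesgue. (\<lambda>n. G n t) \<longlonglongrightarrow> h t"
    and h: "h \<in> borel_measurable lebesgue" "\<And>t. 0 \<le> h t"
    and bdd: "\<And>n. vector_norm N (G n) \<le> B"
  shows "h \<in> vector_valued \<Phi>" "vector_norm N h \<le> B"
proof -
  have G': "(\<lambda>t. complex_of_real (G n t)) \<in> \<Phi>" "N (\<lambda>t. complex_of_real (G n t)) \<le> B" for n
    using G bdd[of n] by (auto simp: vector_valued_def vector_norm_def)
  have "(\<lambda>t. complex_of_real (h t)) \<in> \<Phi> \<and>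
       N (\<lambda>t. complex_of_real (h t)) = (SUP n. N (\<lambda>t. complex_of_real (G n t)))"
  proof (rule fatou)
    show "AE t in lebesgue. (\<forall>n. 0 \<le> G n t \<and> G n t \<le> G (Suc n) t) \<and> (\<lambda>n. G n t) \<longlonglongrightarrow> h t"
      using inc lim by eventually_elim (simp add: G)
    show "bdd_above (range (\<lambda>n. N (\<lambda>t. complex_of_real (G n t))))" using G'(2) by (auto simp: bdd_above_def)
  qed (use G' h in auto)
  moreover have "(SUP n. N (\<lambda>t. complex_of_real (G n t))) \<le> B" by (rule cSUP_least) (use G'(2) in auto)
  ultimately show "h \<in> vector_valued \<Phi>" "vector_norm N h \<le> B"
    using h by (auto simp: vector_valued_def vector_norm_def strongly_measurable_iff_borel)
qed

end

text \<open>The part of the Banach function space axioms that the Rubio de Francia algorithm uses; the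
  Koethe dual satisfies it as well.\<close>

locale sigma_normed =
  fixes \<Phi> :: "(real \<Rightarrow> complex) set" and N :: "(real \<Rightarrow> complex) \<Rightarrow> real"
  assumes borel: "\<Phi> \<subseteq> borel_measurable lebesgue"
    and nonneg: "\<And>f::real \<Rightarrow> real. f \<in> vector_valued \<Phi> \<Longrightarrow> 0 \<le> vector_norm N f"
    and scale: "\<And>(f::real \<Rightarrow> real) c. f \<in> vector_valued \<Phi> \<Longrightarrow> 0 \<le> c \<Longrightarrow>
      (\<lambda>t. c * f t) \<in> vector_valued \<Phi> \<and> vector_norm N (\<lambda>t. c * f t) = c * vector_norm N f"
    and series: "\<And>G::nat \<Rightarrow> real \<Rightarrow> real. (\<And>k. G k \<in> vector_valued \<Phi>) \<Longrightarrow> (\<And>k t. 0 \<le> G k t) \<Longrightarrow>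
      summable (\<lambda>k. vector_norm N (G k)) \<Longrightarrow>
      \<exists>h\<in>vector_valued \<Phi>. (\<forall>t. 0 \<le> h t) \<and> (AE t in lebesgue. (\<lambda>k. G k t) sums h t) \<and>
        vector_norm N h \<le> (\<Sum>k. vector_norm N (G k))"

text \<open>The partial sums are Cauchy, so completeness provides a norm limit f. Comparison with
  |f| shows that the series converges almost everywhere, and the Fatou property then bounds the norm
  of the pointwise sum.\<close>

lemma (in banach_function_space) sigma_normed: "sigma_normed \<Phi> N"
proof
  show "\<Phi> \<subseteq> borel_measurable lebesgue" by (rule measurable)
  show "0 \<le> vector_norm N f" if "f \<in> vector_valued \<Phi>" for f :: "real \<Rightarrow> real"
    using that by (rule vector_norm_nonneg)
  show "(\<lambda>t. c * f t) \<in> vector_valued \<Phi> \<and> vector_norm N (\<lambda>t. c * f t) = c * vector_norm N f"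
    if f: "f \<in> vector_valued \<Phi>" and c: "0 \<le> c" for f :: "real \<Rightarrow> real" and c
  proof -
    have "strongly_measurable (\<lambda>t. c * f t)"
      using f strongly_measurable_scaleR[OF strongly_measurable_const[of c], of f] by (simp add: vector_valued_def)
    from vector_valued_scale[OF f this _ c] c show ?thesis by (simp add: abs_mult)
  qed
next
  fix G :: "nat \<Rightarrow> real \<Rightarrow> real"
  assume G: "\<And>k. G k \<in> vector_valued \<Phi>" and G0: "\<And>k t. 0 \<le> G k t"
    and sum: "summable (\<lambda>k. vector_norm N (G k))"
  define S where "S n t = (\<Sum>k<n. G k t)" for n t
  define P where "P n = (\<Sum>k<n. vector_norm N (G k))" for n
  have Nn: "0 \<le> vector_norm N (G k)" for k by (rule vector_norm_nonneg[OF G])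
  have S: "S n \<in> vector_valued \<Phi>" "vector_norm N (S n) \<le> P n" for n
    using vector_valued_sum[of "{..<n}" G] G by (auto simp: S_def[abs_def] P_def)
  have S0: "0 \<le> S n t" for n t unfolding S_def by (intro sum_nonneg G0)
  have Sm: "strongly_measurable (S n)" for n using S by (simp add: vector_valued_def)
  have inc: "S n t \<le> S (Suc n) t" for n t by (simp add: S_def G0)
  have S_mono: "S n t \<le> S m t" if "n \<le> m" for n m t
    using that inc by (rule lift_Suc_mono_le[of "\<lambda>n. S n t", rotated])
  have diff: "vector_norm N (\<lambda>t. S m t - S n t) \<le> P m - P n" if nm: "n \<le> m" for m n
  proof -
    have "{..<m} = {..<n} \<union> {n..<m}" using nm by auto
    then have "S m t - S n t = (\<Sum>k\<in>{n..<m}. G k t)" and P: "P m - P n = (\<Sum>k\<in>{n..<m}. vector_norm N (G k))" for t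
      unfolding S_def P_def by (auto simp: sum.union_disjoint ivl_disj_int)
    then show ?thesis using vector_valued_sum[of "{n..<m}" G] G by simp
  qed
  have F: "(\<lambda>t. complex_of_real (S n t)) \<in> \<Phi>" for n
    using S(1)[of n] S0[of n] by (simp add: vector_valued_def)
  have NF: "N (\<lambda>t. complex_of_real (S m t) - complex_of_real (S n t)) \<le> \<bar>P m - P n\<bar>" for m n
  proof -
    have *: "N (\<lambda>t. complex_of_real (S m t) - complex_of_real (S n t)) \<le> vector_norm N (\<lambda>t. S j t - S i t)"
      if "(i = n \<and> j = m) \<or> (i = m \<and> j = n)" for i j
    proof -
      have "(\<lambda>t. S j t - S i t) \<in> vector_valued \<Phi>"
        by (rule vector_valued_add_le(1)[OF S(1)[of j] S(1)[of i]])
          (auto intro: strongly_measurable_diff Sm)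
      then have g: "(\<lambda>t. complex_of_real (norm (S j t - S i t))) \<in> \<Phi>" by (simp add: vector_valued_def)
      have m: "(\<lambda>t. complex_of_real (S m t) - complex_of_real (S n t)) \<in> borel_measurable lebesgue"
        using strongly_measurable_borel[OF Sm[of m]] strongly_measurable_borel[OF Sm[of n]] by measurable
      have "cmod (complex_of_real (S m t) - complex_of_real (S n t)) = \<bar>S j t - S i t\<bar>" for t
        using that by (auto simp flip: of_real_diff)
      then show ?thesis
        using ideal[OF m g] by (simp add: vector_norm_def)
    qed
    show ?thesis
    proof (cases "n \<le> m")
      case True
      then show ?thesis using *[of n m] diff[of n m] by simp
    next
      case False
      then show ?thesis using *[of m n] diff[of m n] by simp
    qed
  qed
  have P_conv: "convergent P" using sum unfolding P_def by (simp add: summable_iff_convergent)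
  obtain f where f: "f \<in> \<Phi>" "(\<lambda>n. N (\<lambda>t. complex_of_real (S n t) - f t)) \<longlonglongrightarrow> 0"
  proof (rule complete[of "\<lambda>n t. complex_of_real (S n t)", OF F, THEN bexE])
    fix e :: real assume "0 < e"
    then obtain k where k: "\<And>m n. k \<le> m \<Longrightarrow> k \<le> n \<Longrightarrow> norm (P m - P n) < e"
      using convergent_Cauchy[OF P_conv] CauchyD by blast
    show "\<exists>k. \<forall>m\<ge>k. \<forall>n\<ge>k. N (\<lambda>t. complex_of_real (S m t) - complex_of_real (S n t)) < e"
      using k by (intro exI[of _ k] allI impI le_less_trans[OF NF]) simp
  qed blast
  have fm: "f \<in> borel_measurable lebesgue" using f(1) measurable by blast
  have fS: "(\<lambda>t. complex_of_real (S n t) - f t) \<in> \<Phi>" for n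
  proof -
    have "(\<lambda>t. scaleC (- 1) (f t)) \<in> \<Phi>" using subspace f(1) by (simp add: fun_subspace_def)
    then have "(\<lambda>t. complex_of_real (S n t) + scaleC (- 1) (f t)) \<in> \<Phi>"
      using subspace F[of n] by (simp add: fun_subspace_def)
    then show ?thesis by (simp add: scaleC_complex_def)
  qed
  have "AE t in lebesgue. S m t \<le> cmod (f t)" for m
  proof -
    \<comment> \<open>The positive part of S_m - |f| is dominated by |S_n - f| for every n >= m,
      since the partial sums increase; its norm is therefore 0.\<close>
    define g where "g t = max 0 (S m t - cmod (f t))" for t
    have gm: "g \<in> borel_measurable lebesgue"
      unfolding g_def using fm strongly_measurable_borel[OF Sm[of m]] by measurable
    then have gm': "(\<lambda>t. complex_of_real (g t)) \<in> borel_measurable lebesgue" by measurable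
    have g0: "0 \<le> g t" for t by (simp add: g_def)
    have g: "(\<lambda>t. complex_of_real (g t)) \<in> \<Phi> \<and> N (\<lambda>t. complex_of_real (g t)) \<le> N (\<lambda>t. complex_of_real (S n t) - f t)"
      if "m \<le> n" for n
    proof (rule ideal[OF gm' fS])
      have "S m t - cmod (f t) \<le> cmod (complex_of_real (S n t) - f t)" for t
        using S_mono[OF that, of t] S0[of n t] norm_triangle_ineq2[of "complex_of_real (S n t)" "f t"] by simp
      then show "AE t in lebesgue. cmod (complex_of_real (g t)) \<le> cmod (complex_of_real (S n t) - f t)"
        by (intro AE_I2) (simp add: g_def)
    qed
    have "N (\<lambda>t. complex_of_real (g t)) \<le> 0"
    proof (rule tendsto_lowerbound[OF f(2)])
      show "\<forall>\<^sub>F n in sequentially. N (\<lambda>t. complex_of_real (g t)) \<le> N (\<lambda>t. complex_of_real (S n t) - f t)"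
        using g by (auto simp: eventually_sequentially)
    qed simp
    then have "N (\<lambda>t. complex_of_real (g t)) = 0" using norm_nonneg g[OF order_refl] by (simp add: antisym)
    then have "AE t in lebesgue. complex_of_real (g t) = 0" using norm_eq_0 g[OF order_refl] by blast
    then show ?thesis by eventually_elim (simp add: g_def max_def split: if_splits)
  qed
  then have "AE t in lebesgue. \<forall>m. S m t \<le> cmod (f t)" unfolding AE_all_countable by (rule allI)
  then have summ: "AE t in lebesgue. summable (\<lambda>k. G k t)"
  proof eventually_elim
    case (elim t)
    then show ?case by (intro summableI_nonneg_bounded[of _ "cmod (f t)"]) (auto simp: G0 S_def)
  qed
  define h where "h t = (if summable (\<lambda>k. G k t) then \<Sum>k. G k t else 0)" for t
  have sums: "AE t in lebesgue. (\<lambda>k. G k t) sums h t"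
    using summ by eventually_elim (auto simp: h_def)
  then have lim: "AE t in lebesgue. (\<lambda>n. S n t) \<longlonglongrightarrow> h t" by (simp add: sums_def S_def)
  have h0: "0 \<le> h t" for t by (auto simp: h_def G0 intro: suminf_nonneg)
  have hm: "h \<in> borel_measurable lebesgue"
    by (rule strongly_measurable_borel[OF strongly_measurable_LIMSEQ[OF Sm lim]])
  have bound: "vector_norm N (S n) \<le> (\<Sum>k. vector_norm N (G k))" for n
    using S(2)[of n] sum_le_suminf[OF sum, of "{..<n}"] Nn by (simp add: P_def)
  have "h \<in> vector_valued \<Phi>" "vector_norm N h \<le> (\<Sum>k. vector_norm N (G k))"
    by (rule fatou_bounded[OF S(1) S0 _ lim hm h0 bound]; use inc in simp)+
  with h0 sums show "\<exists>h\<in>vector_valued \<Phi>. (\<forall>t. 0 \<le> h t) \<and> (AE t in lebesgue. (\<lambda>k. G k t) sums h t) \<and>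
        vector_norm N h \<le> (\<Sum>k. vector_norm N (G k))" by blast
qed

text \<open>The Rubio de Francia algorithm: sum the iterates of the maximal operator.\<close>

lemma (in sigma_normed) A1_majorant:
  assumes M: "maximal_bounded_on \<Phi> N"
  obtains C where "0 < C" "\<And>g :: real \<Rightarrow> real. g \<in> vector_valued \<Phi> \<Longrightarrow> (\<And>t. 0 \<le> g t) \<Longrightarrow>
    \<exists>v\<in>vector_valued \<Phi>. A1_bound C v \<and> (AE t in lebesgue. g t \<le> v t) \<and> vector_norm N v \<le> 2 * vector_norm N g"
proof -
  obtain B0 where B0: "\<And>g. g \<in> \<Phi> \<Longrightarrow> (AE t in lebesgue. maximal_function g t < \<infinity>) \<and>
        (\<lambda>t. complex_of_real (enn2real (maximal_function g t))) \<in> \<Phi> \<and>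
        N (\<lambda>t. complex_of_real (enn2real (maximal_function g t))) \<le> B0 * N g"
    using M unfolding maximal_bounded_on_def by blast
  \<comment> \<open>A bound of at least 1 makes the resulting A_1 constant 2 B positive and allows
    division by B.\<close>
  define B where "B = max 1 B0"
  have B: "1 \<le> B" by (simp add: B_def)
  define mx where "mx g t = enn2real (maximal_function (\<lambda>s. complex_of_real (g s)) t)" for g t
  have mx0: "0 \<le> mx g t" for g t by (simp add: mx_def)
  have mx: "mx g \<in> vector_valued \<Phi> \<and> vector_norm N (mx g) \<le> B * vector_norm N g \<and>
      (AE t in lebesgue. maximal_function (\<lambda>s. complex_of_real (g s)) t = ennreal (mx g t))"
    if g: "g \<in> vector_valued \<Phi>" "\<And>t. 0 \<le> g t" for g
  proof (intro conjI)
    have g': "(\<lambda>s. complex_of_real (g s)) \<in> \<Phi>" using g by (simp add: vector_valued_def)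
    have "(\<lambda>t. complex_of_real (mx g t)) \<in> \<Phi>" using B0[OF g'] by (simp add: mx_def)
    moreover from this have "(\<lambda>t. Re (complex_of_real (mx g t))) \<in> borel_measurable lebesgue"
      using borel by (intro borel_measurable_continuous_on[where f=Re]) (auto intro!: continuous_intros)
    ultimately show "mx g \<in> vector_valued \<Phi>"
      using mx0 by (simp add: vector_valued_def strongly_measurable_iff_borel)
    have "vector_norm N (mx g) \<le> B0 * vector_norm N g"
      using B0[OF g'] g(2) mx0 by (simp add: vector_norm_def mx_def)
    also have "\<dots> \<le> B * vector_norm N g" using nonneg[OF g(1)] by (intro mult_right_mono) (auto simp: B_def)
    finally show "vector_norm N (mx g) \<le> B * vector_norm N g" .
    show "AE t in lebesgue. maximal_function (\<lambda>s. complex_of_real (g s)) t = ennreal (mx g t)"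
      using B0[OF g', THEN conjunct1] by eventually_elim (simp add: mx_def)
  qed
  show thesis
  proof (rule that[of "2 * B"])
    fix g :: "real \<Rightarrow> real" assume g: "g \<in> vector_valued \<Phi>" "\<And>t. 0 \<le> g t"
    define it where "it k = (mx ^^ k) g" for k
    have it: "it k \<in> vector_valued \<Phi> \<and> (\<forall>t. 0 \<le> it k t) \<and> vector_norm N (it k) \<le> B ^ k * vector_norm N g" for k
    proof (induction k)
      case (Suc k)
      have "vector_norm N (it (Suc k)) \<le> B * vector_norm N (it k)" using mx[of "it k"] Suc by (simp add: it_def)
      also have "\<dots> \<le> B * (B ^ k * vector_norm N g)" using Suc B by (intro mult_left_mono) auto
      finally show ?case using mx[of "it k"] Suc mx0 by (simp add: it_def mult.assoc)
    qed (use g in \<open>simp add: it_def\<close>)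
    \<comment> \<open>The k-th iterate has norm at most B^k times that of g; these coefficients
      leave a geometric series with sum 2.\<close>
    define c where "c k = (1 / (2 * B)) ^ k" for k
    have c: "0 < c k" for k using B by (simp add: c_def)
    define G where "G k t = c k * it k t" for k t
    have G: "G k \<in> vector_valued \<Phi>" "vector_norm N (G k) \<le> (1 / 2) ^ k * vector_norm N g" for k
    proof -
      have s: "G k \<in> vector_valued \<Phi> \<and> vector_norm N (G k) = c k * vector_norm N (it k)"
        using scale[of "it k" "c k"] it c[of k] by (simp add: G_def[abs_def])
      then show "G k \<in> vector_valued \<Phi>" by simp
      have "vector_norm N (G k) \<le> c k * (B ^ k * vector_norm N g)"
        using s it[of k] c[of k] by (simp add: mult_left_mono)
      also have "\<dots> = (1 / 2) ^ k * vector_norm N g" using B by (simp add: c_def power_mult_distrib power_divide)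
      finally show "vector_norm N (G k) \<le> (1 / 2) ^ k * vector_norm N g" .
    qed
    have G0: "0 \<le> G k t" for k t using it c[of k] by (simp add: G_def)
    have geo: "summable (\<lambda>k. (1 / 2 :: real) ^ k * vector_norm N g)" by (intro summable_mult2 summable_geometric) simp
    have summ: "summable (\<lambda>k. vector_norm N (G k))"
      by (rule summable_comparison_test'[OF geo, of 0]) (use G nonneg in simp)
    obtain v where v: "v \<in> vector_valued \<Phi>" "\<And>t. 0 \<le> v t" "AE t in lebesgue. (\<lambda>k. G k t) sums v t"
      "vector_norm N v \<le> (\<Sum>k. vector_norm N (G k))"
      using series[OF G(1) G0 summ] by blast
    have "(\<Sum>k. vector_norm N (G k)) \<le> (\<Sum>k. (1 / 2) ^ k * vector_norm N g)" by (rule suminf_le[OF G(2) summ geo])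
    also have "\<dots> = 2 * vector_norm N g" by (simp add: suminf_mult2[symmetric] suminf_geometric)
    finally have v_norm: "vector_norm N v \<le> 2 * vector_norm N g" using v(4) by simp
    have gv: "AE t in lebesgue. g t \<le> v t"
      using v(3)
    proof eventually_elim
      case (elim t)
      have "(\<Sum>k\<in>{0}. G k t) \<le> (\<Sum>k. G k t)"
        by (rule sum_le_suminf) (use elim G0 in \<open>auto simp: sums_iff\<close>)
      then show ?case using elim by (simp add: sums_iff G_def c_def it_def)
    qed
    have Gm [measurable]: "G k \<in> borel_measurable lebesgue" for k
      using G(1)[of k] by (simp add: vector_valued_def strongly_measurable_iff_borel)
    have vm: "v \<in> borel_measurable lebesgue" using v(1) by (simp add: vector_valued_def strongly_measurable_iff_borel)
    have "AE t in lebesgue. maximal_function (\<lambda>s. complex_of_real (it k s)) t = ennreal (it (Suc k) t)" for k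
      using mx[of "it k"] it[of k] by (simp add: it_def)
    then have "AE t in lebesgue. \<forall>k. maximal_function (\<lambda>s. complex_of_real (it k s)) t = ennreal (it (Suc k) t)"
      unfolding AE_all_countable by (rule allI)
    then have "AE t in lebesgue. \<forall>a b. a < b \<longrightarrow> a \<le> t \<longrightarrow> t \<le> b \<longrightarrow>
        (\<integral>\<^sup>+s\<in>{a..b}. ennreal (v s) \<partial>lebesgue) \<le> ennreal (2 * B * (b - a) * v t)"
      using v(3)
    proof (eventually_elim, intro allI impI)
      fix t a b :: real
      assume max: "\<forall>k. maximal_function (\<lambda>s. complex_of_real (it k s)) t = ennreal (it (Suc k) t)"
        and sums: "(\<lambda>k. G k t) sums v t" and ab: "a < b" "a \<le> t" "t \<le> b"
      have [measurable]: "{a..b} \<in> sets lebesgue" by simp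
      define D where "D = 2 * B * (b - a)"
      have D: "0 \<le> D" using B ab by (simp add: D_def)
      \<comment> \<open>Integrating the k-th term over the interval costs the maximal function of
        the k-th iterate at t, which is the next iterate. The coefficients turn this into 2 B (b -
        a) times term k + 1, so summation reproduces v without its term of index 0.\<close>
      have step: "(\<integral>\<^sup>+s\<in>{a..b}. ennreal (G k s) \<partial>lebesgue) \<le> ennreal (D * G (Suc k) t)" for k
      proof -
        have "(\<integral>\<^sup>+s\<in>{a..b}. ennreal (G k s) \<partial>lebesgue) =
            (\<integral>\<^sup>+s. ennreal (c k) * (ennreal (cmod (complex_of_real (it k s))) * indicator {a..b} s) \<partial>lebesgue)"
          using it[of k] c[of k] by (intro nn_integral_cong) (simp add: G_def ennreal_mult mult.assoc)
        also have "\<dots> = ennreal (c k) * (\<integral>\<^sup>+s\<in>{a..b}. ennreal (cmod (complex_of_real (it k s))) \<partial>lebesgue)"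
        proof (rule nn_integral_cmult)
          have [measurable]: "it k \<in> borel_measurable lebesgue"
            using it[of k] by (simp add: vector_valued_def strongly_measurable_iff_borel)
          show "(\<lambda>s. ennreal (cmod (complex_of_real (it k s))) * indicator {a..b} s) \<in> borel_measurable lebesgue"
            by measurable
        qed
        also have "\<dots> \<le> ennreal (c k) * (ennreal (b - a) * ennreal (it (Suc k) t))"
          using maximal_function_average_le[OF ab, of "\<lambda>s. complex_of_real (it k s)"] max
          by (intro mult_left_mono) auto
        also have "\<dots> = ennreal (c k * ((b - a) * it (Suc k) t))"
          using c[of k] ab it[of "Suc k"] by (simp add: ennreal_mult)
        also have "c k * ((b - a) * it (Suc k) t) = D * G (Suc k) t"
          using B by (simp add: G_def c_def D_def)
        finally show ?thesis .
      qed
      have "(\<integral>\<^sup>+s\<in>{a..b}. ennreal (v s) \<partial>lebesgue) = (\<integral>\<^sup>+s. (\<Sum>k. ennreal (G k s) * indicator {a..b} s) \<partial>lebesgue)"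
      proof (rule nn_integral_cong_AE)
        show "AE s in lebesgue. ennreal (v s) * indicator {a..b} s = (\<Sum>k. ennreal (G k s) * indicator {a..b} s)"
          using v(3) by eventually_elim (simp add: suminf_ennreal_eq[OF G0])
      qed
      also have "\<dots> = (\<Sum>k. \<integral>\<^sup>+s\<in>{a..b}. ennreal (G k s) \<partial>lebesgue)"
        by (rule nn_integral_suminf) measurable
      also have "\<dots> \<le> (\<Sum>k. ennreal (D * G (Suc k) t))" by (intro suminf_le step) auto
      also have "\<dots> = ennreal (D * (v t - G 0 t))"
      proof (rule suminf_ennreal_eq)
        show "(\<lambda>k. D * G (Suc k) t) sums (D * (v t - G 0 t))"
          using sums sums_Suc_iff[of "\<lambda>k. G k t" "v t - G 0 t"] by (intro sums_mult) simp
      qed (use D G0 in auto)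
      also have "\<dots> \<le> ennreal (2 * B * (b - a) * v t)"
        unfolding D_def[symmetric] using D G0[of 0 t] by (intro ennreal_leI mult_left_mono) auto
      finally show "(\<integral>\<^sup>+s\<in>{a..b}. ennreal (v s) \<partial>lebesgue) \<le> ennreal (2 * B * (b - a) * v t)" .
    qed
    then have "A1_bound (2 * B) v" using vm v(2) by (simp add: A1_bound_def)
    with v(1) gv v_norm show "\<exists>v\<in>vector_valued \<Phi>. A1_bound (2 * B) v \<and> (AE t in lebesgue. g t \<le> v t) \<and>
        vector_norm N v \<le> 2 * vector_norm N g" by blast
  qed (use B in simp)
qed

subsection \<open>The Koethe dual\<close>

lemma kothe_ennnorm_mono:
  assumes "AE t in lebesgue. cmod (g t) \<le> cmod (h t)"
  shows "kothe_ennnorm \<Phi> N g \<le> kothe_ennnorm \<Phi> N h"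
  unfolding kothe_ennnorm_def
proof (rule SUP_mono', rule nn_integral_mono_AE)
  show "AE t in lebesgue. ennreal (cmod (f t * g t)) \<le> ennreal (cmod (f t * h t))" for f
    using assms by eventually_elim (auto simp: norm_mult intro!: ennreal_leI mult_left_mono)
qed

lemma vector_valued_kothe_iff:
  "h \<in> vector_valued (kothe_dual \<Phi> N) \<longleftrightarrow> strongly_measurable h \<and>
     kothe_ennnorm \<Phi> N (\<lambda>t. complex_of_real (norm (h t))) < \<infinity>"
proof -
  have "(\<lambda>t. complex_of_real (norm (h t))) \<in> borel_measurable lebesgue" if "strongly_measurable h"
    using strongly_measurable_norm[OF that] by measurable
  then show ?thesis by (auto simp: vector_valued_def kothe_dual_def)
qed

lemma ennreal_vector_norm_kothe:
  "h \<in> vector_valued (kothe_dual \<Phi> N) \<Longrightarrow>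
     ennreal (vector_norm (kothe_norm \<Phi> N) h) = kothe_ennnorm \<Phi> N (\<lambda>t. complex_of_real (norm (h t)))"
  by (simp add: vector_valued_kothe_iff vector_norm_def kothe_norm_def)

context banach_function_space
begin

text \<open>Hoelder's inequality for the Koethe pair. A positive upper bound R stands for the norm
  of f so that dividing by it is also possible when f vanishes almost everywhere.\<close>

lemma kothe_pairing:
  fixes f :: "real \<Rightarrow> 'x::real_normed_vector" and h :: "real \<Rightarrow> real"
  assumes f: "f \<in> vector_valued \<Phi>" "vector_norm N f \<le> R" and R: "0 < R" and hm: "h \<in> borel_measurable lebesgue"
  shows "(\<integral>\<^sup>+t. ennreal (norm (f t) * norm (h t)) \<partial>lebesgue) \<le>
    ennreal R * kothe_ennnorm \<Phi> N (\<lambda>t. complex_of_real (norm (h t)))"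
proof -
  let ?F = "\<lambda>t. complex_of_real (norm (f t))"
  have F: "?F \<in> \<Phi>" "N ?F \<le> R" using f by (auto simp: vector_valued_def vector_norm_def)
  let ?G = "\<lambda>t. complex_of_real (1 / R) * ?F t"
  have "(\<lambda>t. c * ?F t) \<in> \<Phi>" for c using subspace F(1) by (simp add: fun_subspace_def scaleC_complex_def)
  then have "?G \<in> \<Phi>" .
  moreover have "N ?G \<le> 1" unfolding norm_scale[OF F(1)] norm_of_real using F(2) R by simp
  ultimately have le: "(\<integral>\<^sup>+t. ennreal (cmod (?G t * complex_of_real (norm (h t)))) \<partial>lebesgue) \<le>
      kothe_ennnorm \<Phi> N (\<lambda>t. complex_of_real (norm (h t)))"
    unfolding kothe_ennnorm_def by (intro SUP_upper) simp
  have [measurable]: "(\<lambda>t. norm (f t)) \<in> borel_measurable lebesgue"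
    using f by (auto simp: vector_valued_def intro: strongly_measurable_norm)
  note hm[measurable]
  have "cmod (?G t * complex_of_real (norm (h t))) = norm (f t) * norm (h t) / R" for t
    using R by (simp add: norm_mult norm_divide)
  then have eq: "ennreal (norm (f t) * norm (h t)) = ennreal R * ennreal (cmod (?G t * complex_of_real (norm (h t))))" for t
    using R by (simp flip: ennreal_mult)
  have "(\<integral>\<^sup>+t. ennreal (norm (f t) * norm (h t)) \<partial>lebesgue) =
      ennreal R * (\<integral>\<^sup>+t. ennreal (cmod (?G t * complex_of_real (norm (h t)))) \<partial>lebesgue)"
    unfolding eq by (rule nn_integral_cmult) measurable
  also have "\<dots> \<le> ennreal R * kothe_ennnorm \<Phi> N (\<lambda>t. complex_of_real (norm (h t)))"
    by (rule mult_left_mono[OF le]) simp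
  finally show ?thesis .
qed

text \<open>A nonzero f has positive integral over a large interval, so its maximal function is
  bounded below there by a positive constant; a multiple of the maximal function dominates the
  indicator.\<close>

lemma interval_indicator_in:
  assumes M: "maximal_bounded_on \<Phi> N"
  shows "interval_indicator n \<in> vector_valued \<Phi>"
proof -
  obtain f where f: "f \<in> \<Phi>" "\<not> (AE t in lebesgue. f t = 0)" using nonzero by blast
  have [measurable]: "f \<in> borel_measurable lebesgue" using f measurable by blast
  have "\<exists>m. (\<integral>\<^sup>+s\<in>{-real m..real m}. ennreal (cmod (f s)) \<partial>lebesgue) \<noteq> 0"
    using AE_zero_of_intervals[of f] f(2) by fastforce
  then obtain m where m: "(\<integral>\<^sup>+s\<in>{-real m..real m}. ennreal (cmod (f s)) \<partial>lebesgue) \<noteq> 0" by blast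
  \<comment> \<open>Large enough to contain both the interval on which f is seen to be nonzero and
    the given one; \<open>Suc\<close> keeps it nondegenerate.\<close>
  define k where "k = real (Suc (max m n))"
  have k: "real m \<le> k" "real n \<le> k" "0 < k" by (auto simp: k_def)
  let ?I = "\<integral>\<^sup>+s\<in>{-k..k}. ennreal (cmod (f s)) \<partial>lebesgue"
  have "(\<integral>\<^sup>+s\<in>{-real m..real m}. ennreal (cmod (f s)) \<partial>lebesgue) \<le> ?I"
    using k by (intro nn_integral_mono mult_left_mono) (auto simp: indicator_def)
  then have I0: "?I \<noteq> 0" using m by auto
  define g where "g t = enn2real (maximal_function f t)" for t
  have "(AE t in lebesgue. maximal_function f t < \<infinity>) \<and> (\<lambda>t. complex_of_real (g t)) \<in> \<Phi>"
    using M f(1) unfolding maximal_bounded_on_def g_def by blast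
  then have fin: "AE t in lebesgue. maximal_function f t = ennreal (g t)" and g\<Phi>: "(\<lambda>t. complex_of_real (g t)) \<in> \<Phi>"
    by (auto simp: g_def)
  have g0: "0 \<le> g t" for t by (simp add: g_def)
  have "(\<lambda>t. Re (complex_of_real (g t))) \<in> borel_measurable lebesgue"
    using measurable g\<Phi> by (intro borel_measurable_continuous_on[where f=Re]) (auto intro!: continuous_intros)
  then have g: "g \<in> vector_valued \<Phi>"
    using g\<Phi> g0 by (simp add: vector_valued_def strongly_measurable_iff_borel)
  have avg: "AE t in lebesgue. t \<in> {-k..k} \<longrightarrow> ?I \<le> ennreal (2 * k * g t)"
    using fin
  proof (eventually_elim, intro impI)
    fix t assume "maximal_function f t = ennreal (g t)" "t \<in> {-k..k}"
    then show "?I \<le> ennreal (2 * k * g t)"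
      using maximal_function_average_le[of "-k" k t f] k g0[of t] by (simp add: ennreal_mult)
  qed
  then obtain t where "- k \<le> t" "t \<le> k" "t \<in> {-k..k} \<longrightarrow> ?I \<le> ennreal (2 * k * g t)"
    by (rule AE_lebesgue_ex_in_interval[where a="- k" and b=k]) (use k in auto)
  then have "?I \<noteq> \<infinity>" by (auto simp: top_unique)
  with I0 obtain i where i: "?I = ennreal i" "0 < i" by (cases ?I) (auto simp: less_le)
  let ?c = "2 * k / i"
  have cg: "(\<lambda>t. ?c * g t) \<in> vector_valued \<Phi>"
    using sigma_normed.scale[OF sigma_normed g, of ?c] i k by simp
  show ?thesis
  proof (rule vector_valued_ideal(1)[OF cg])
    show "strongly_measurable (interval_indicator n)" by (simp add: strongly_measurable_iff_borel)
    show "AE t in lebesgue. norm (interval_indicator n t) \<le> norm (?c * g t)"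
      using avg
    proof eventually_elim
      case (elim t)
      show ?case
      proof (cases "t \<in> {-real n..real n}")
        case True
        then have "ennreal i \<le> ennreal (2 * k * g t)" using elim k i by auto
        then have "i \<le> 2 * k * g t" using k g0[of t] by (simp add: ennreal_le_iff)
        then have "1 \<le> ?c * g t" using i by (simp add: field_simps)
        then have "1 \<le> norm (?c * g t)" unfolding real_norm_def by (rule order_trans[OF _ abs_ge_self])
        then show ?thesis using True by (simp only: interval_indicator_def indicator_simps norm_one)
      qed (simp add: interval_indicator_def)
    qed
  qed
qed

text \<open>The interval of index 0 is a single point and its indicator is null, hence
  \<open>Suc n\<close>.\<close>

lemma interval_indicator_norm_pos:
  assumes M: "maximal_bounded_on \<Phi> N"
  shows "0 < vector_norm N (interval_indicator (Suc n))"
proof -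
  have "\<not> (AE t in lebesgue. interval_indicator (Suc n) t = 0)"
  proof
    assume "AE t in lebesgue. interval_indicator (Suc n) t = 0"
    then obtain t where "- real (Suc n) \<le> t" "t \<le> real (Suc n)" "interval_indicator (Suc n) t = 0"
      by (rule AE_lebesgue_ex_in_interval[where a="- real (Suc n)" and b="real (Suc n)"]) auto
    then show False by (simp add: interval_indicator_def)
  qed
  then show ?thesis
    using vector_norm_eq_0[OF interval_indicator_in[OF M]] vector_norm_nonneg[OF interval_indicator_in[OF M]]
    by (metis less_eq_real_def)
qed

text \<open>On an interval I the average of |f| is at most the maximal function of f. Taking norms
  bounds this average times the norm of the indicator of I by the norm of the maximal function, so
  the integral of |f| over I is bounded uniformly on the unit ball.\<close>

lemma interval_indicator_in_kothe:
  assumes M: "maximal_bounded_on \<Phi> N"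
  shows "interval_indicator n \<in> vector_valued (kothe_dual \<Phi> N)"
proof -
  let ?n = "real (Suc n)" and ?ind = "interval_indicator (Suc n)"
  obtain B where B: "\<And>g. g \<in> \<Phi> \<Longrightarrow> (AE t in lebesgue. maximal_function g t < \<infinity>) \<and>
        (\<lambda>t. complex_of_real (enn2real (maximal_function g t))) \<in> \<Phi> \<and>
        N (\<lambda>t. complex_of_real (enn2real (maximal_function g t))) \<le> B * N g"
    using M unfolding maximal_bounded_on_def by blast
  have pos: "0 < vector_norm N ?ind" by (rule interval_indicator_norm_pos[OF M])
  \<comment> \<open>The bound B comes from an existential statement and has no sign;
    \<open>max 0 B\<close> allows products to be compared.\<close>
  have "kothe_ennnorm \<Phi> N (\<lambda>t. complex_of_real (?ind t)) \<le>
      ennreal (2 * ?n * max 0 B / vector_norm N ?ind)"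
    unfolding kothe_ennnorm_def
  proof (rule SUP_least)
    fix f assume f': "f \<in> {f \<in> \<Phi>. N f \<le> 1}"
    then have f: "f \<in> \<Phi>" "N f \<le> 1" by auto
    let ?I = "\<integral>\<^sup>+s\<in>{-?n..?n}. ennreal (cmod (f s)) \<partial>lebesgue"
    define g where "g t = enn2real (maximal_function f t)" for t
    have fin: "AE t in lebesgue. maximal_function f t = ennreal (g t)"
      using B[OF f(1), THEN conjunct1] by eventually_elim (simp add: g_def)
    have g\<Phi>: "(\<lambda>t. complex_of_real (g t)) \<in> \<Phi>" "N (\<lambda>t. complex_of_real (g t)) \<le> B * N f"
      using B[OF f(1)] by (auto simp: g_def)
    have g0: "0 \<le> g t" for t by (simp add: g_def)
    have "(\<lambda>t. Re (complex_of_real (g t))) \<in> borel_measurable lebesgue"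
      using measurable g\<Phi> by (intro borel_measurable_continuous_on[where f=Re]) (auto intro!: continuous_intros)
    then have g: "g \<in> vector_valued \<Phi>"
      using g\<Phi> g0 by (simp add: vector_valued_def strongly_measurable_iff_borel)
    have "vector_norm N g \<le> B * N f" using g\<Phi>(2) g0 by (simp add: vector_norm_def)
    also have "\<dots> \<le> max 0 B * 1" using f norm_nonneg[OF f(1)] by (intro mult_mono) auto
    finally have gN: "vector_norm N g \<le> max 0 B" by simp
    have avg: "AE t in lebesgue. t \<in> {-?n..?n} \<longrightarrow> ?I \<le> ennreal (2 * ?n * g t)"
      using fin
    proof (eventually_elim, intro impI)
      fix t assume "maximal_function f t = ennreal (g t)" "t \<in> {-?n..?n}"
      then show "?I \<le> ennreal (2 * ?n * g t)"
        using maximal_function_average_le[of "-?n" ?n t f] g0[of t] by (simp add: ennreal_mult del: of_nat_Suc)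
    qed
    then obtain t where "- ?n \<le> t" "t \<le> ?n" "t \<in> {-?n..?n} \<longrightarrow> ?I \<le> ennreal (2 * ?n * g t)"
      by (rule AE_lebesgue_ex_in_interval[where a="- ?n" and b="?n"]) auto
    then have "?I \<noteq> \<infinity>" by (auto simp: top_unique)
    then obtain i where i: "?I = ennreal i" "0 \<le> i" by (cases ?I) auto
    have cg: "(\<lambda>t. 2 * ?n * g t) \<in> vector_valued \<Phi>" "vector_norm N (\<lambda>t. 2 * ?n * g t) = 2 * ?n * vector_norm N g"
      using sigma_normed.scale[OF sigma_normed g, of "2 * ?n"] by simp_all
    have "vector_norm N (\<lambda>t. i * ?ind t) \<le> vector_norm N (\<lambda>t. 2 * ?n * g t)"
    proof (rule vector_valued_ideal(2)[OF cg(1)])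
      show "strongly_measurable (\<lambda>t. i * ?ind t)" by (simp add: strongly_measurable_iff_borel)
      show "AE t in lebesgue. norm (i * ?ind t) \<le> norm (2 * ?n * g t)"
        using avg
      proof eventually_elim
        case (elim t)
        show ?case
        proof (cases "t \<in> {-?n..?n}")
          case True
          then have "ennreal i \<le> ennreal (2 * ?n * g t)" using elim i by auto
          then have "i \<le> 2 * ?n * g t" using g0[of t] by (subst (asm) ennreal_le_iff) auto
          then show ?thesis using True i g0[of t] by (simp add: interval_indicator_def abs_mult)
        qed (simp add: interval_indicator_def)
      qed
    qed
    also have "\<dots> \<le> 2 * ?n * max 0 B" unfolding cg(2) using gN by (intro mult_left_mono) auto
    finally have "i * vector_norm N ?ind \<le> 2 * ?n * max 0 B"
      using sigma_normed.scale[OF sigma_normed interval_indicator_in[OF M] i(2)] by simp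
    then have "i \<le> 2 * ?n * max 0 B / vector_norm N ?ind" using pos by (simp add: field_simps)
    moreover have "(\<integral>\<^sup>+t. ennreal (cmod (f t * complex_of_real (?ind t))) \<partial>lebesgue) = ?I"
      by (rule nn_integral_cong) (auto simp: interval_indicator_def indicator_def norm_mult)
    ultimately show "(\<integral>\<^sup>+t. ennreal (cmod (f t * complex_of_real (?ind t))) \<partial>lebesgue)
        \<le> ennreal (2 * ?n * max 0 B / vector_norm N ?ind)"
      using i by (simp add: ennreal_leI del: of_nat_Suc)
  qed
  then have fin: "kothe_ennnorm \<Phi> N (\<lambda>t. complex_of_real (?ind t)) < \<infinity>" by (rule le_less_trans) simp
  have "kothe_ennnorm \<Phi> N (\<lambda>t. complex_of_real (norm (interval_indicator n t))) \<le>
      kothe_ennnorm \<Phi> N (\<lambda>t. complex_of_real (?ind t))"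
    by (intro kothe_ennnorm_mono AE_I2) (auto simp: interval_indicator_def indicator_def)
  with fin show ?thesis
    by (auto simp: vector_valued_kothe_iff strongly_measurable_iff_borel intro: le_less_trans)
qed

text \<open>Termwise integration against the unit ball of \<open>\<Phi>\<close> bounds the Koethe
  norm of a sum by the sum of the norms. Almost everywhere convergence comes from pairing the series
  with indicators of intervals, which lie in \<open>\<Phi>\<close> because the maximal operator is
  bounded there.\<close>

lemma sigma_normed_kothe:
  assumes M: "maximal_bounded_on \<Phi> N"
  shows "sigma_normed (kothe_dual \<Phi> N) (kothe_norm \<Phi> N)"
proof
  show "kothe_dual \<Phi> N \<subseteq> borel_measurable lebesgue" by (auto simp: kothe_dual_def)
  show "0 \<le> vector_norm (kothe_norm \<Phi> N) f" for f :: "real \<Rightarrow> real"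
    by (simp add: vector_norm_def kothe_norm_def)
  show "(\<lambda>t. c * f t) \<in> vector_valued (kothe_dual \<Phi> N) \<and>
      vector_norm (kothe_norm \<Phi> N) (\<lambda>t. c * f t) = c * vector_norm (kothe_norm \<Phi> N) f"
    if f: "f \<in> vector_valued (kothe_dual \<Phi> N)" and c: "0 \<le> c" for f :: "real \<Rightarrow> real" and c
  proof -
    have [measurable]: "f \<in> borel_measurable lebesgue"
      using f by (simp add: vector_valued_def strongly_measurable_iff_borel)
    have "(\<integral>\<^sup>+t. ennreal (cmod (g t * complex_of_real (norm (c * f t)))) \<partial>lebesgue) =
        ennreal c * (\<integral>\<^sup>+t. ennreal (cmod (g t * complex_of_real (norm (f t)))) \<partial>lebesgue)"
      if "g \<in> {g \<in> \<Phi>. N g \<le> 1}" for g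
    proof -
      have [measurable]: "g \<in> borel_measurable lebesgue" using that measurable by blast
      show ?thesis
        using c by (subst nn_integral_cmult[symmetric])
          (auto intro!: nn_integral_cong simp: norm_mult abs_mult ennreal_mult[symmetric] mult_ac)
    qed
    then have eq: "kothe_ennnorm \<Phi> N (\<lambda>t. complex_of_real (norm (c * f t))) =
        ennreal c * kothe_ennnorm \<Phi> N (\<lambda>t. complex_of_real (norm (f t)))"
      unfolding kothe_ennnorm_def SUP_mult_left_ennreal by (rule SUP_cong[OF refl])
    have "strongly_measurable (\<lambda>t. c * f t)" by (simp add: strongly_measurable_iff_borel)
    then show ?thesis using f c
      unfolding vector_valued_kothe_iff vector_norm_def kothe_norm_def eq
      by (simp add: ennreal_mult_less_top enn2real_mult)
  qed
next
  fix G :: "nat \<Rightarrow> real \<Rightarrow> real"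
  assume G: "\<And>k. G k \<in> vector_valued (kothe_dual \<Phi> N)" and G0: "\<And>k t. 0 \<le> G k t"
    and sum: "summable (\<lambda>k. vector_norm (kothe_norm \<Phi> N) (G k))"
  let ?K = "\<Sum>k. vector_norm (kothe_norm \<Phi> N) (G k)"
  have Gm [measurable]: "G k \<in> borel_measurable lebesgue" for k
    using G[of k] by (simp add: vector_valued_def strongly_measurable_iff_borel)
  have Kn: "0 \<le> vector_norm (kothe_norm \<Phi> N) (G k)" for k
    by (simp add: vector_norm_def kothe_norm_def)
  have bound: "(\<integral>\<^sup>+t. (\<Sum>k. ennreal (norm (f t) * G k t)) \<partial>lebesgue) \<le> ennreal (R * ?K)"
    if f: "f \<in> vector_valued \<Phi>" "vector_norm N f \<le> R" and R: "0 < R" for f :: "real \<Rightarrow> real" and R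
  proof -
    have [measurable]: "(\<lambda>t. norm (f t)) \<in> borel_measurable lebesgue"
      using f strongly_measurable_norm[of f] by (simp add: vector_valued_def)
    have "(\<integral>\<^sup>+t. (\<Sum>k. ennreal (norm (f t) * G k t)) \<partial>lebesgue) =
        (\<Sum>k. \<integral>\<^sup>+t. ennreal (norm (f t) * G k t) \<partial>lebesgue)"
      by (rule nn_integral_suminf) measurable
    also have "\<dots> \<le> (\<Sum>k. ennreal (R * vector_norm (kothe_norm \<Phi> N) (G k)))"
    proof (intro suminf_le)
      show "(\<integral>\<^sup>+t. ennreal (norm (f t) * G k t) \<partial>lebesgue) \<le> ennreal (R * vector_norm (kothe_norm \<Phi> N) (G k))" for k
        using kothe_pairing[OF f R Gm[of k]] ennreal_vector_norm_kothe[OF G[of k]] R Kn[of k] G0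
        by (simp add: ennreal_mult)
    qed auto
    also have "\<dots> = ennreal (R * ?K)"
      by (rule suminf_ennreal_eq) (use R Kn sum in \<open>auto intro: sums_mult\<close>)
    finally show ?thesis .
  qed
  have "AE t in lebesgue. summable (\<lambda>k. G k t)"
  proof (rule AE_all_intervals)
    fix n
    let ?R = "vector_norm N (interval_indicator (Suc n))"
    have "(\<integral>\<^sup>+t. (\<Sum>k. ennreal (norm (interval_indicator (Suc n) t) * G k t)) \<partial>lebesgue) \<le> ennreal (?R * ?K)"
      by (intro bound interval_indicator_in[OF M] interval_indicator_norm_pos[OF M]) simp
    then have "(\<integral>\<^sup>+t. (\<Sum>k. ennreal (norm (interval_indicator (Suc n) t) * G k t)) \<partial>lebesgue) \<noteq> \<infinity>"
      by (auto simp: top_unique)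
    then have "AE t in lebesgue. (\<Sum>k. ennreal (norm (interval_indicator (Suc n) t) * G k t)) \<noteq> \<infinity>"
      by (rule nn_integral_noteq_infinite[rotated]) measurable
    then show "AE t in lebesgue. t \<in> {- real n..real n} \<longrightarrow> summable (\<lambda>k. G k t)"
    proof (eventually_elim, intro impI)
      fix t assume t: "(\<Sum>k. ennreal (norm (interval_indicator (Suc n) t) * G k t)) \<noteq> \<infinity>" "t \<in> {- real n..real n}"
      then have "interval_indicator (Suc n) t = 1" by (auto simp: interval_indicator_def indicator_def)
      with t have "(\<Sum>k. ennreal (G k t)) \<noteq> top" by simp
      then show "summable (\<lambda>k. G k t)" using G0 by (intro summable_suminf_not_top) auto
    qed
  qed
  moreover define h where "h t = (if summable (\<lambda>k. G k t) then \<Sum>k. G k t else 0)" for t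
  ultimately have sums: "AE t in lebesgue. (\<lambda>k. G k t) sums h t" by (auto elim!: eventually_mono)
  then have "AE t in lebesgue. (\<lambda>n. \<Sum>k<n. G k t) \<longlonglongrightarrow> h t" by (simp add: sums_def)
  then have hm: "strongly_measurable h"
    by (rule strongly_measurable_LIMSEQ[rotated]) (simp add: strongly_measurable_iff_borel)
  have h0: "0 \<le> h t" for t by (auto simp: h_def G0 intro: suminf_nonneg)
  have le: "kothe_ennnorm \<Phi> N (\<lambda>t. complex_of_real (norm (h t))) \<le> ennreal ?K"
    unfolding kothe_ennnorm_def
  proof (rule SUP_least)
    fix f assume f: "f \<in> {f \<in> \<Phi>. N f \<le> 1}"
    then have fm: "f \<in> borel_measurable lebesgue" using measurable by blast
    have cm: "(\<lambda>t. cmod (f t)) \<in> borel_measurable lebesgue" using fm by measurable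
    have "(\<lambda>t. complex_of_real (cmod (f t))) \<in> \<Phi> \<and> N (\<lambda>t. complex_of_real (cmod (f t))) \<le> N f"
      using f cm by (intro ideal) auto
    then have F: "(\<lambda>t. cmod (f t)) \<in> vector_valued \<Phi>" "vector_norm N (\<lambda>t. cmod (f t)) \<le> 1"
      using f cm by (auto simp: vector_valued_def vector_norm_def strongly_measurable_iff_borel)
    have "(\<integral>\<^sup>+t. ennreal (cmod (f t * complex_of_real (norm (h t)))) \<partial>lebesgue) =
        (\<integral>\<^sup>+t. (\<Sum>k. ennreal (norm (cmod (f t)) * G k t)) \<partial>lebesgue)"
    proof (rule nn_integral_cong_AE)
      show "AE t in lebesgue. ennreal (cmod (f t * complex_of_real (norm (h t)))) =
          (\<Sum>k. ennreal (norm (cmod (f t)) * G k t))"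
        using sums
      proof eventually_elim
        case (elim t)
        have "(\<Sum>k. ennreal (norm (cmod (f t)) * G k t)) = ennreal (cmod (f t) * h t)"
          by (rule suminf_ennreal_eq) (use elim G0 in \<open>auto intro: sums_mult\<close>)
        then show ?case using h0[of t] by (simp add: norm_mult)
      qed
    qed
    also have "\<dots> \<le> ennreal ?K" using bound[OF F] by simp
    finally show "(\<integral>\<^sup>+t. ennreal (cmod (f t * complex_of_real (norm (h t)))) \<partial>lebesgue) \<le> ennreal ?K" .
  qed
  then have hv: "h \<in> vector_valued (kothe_dual \<Phi> N)"
    using hm by (auto simp: vector_valued_kothe_iff intro: le_less_trans)
  moreover have "vector_norm (kothe_norm \<Phi> N) h \<le> ?K"
    using le ennreal_vector_norm_kothe[OF hv] suminf_nonneg[OF sum Kn] by (simp flip: ennreal_le_iff)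
  ultimately show "\<exists>h\<in>vector_valued (kothe_dual \<Phi> N). (\<forall>t. 0 \<le> h t) \<and> (AE t in lebesgue. (\<lambda>k. G k t) sums h t) \<and>
        vector_norm (kothe_norm \<Phi> N) h \<le> ?K"
    using h0 sums by blast
qed

end

subsection \<open>Lorentz--Luxemburg duality\<close>

lemma integrable_square_mult:
  fixes f g :: "real \<Rightarrow> real"
  assumes [measurable]: "f \<in> borel_measurable lebesgue" "g \<in> borel_measurable lebesgue"
    and f: "integrable lebesgue (\<lambda>t. (f t)\<^sup>2)" and g: "integrable lebesgue (\<lambda>t. (g t)\<^sup>2)"
  shows "integrable lebesgue (\<lambda>t. f t * g t)"
proof (rule Bochner_Integration.integrable_bound[OF Bochner_Integration.integrable_add[OF f g]])
  have "\<bar>f t * g t\<bar> \<le> \<bar>(f t)\<^sup>2 + (g t)\<^sup>2\<bar>" for t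
  proof -
    have "2 * (\<bar>f t\<bar> * \<bar>g t\<bar>) \<le> (f t)\<^sup>2 + (g t)\<^sup>2"
      using sum_squares_bound[of "\<bar>f t\<bar>" "\<bar>g t\<bar>"] by (simp add: mult.assoc)
    moreover have "0 \<le> \<bar>f t\<bar> * \<bar>g t\<bar>" by simp
    ultimately show ?thesis unfolding abs_mult by linarith
  qed
  then show "AE t in lebesgue. norm (f t * g t) \<le> norm ((f t)\<^sup>2 + (g t)\<^sup>2)" by simp
qed measurable

text \<open>The one expansion behind the whole projection argument: midpoints, differences of
  minimizing terms and moves along a segment are its instances.\<close>

lemma integrable_square_lin:
  fixes f g :: "real \<Rightarrow> real"
  assumes [measurable]: "f \<in> borel_measurable lebesgue" "g \<in> borel_measurable lebesgue"
    and f: "integrable lebesgue (\<lambda>t. (f t)\<^sup>2)" and g: "integrable lebesgue (\<lambda>t. (g t)\<^sup>2)"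
  shows "integrable lebesgue (\<lambda>t. (a * f t + b * g t)\<^sup>2)"
    and "(\<integral>t. (a * f t + b * g t)\<^sup>2 \<partial>lebesgue) =
      a\<^sup>2 * (\<integral>t. (f t)\<^sup>2 \<partial>lebesgue) + 2 * a * b * (\<integral>t. f t * g t \<partial>lebesgue) + b\<^sup>2 * (\<integral>t. (g t)\<^sup>2 \<partial>lebesgue)"
proof -
  note fg = integrable_square_mult[OF assms]
  have eq: "(a * f t + b * g t)\<^sup>2 = a\<^sup>2 * (f t)\<^sup>2 + 2 * a * b * (f t * g t) + b\<^sup>2 * (g t)\<^sup>2" for t
    by (simp add: power2_sum power_mult_distrib algebra_simps)
  show "integrable lebesgue (\<lambda>t. (a * f t + b * g t)\<^sup>2)"
    unfolding eq using f g fg by simp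
  show "(\<integral>t. (a * f t + b * g t)\<^sup>2 \<partial>lebesgue) =
      a\<^sup>2 * (\<integral>t. (f t)\<^sup>2 \<partial>lebesgue) + 2 * a * b * (\<integral>t. f t * g t \<partial>lebesgue) + b\<^sup>2 * (\<integral>t. (g t)\<^sup>2 \<partial>lebesgue)"
    unfolding eq using f g fg by simp
qed

lemma power_integral_2:
  fixes f :: "real \<Rightarrow> real"
  assumes "integrable lebesgue (\<lambda>t. (f t)\<^sup>2)"
  shows "power_integral 2 (\<lambda>_. 1) f = ennreal (\<integral>t. (f t)\<^sup>2 \<partial>lebesgue)"
proof -
  have "power_integral 2 (\<lambda>_. 1) f = (\<integral>\<^sup>+t. ennreal ((f t)\<^sup>2) \<partial>lebesgue)"
    unfolding power_integral_def by (intro nn_integral_cong) (simp add: powr_numeral)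
  also have "\<dots> = ennreal (\<integral>t. (f t)\<^sup>2 \<partial>lebesgue)" by (rule nn_integral_eq_integral[OF assms]) simp
  finally show ?thesis .
qed

lemma integrable_square_of_power_integral:
  fixes f :: "real \<Rightarrow> real"
  assumes "f \<in> borel_measurable lebesgue" "power_integral 2 (\<lambda>_. 1) f < \<infinity>"
  shows "integrable lebesgue (\<lambda>t. (f t)\<^sup>2)"
proof (rule integrableI_bounded)
  have "(\<integral>\<^sup>+t. ennreal (norm ((f t)\<^sup>2)) \<partial>lebesgue) = power_integral 2 (\<lambda>_. 1) f"
    unfolding power_integral_def by (intro nn_integral_cong) (simp add: powr_numeral)
  then show "(\<integral>\<^sup>+t. ennreal (norm ((f t)\<^sup>2)) \<partial>lebesgue) < \<infinity>" using assms by simp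
qed (use assms in measurable)

context banach_function_space
begin

text \<open>The axiom concerns increasing sequences. The infima of |u k| over k >= n increase to |v|
  and are dominated by |u n|, so it applies to them. The result makes the unit ball closed under
  almost everywhere limits.\<close>

lemma fatou_AE:
  fixes u :: "nat \<Rightarrow> real \<Rightarrow> real"
  assumes u: "\<And>n. u n \<in> vector_valued \<Phi>" "\<And>n. vector_norm N (u n) \<le> B"
    and lim: "AE t in lebesgue. (\<lambda>n. u n t) \<longlonglongrightarrow> v t"
  shows "v \<in> vector_valued \<Phi>" "vector_norm N v \<le> B"
proof -
  have um: "strongly_measurable (u n)" for n using u(1)[of n] by (simp add: vector_valued_def)
  have vm: "strongly_measurable v" by (rule strongly_measurable_LIMSEQ[OF um lim])
  have [measurable]: "u n \<in> borel_measurable lebesgue" "v \<in> borel_measurable lebesgue" for n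
    using um vm by (auto simp: strongly_measurable_iff_borel)
  define G where "G n t = (INF k\<in>{n..}. \<bar>u k t\<bar>)" for n t
  have bdd: "bdd_below ((\<lambda>k. \<bar>u k t\<bar>) ` A)" for A t by (rule bdd_belowI[of _ 0]) auto
  have Gm [measurable]: "G n \<in> borel_measurable lebesgue" for n
    unfolding G_def by (rule borel_measurable_cINF_real) auto
  have G0: "0 \<le> G n t" for n t unfolding G_def by (rule cINF_greatest) auto
  have G_le: "G n t \<le> \<bar>u k t\<bar>" if "n \<le> k" for n k t
    unfolding G_def by (rule cINF_lower[OF bdd]) (use that in simp)
  have G: "G n \<in> vector_valued \<Phi>" "vector_norm N (G n) \<le> B" for n
  proof -
    have sm: "strongly_measurable (G n)" by (simp add: strongly_measurable_iff_borel)
    have le: "AE t in lebesgue. norm (G n t) \<le> norm (u n t)" using G0 G_le by (intro AE_I2) auto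
    show "G n \<in> vector_valued \<Phi>" "vector_norm N (G n) \<le> B"
      using vector_valued_ideal[OF u(1)[of n] sm le] u(2)[of n] by auto
  qed
  have inc: "G n t \<le> G (Suc n) t" for n t
    unfolding G_def by (rule cINF_superset_mono[OF _ bdd]) auto
  have "AE t in lebesgue. (\<lambda>n. G n t) \<longlonglongrightarrow> \<bar>v t\<bar>"
    using lim
  proof eventually_elim
    case (elim t)
    have l: "(\<lambda>n. \<bar>u n t\<bar>) \<longlonglongrightarrow> \<bar>v t\<bar>" by (rule tendsto_rabs[OF elim])
    show ?case
    proof (rule LIMSEQ_I)
      fix r :: real assume r: "0 < r"
      then obtain no where no: "\<And>n. no \<le> n \<Longrightarrow> norm (\<bar>u n t\<bar> - \<bar>v t\<bar>) < r / 2"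
        using LIMSEQ_D[OF l, of "r / 2"] by auto
      have "norm (G n t - \<bar>v t\<bar>) < r" if n: "no \<le> n" for n
      proof -
        have "\<bar>v t\<bar> - r / 2 \<le> G n t"
          unfolding G_def
        proof (rule cINF_greatest)
          fix k assume "k \<in> {n..}"
          then have "norm (\<bar>u k t\<bar> - \<bar>v t\<bar>) < r / 2" using n by (intro no) simp
          then show "\<bar>v t\<bar> - r / 2 \<le> \<bar>u k t\<bar>" unfolding real_norm_def by linarith
        qed simp
        moreover have "G n t \<le> \<bar>v t\<bar> + r / 2" using G_le[of n n t] no[OF n] unfolding real_norm_def by linarith
        ultimately show ?thesis using r by (simp add: abs_less_iff)
      qed
      then show "\<exists>no. \<forall>n\<ge>no. norm (G n t - \<bar>v t\<bar>) < r" by blast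
    qed
  qed
  then have v: "(\<lambda>t. \<bar>v t\<bar>) \<in> vector_valued \<Phi>" "vector_norm N (\<lambda>t. \<bar>v t\<bar>) \<le> B"
    using inc by (intro fatou_bounded[of G, OF G(1) G0 _ _ _ _ G(2)]; simp)+
  show "v \<in> vector_valued \<Phi>" "vector_norm N v \<le> B"
    using vector_valued_ideal[OF v(1) vm] v(2) by auto
qed

text \<open>Separation in \<open>L\<^sup>2\<close>: the difference of \<open>f\<close> and its nearest point in the convex set \<open>S\<close> of
  square integrable functions of norm at most \<open>1\<close> is a functional separating \<open>f\<close> from \<open>S\<close>.\<close>

lemma separating_functional:
  fixes f :: "real \<Rightarrow> real"
  assumes ind: "\<And>n. interval_indicator n \<in> vector_valued \<Phi>"
    and f: "f \<in> vector_valued \<Phi>" "\<And>t. 0 \<le> f t" "integrable lebesgue (\<lambda>t. (f t)\<^sup>2)" "1 < vector_norm N f"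
  obtains g :: "real \<Rightarrow> real" where "g \<in> borel_measurable lebesgue" "\<And>t. 0 \<le> g t"
    "kothe_ennnorm \<Phi> N (\<lambda>t. complex_of_real (g t)) \<le> 1"
    "1 < (\<integral>\<^sup>+t. ennreal (f t * g t) \<partial>lebesgue)"
proof -
  define S where "S = {u :: real \<Rightarrow> real. u \<in> vector_valued \<Phi> \<and> vector_norm N u \<le> 1 \<and> integrable lebesgue (\<lambda>t. (u t)\<^sup>2)}"
  define Q where "Q u = (\<integral>t. (f t - u t)\<^sup>2 \<partial>lebesgue)" for u
  have fm [measurable]: "f \<in> borel_measurable lebesgue"
    using f(1) by (simp add: vector_valued_def strongly_measurable_iff_borel)
  have Sm: "u \<in> borel_measurable lebesgue" if "u \<in> S" for u
    using that by (simp add: S_def vector_valued_def strongly_measurable_iff_borel)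
  have zero: "(\<lambda>t. 0) \<in> S"
    using vector_valued_zero vector_norm_eq_0[OF vector_valued_zero[where 'a=real]] by (simp add: S_def)
  have convex: "(\<lambda>t. (1 - s) * u t + s * v t) \<in> S" if u: "u \<in> S" and v: "v \<in> S" and s: "0 \<le> s" "s \<le> 1" for u v s
  proof -
    have [measurable]: "u \<in> borel_measurable lebesgue" "v \<in> borel_measurable lebesgue" using Sm u v by auto
    have u': "(\<lambda>t. (1 - s) * u t) \<in> vector_valued \<Phi>" "vector_norm N (\<lambda>t. (1 - s) * u t) = (1 - s) * vector_norm N u"
      and v': "(\<lambda>t. s * v t) \<in> vector_valued \<Phi>" "vector_norm N (\<lambda>t. s * v t) = s * vector_norm N v"
      using sigma_normed.scale[OF sigma_normed, of u "1 - s"] sigma_normed.scale[OF sigma_normed, of v s] u v s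
      by (auto simp: S_def)
    have sm: "strongly_measurable (\<lambda>t. (1 - s) * u t + s * v t)" by (simp add: strongly_measurable_iff_borel)
    have le: "AE t in lebesgue. norm ((1 - s) * u t + s * v t) \<le> norm ((1 - s) * u t) + norm (s * v t)"
      by (intro AE_I2 norm_triangle_ineq)
    have "vector_norm N (\<lambda>t. (1 - s) * u t + s * v t) \<le> (1 - s) * vector_norm N u + s * vector_norm N v"
      using vector_valued_add_le(2)[OF u'(1) v'(1) sm le] u'(2) v'(2) by simp
    also have "\<dots> \<le> (1 - s) * 1 + s * 1" using u v s by (intro add_mono mult_left_mono) (auto simp: S_def)
    finally have "vector_norm N (\<lambda>t. (1 - s) * u t + s * v t) \<le> 1" by simp
    moreover have "integrable lebesgue (\<lambda>t. ((1 - s) * u t + s * v t)\<^sup>2)"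
      by (rule integrable_square_lin) (use u v in \<open>auto simp: S_def\<close>)
    ultimately show ?thesis using vector_valued_add_le(1)[OF u'(1) v'(1) sm le] by (simp add: S_def)
  qed
  have fu: "integrable lebesgue (\<lambda>t. (f t - u t)\<^sup>2)" if "u \<in> S" for u
    using integrable_square_lin(1)[OF fm Sm[OF that] f(3), of 1 "- 1"] that by (simp add: S_def)
  have Q0: "0 \<le> Q u" for u unfolding Q_def by (rule integral_nonneg_AE) simp
  define d where "d = (INF u\<in>S. Q u)"
  have d_le: "d \<le> Q u" if "u \<in> S" for u
    unfolding d_def by (rule cINF_lower[OF _ that]) (use Q0 in \<open>auto intro: bdd_belowI[of _ 0]\<close>)
  \<comment> \<open>This is 16^(-n), the rate required by \<open>power_integral_complete\<close> for
    p = 2.\<close>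
  define e where "e n = (4 powr - (2::real)) ^ n" for n :: nat
  have e_eq: "e n = (1 / 16) ^ n" for n by (simp add: e_def powr_minus powr_numeral)
  have e: "0 < e n" for n by (simp add: e_eq)
  have "\<exists>u\<in>S. Q u < d + e n" for n
  proof -
    have "(INF u\<in>S. Q u) < d + e n" using e[of n] by (simp add: d_def)
    then show ?thesis
      using zero Q0 by (subst (asm) cINF_less_iff) (auto intro: bdd_belowI[of _ 0])
  qed
  then obtain u where u: "\<And>n. u n \<in> S" "\<And>n. Q (u n) < d + e n" by metis
  have um [measurable]: "u n \<in> borel_measurable lebesgue" for n by (rule Sm[OF u(1)])
  have cauchy: "power_integral 2 (\<lambda>_. 1) (\<lambda>t. u n t - u m t) \<le> ennreal (4 * (4 powr - 2) ^ n)" if nm: "n \<le> m" for n m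
  proof -
    let ?a = "\<lambda>t. f t - u n t" and ?b = "\<lambda>t. f t - u m t"
    have ab: "integrable lebesgue (\<lambda>t. (?a t)\<^sup>2)" "integrable lebesgue (\<lambda>t. (?b t)\<^sup>2)"
      using fu u(1) by auto
    have m: "?a \<in> borel_measurable lebesgue" "?b \<in> borel_measurable lebesgue" by measurable
    note L = integrable_square_lin[OF m ab]
    \<comment> \<open>The midpoint stays in S, so its squared distance to f is at least d. With the
      expansion of the squares this bounds the squared distance of two terms by their excess over
      d.\<close>
    have mid: "(\<lambda>t. (1 - 1 / 2) * u n t + 1 / 2 * u m t) \<in> S" by (rule convex[OF u(1) u(1)]) auto
    have "Q (\<lambda>t. (1 - 1 / 2) * u n t + 1 / 2 * u m t) = (\<integral>t. (1 / 2 * ?a t + 1 / 2 * ?b t)\<^sup>2 \<partial>lebesgue)"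
      unfolding Q_def by (rule Bochner_Integration.integral_cong) (auto simp: algebra_simps)
    then have d4: "d \<le> 1 / 4 * Q (u n) + 1 / 2 * (\<integral>t. ?a t * ?b t \<partial>lebesgue) + 1 / 4 * Q (u m)"
      using d_le[OF mid] L(2)[of "1 / 2" "1 / 2"] by (simp add: Q_def power_divide)
    have eq: "u n t - u m t = - 1 * ?a t + 1 * ?b t" for t by simp
    have int: "integrable lebesgue (\<lambda>t. (u n t - u m t)\<^sup>2)" unfolding eq by (rule L(1))
    have "(\<integral>t. (u n t - u m t)\<^sup>2 \<partial>lebesgue) = Q (u n) - 2 * (\<integral>t. ?a t * ?b t \<partial>lebesgue) + Q (u m)"
      unfolding eq L(2) by (simp add: Q_def)
    also have "\<dots> \<le> 2 * (Q (u n) - d) + 2 * (Q (u m) - d)" using d4 by simp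
    also have "\<dots> \<le> 2 * e n + 2 * e m" using u(2)[of n] u(2)[of m] by simp
    also have "\<dots> \<le> 4 * e n" using nm by (simp add: e_eq power_decreasing)
    finally show ?thesis unfolding power_integral_2[OF int] by (simp add: e_def ennreal_leI)
  qed
  obtain u0 where u0: "strongly_measurable u0" "AE t in lebesgue. (\<lambda>n. u n t) \<longlonglongrightarrow> u0 t"
    "\<And>n. power_integral 2 (\<lambda>_. 1) (\<lambda>t. u n t - u0 t) \<le> ennreal (4 * (4 powr - 2) ^ n)"
  proof (rule power_integral_complete[of 2 "\<lambda>_. 1" u 4])
    show "strongly_measurable (u n)" for n by (simp add: strongly_measurable_iff_borel)
  qed (use cauchy in auto)
  have u0m [measurable]: "u0 \<in> borel_measurable lebesgue" using u0(1) by (rule strongly_measurable_borel)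
  have u0S: "u0 \<in> S"
  proof -
    have N: "u0 \<in> vector_valued \<Phi>" "vector_norm N u0 \<le> 1"
      using fatou_AE[of u 1 u0, OF _ _ u0(2)] u(1) by (auto simp: S_def)
    have "integrable lebesgue (\<lambda>t. (u 0 t - u0 t)\<^sup>2)"
      by (rule integrable_square_of_power_integral) (use u0(3)[of 0] in \<open>auto intro: le_less_trans\<close>)
    moreover have "integrable lebesgue (\<lambda>t. (u 0 t)\<^sup>2)" using u(1)[of 0] by (simp add: S_def)
    ultimately have "integrable lebesgue (\<lambda>t. (1 * u 0 t + (- 1) * (u 0 t - u0 t))\<^sup>2)"
      by (intro integrable_square_lin) measurable
    with N show ?thesis by (simp add: S_def)
  qed
  have Qu0: "Q u0 \<le> d"
  proof (rule field_le_epsilon)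
    fix r :: real assume r: "0 < r"
    have d0: "0 \<le> d" unfolding d_def by (rule cINF_greatest) (use zero Q0 in auto)
    have "power_integral 2 (\<lambda>_. 1) (\<lambda>t. f t - u0 t) \<le> ennreal (d + r)"
    proof (rule power_integral_fatou[of "\<lambda>n t. f t - u n t"])
      show "AE t in lebesgue. (\<lambda>n. f t - u n t) \<longlonglongrightarrow> f t - u0 t"
        using u0(2) by eventually_elim (intro tendsto_intros)
      have "e \<longlonglongrightarrow> 0" unfolding e_eq by (rule LIMSEQ_realpow_zero) auto
      then have "eventually (\<lambda>n. e n < r) sequentially" using r by (rule order_tendstoD)
      then show "eventually (\<lambda>n. power_integral 2 (\<lambda>_. 1) (\<lambda>t. f t - u n t) \<le> ennreal (d + r)) sequentially"
      proof eventually_elim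
        case (elim n)
        then show ?case
          using u(2)[of n] unfolding power_integral_2[OF fu[OF u(1)]] Q_def by (intro ennreal_leI) simp
      qed
    qed (auto simp: strongly_measurable_iff_borel)
    then show "Q u0 \<le> d + r"
      using r d0 unfolding power_integral_2[OF fu[OF u0S]] Q_def by (subst (asm) ennreal_le_iff) auto
  qed
  define h where "h t = f t - u0 t" for t
  have hm [measurable]: "h \<in> borel_measurable lebesgue" unfolding h_def by measurable
  have h2: "integrable lebesgue (\<lambda>t. (h t)\<^sup>2)" unfolding h_def by (rule fu[OF u0S])
  have hS: "integrable lebesgue (\<lambda>t. h t * v t)" if "v \<in> S" for v
    by (rule integrable_square_mult[OF hm Sm[OF that] h2]) (use that in \<open>simp add: S_def\<close>)
  have var: "(\<integral>t. h t * v t \<partial>lebesgue) \<le> (\<integral>t. h t * u0 t \<partial>lebesgue)" if v: "v \<in> S" for v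
  proof (rule ccontr)
    let ?k = "\<lambda>t. v t - u0 t"
    have [measurable]: "v \<in> borel_measurable lebesgue" by (rule Sm[OF v])
    define x where "x = (\<integral>t. h t * ?k t \<partial>lebesgue)"
    define y where "y = (\<integral>t. (?k t)\<^sup>2 \<partial>lebesgue)"
    have y0: "0 \<le> y" unfolding y_def by (rule integral_nonneg_AE) simp
    have "x = (\<integral>t. h t * v t \<partial>lebesgue) - (\<integral>t. h t * u0 t \<partial>lebesgue)"
      unfolding x_def right_diff_distrib by (rule Bochner_Integration.integral_diff[OF hS[OF v] hS[OF u0S]])
    moreover assume "\<not> ?thesis"
    ultimately have x: "0 < x" by simp
    have k2: "integrable lebesgue (\<lambda>t. (?k t)\<^sup>2)"
      using integrable_square_lin(1)[OF Sm[OF v] u0m, of 1 "- 1"] v u0S by (simp add: S_def)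
    \<comment> \<open>Moving from \<open>u0\<close> towards v by s changes the squared distance by
      -2 s x + s^2 y, which is negative for s of this size; y + 1 covers the case y = 0.\<close>
    define s where "s = min 1 (x / (y + 1))"
    have s: "0 < s" "s \<le> 1" using x y0 by (auto simp: s_def)
    have s3: "s * (y + 1) \<le> x" using y0 by (subst pos_le_divide_eq[symmetric]) (auto simp: s_def)
    have S': "(\<lambda>t. (1 - s) * u0 t + s * v t) \<in> S" using s by (intro convex u0S v) auto
    have "Q (\<lambda>t. (1 - s) * u0 t + s * v t) = (\<integral>t. (1 * h t + (- s) * ?k t)\<^sup>2 \<partial>lebesgue)"
      unfolding Q_def by (rule Bochner_Integration.integral_cong) (auto simp: h_def algebra_simps)
    also have "\<dots> = Q u0 - 2 * s * x + s\<^sup>2 * y"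
      by (subst integrable_square_lin(2)[OF hm _ h2 k2]) (auto simp: Q_def h_def x_def y_def)
    finally have "d \<le> d - 2 * s * x + s\<^sup>2 * y" using d_le[OF S'] Qu0 by linarith
    then have "2 * x * s \<le> s * y * s" by (simp add: power2_eq_square algebra_simps)
    then have "2 * x \<le> s * y" using s by (simp only: mult_le_cancel_right_pos)
    also have "\<dots> \<le> s * (y + 1)" using s by simp
    also have "\<dots> \<le> x" by (rule s3)
    finally show False using x by simp
  qed
  define \<alpha> where "\<alpha> = (\<integral>t. h t * u0 t \<partial>lebesgue)"
  have \<alpha>0: "0 \<le> \<alpha>" using var[OF zero] by (simp add: \<alpha>_def)
  have abs_int: "integrable lebesgue (\<lambda>t. \<bar>h t\<bar> * \<bar>v t\<bar>)" if "v \<in> S" for v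
    using integrable_abs[OF hS[OF that]] by (simp add: abs_mult)
  have abs_le: "(\<integral>t. \<bar>h t\<bar> * \<bar>v t\<bar> \<partial>lebesgue) \<le> \<alpha>" if v: "v \<in> S" for v
  proof -
    have [measurable]: "v \<in> borel_measurable lebesgue" by (rule Sm[OF v])
    \<comment> \<open>S is solid, so v may be given the sign of h. The bound \<alpha> on the
      integral of h v thus becomes a bound for |h| |v|, and |h| can serve as a nonnegative
      functional.\<close>
    define v' where "v' t = (if 0 \<le> h t then \<bar>v t\<bar> else - \<bar>v t\<bar>)" for t
    have v'm: "v' \<in> borel_measurable lebesgue" unfolding v'_def by measurable
    then have v'sm: "strongly_measurable v'" by (simp add: strongly_measurable_iff_borel)
    have vv: "v \<in> vector_valued \<Phi>" using v by (simp add: S_def)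
    have le: "AE t in lebesgue. norm (v' t) \<le> norm (v t)" by (simp add: v'_def)
    have "v' \<in> vector_valued \<Phi> \<and> vector_norm N v' \<le> vector_norm N v"
      using vector_valued_ideal[OF vv v'sm le] by simp
    moreover have "(\<lambda>t. (v' t)\<^sup>2) = (\<lambda>t. (v t)\<^sup>2)" by (auto simp: v'_def)
    ultimately have v': "v' \<in> S" using v by (simp add: S_def)
    have "(\<integral>t. \<bar>h t\<bar> * \<bar>v t\<bar> \<partial>lebesgue) = (\<integral>t. h t * v' t \<partial>lebesgue)"
      by (rule Bochner_Integration.integral_cong) (auto simp: v'_def)
    also have "\<dots> \<le> \<alpha>" unfolding \<alpha>_def by (rule var[OF v'])
    finally show ?thesis .
  qed
  have fS: "integrable lebesgue (\<lambda>t. h t * f t)" by (rule integrable_square_mult[OF hm fm h2 f(3)])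
  \<comment> \<open>If h vanished almost everywhere, f would coincide with \<open>u0\<close> and
    have norm at most 1.\<close>
  have hpos: "0 < (\<integral>t. (h t)\<^sup>2 \<partial>lebesgue)"
  proof (rule ccontr)
    assume "\<not> ?thesis"
    moreover have "0 \<le> (\<integral>t. (h t)\<^sup>2 \<partial>lebesgue)" by (rule integral_nonneg_AE) simp
    ultimately have "(\<integral>t. (h t)\<^sup>2 \<partial>lebesgue) = 0" by simp
    then have "AE t in lebesgue. (h t)\<^sup>2 = 0"
      using integral_nonneg_eq_0_iff_AE[OF h2] by simp
    then have "AE t in lebesgue. norm (f t) \<le> norm (u0 t)" by eventually_elim (simp add: h_def)
    then have "vector_norm N f \<le> vector_norm N u0"
      using u0S f(1) by (intro vector_valued_ideal(2)) (auto simp: S_def vector_valued_def)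
    with f(4) u0S show False by (simp add: S_def)
  qed
  define \<beta> where "\<beta> = (\<integral>t. \<bar>h t\<bar> * f t \<partial>lebesgue)"
  have \<beta>i: "integrable lebesgue (\<lambda>t. \<bar>h t\<bar> * f t)"
    using integrable_abs[OF fS] f(2) by (simp add: abs_mult)
  have "(\<integral>t. (h t)\<^sup>2 \<partial>lebesgue) + \<alpha> = (\<integral>t. (h t)\<^sup>2 + h t * u0 t \<partial>lebesgue)"
    unfolding \<alpha>_def by (rule Bochner_Integration.integral_add[OF h2 hS[OF u0S], symmetric])
  also have "\<dots> = (\<integral>t. h t * f t \<partial>lebesgue)"
    by (rule Bochner_Integration.integral_cong) (auto simp: h_def power2_eq_square algebra_simps)
  also have "\<dots> \<le> \<beta>"
    unfolding \<beta>_def by (rule integral_mono[OF fS \<beta>i]) (simp add: f(2) mult_right_mono)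
  finally have \<alpha>\<beta>: "\<alpha> < \<beta>" using hpos by simp
  \<comment> \<open>The integrals of h f and h \<open>u0\<close> differ by that of h^2, whence
    \<alpha> < \<beta>. Division by the midpoint brings the functional to at most 1 on S and above 1
    at f, also when \<alpha> = 0.\<close>
  define \<gamma> where "\<gamma> = (\<alpha> + \<beta>) / 2"
  have \<gamma>: "\<alpha> < \<gamma>" "\<gamma> < \<beta>" "0 < \<gamma>" using \<alpha>\<beta> \<alpha>0 by (auto simp: \<gamma>_def)
  define g where "g t = \<bar>h t\<bar> / \<gamma>" for t
  have gm [measurable]: "g \<in> borel_measurable lebesgue" unfolding g_def by measurable
  have g0: "0 \<le> g t" for t using \<gamma> by (simp add: g_def)
  show thesis
  proof (rule that[OF gm g0])
    have "(\<integral>\<^sup>+t. ennreal (f t * g t) \<partial>lebesgue) = (\<integral>\<^sup>+t. ennreal (\<bar>h t\<bar> * f t / \<gamma>) \<partial>lebesgue)"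
      by (rule nn_integral_cong) (simp add: g_def mult.commute)
    also have "\<dots> = ennreal (\<integral>t. \<bar>h t\<bar> * f t / \<gamma> \<partial>lebesgue)"
      by (rule nn_integral_eq_integral) (use \<beta>i f(2) \<gamma> in \<open>auto intro!: divide_nonneg_pos\<close>)
    also have "\<dots> = ennreal (\<beta> / \<gamma>)" by (simp add: \<beta>_def)
    finally show "1 < (\<integral>\<^sup>+t. ennreal (f t * g t) \<partial>lebesgue)"
      using \<gamma> by (simp add: ennreal_less_iff flip: ennreal_1)
    show "kothe_ennnorm \<Phi> N (\<lambda>t. complex_of_real (g t)) \<le> 1"
      unfolding kothe_ennnorm_def
    proof (rule SUP_least)
      fix \<phi> assume \<phi>': "\<phi> \<in> {f \<in> \<Phi>. N f \<le> 1}"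
      then have [measurable]: "\<phi> \<in> borel_measurable lebesgue" using measurable by blast
      have cm: "(\<lambda>t. cmod (\<phi> t)) \<in> borel_measurable lebesgue" by measurable
      have "(\<lambda>t. complex_of_real (cmod (\<phi> t))) \<in> \<Phi> \<and> N (\<lambda>t. complex_of_real (cmod (\<phi> t))) \<le> N \<phi>"
        using \<phi>' cm by (intro ideal) auto
      then have F: "(\<lambda>t. cmod (\<phi> t)) \<in> vector_valued \<Phi>" "vector_norm N (\<lambda>t. cmod (\<phi> t)) \<le> 1"
        using \<phi>' cm by (auto simp: vector_valued_def vector_norm_def strongly_measurable_iff_borel)
      \<comment> \<open>A member of the unit ball need not be square integrable; its truncations
        belong to S, and Fatou's lemma for the integral against g removes the truncation.\<close>
      define v where "v n t = min (cmod (\<phi> t)) (real n) * interval_indicator n t" for n t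
      have vm: "v n \<in> borel_measurable lebesgue" for n unfolding v_def by measurable
      have v0: "0 \<le> v n t" for n t by (simp add: v_def interval_indicator_bounds)
      have "v n t \<le> cmod (\<phi> t)" for n t
        unfolding v_def by (rule order_trans[OF mult_left_le]) (auto simp: interval_indicator_bounds)
      then have vN: "v n \<in> vector_valued \<Phi>" "vector_norm N (v n) \<le> 1" for n
        using vector_valued_ideal[OF F(1), of "v n"] F(2) vm[of n] v0
        by (auto simp: strongly_measurable_iff_borel)
      have "integrable lebesgue (\<lambda>t. (v n t)\<^sup>2)" for n
      proof (rule integrable_square_of_power_integral[OF vm])
        show "power_integral 2 (\<lambda>_. 1) (v n) < \<infinity>"
          by (rule power_integral_bounded_support[of _ _ "real n" _ "real n"])
            (use Ap_locally_integrable[OF Ap_one[of 2]] v0 in \<open>auto simp: v_def interval_indicator_def indicator_def\<close>)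
      qed
      with vN have vS: "v n \<in> S" for n by (simp add: S_def)
      have "power_integral 1 g (\<lambda>t. cmod (\<phi> t)) \<le> 1"
      proof (rule power_integral_fatou[of v])
        show "AE t in lebesgue. (\<lambda>n. v n t) \<longlonglongrightarrow> cmod (\<phi> t)"
        proof (rule AE_I2, rule tendsto_eventually)
          fix t
          obtain n0 where "max (cmod (\<phi> t)) \<bar>t\<bar> \<le> real n0" using real_arch_simple by blast
          then have "v n t = cmod (\<phi> t)" if "n0 \<le> n" for n
            using that by (auto simp: v_def interval_indicator_def indicator_def min_def abs_le_iff)
          then show "eventually (\<lambda>n. v n t = cmod (\<phi> t)) sequentially" by (auto simp: eventually_sequentially)
        qed
        have "power_integral 1 g (v n) \<le> 1" for n
        proof -
          have "power_integral 1 g (v n) = (\<integral>\<^sup>+t. ennreal (\<bar>h t\<bar> * \<bar>v n t\<bar> / \<gamma>) \<partial>lebesgue)"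
            unfolding power_integral_def using g0
            by (intro nn_integral_cong) (simp add: g_def ennreal_mult[symmetric] mult.commute)
          also have "\<dots> = ennreal (\<integral>t. \<bar>h t\<bar> * \<bar>v n t\<bar> / \<gamma> \<partial>lebesgue)"
            by (rule nn_integral_eq_integral) (use abs_int[OF vS] \<gamma> in auto)
          also have "\<dots> \<le> ennreal (\<alpha> / \<gamma>)" using abs_le[OF vS[of n]] \<gamma> by (intro ennreal_leI) (simp add: divide_right_mono)
          also have "\<dots> \<le> 1" using \<gamma> by (simp flip: ennreal_1 add: ennreal_leI)
          finally show ?thesis .
        qed
        then show "eventually (\<lambda>n. power_integral 1 g (v n) \<le> 1) sequentially" by simp
      qed (auto simp: strongly_measurable_iff_borel vm)
      moreover have "(\<integral>\<^sup>+t. ennreal (cmod (\<phi> t * complex_of_real (g t))) \<partial>lebesgue) = power_integral 1 g (\<lambda>t. cmod (\<phi> t))"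
        unfolding power_integral_def using g0 by (intro nn_integral_cong) (simp add: norm_mult ennreal_mult)
      ultimately show "(\<integral>\<^sup>+t. ennreal (cmod (\<phi> t * complex_of_real (g t))) \<partial>lebesgue) \<le> 1" by simp
    qed
  qed
qed

text \<open>The part of the Lorentz-Luxemburg theorem in which membership in \<open>\<Phi>\<close>
  is a conclusion. Truncations of |g| in size and support lie in \<open>\<Phi>\<close> and in L^2;
  one of norm above C would give, after division by C, a separating function violating
  \<open>dual\<close>. The Fatou property passes from the truncations to |g|.\<close>

lemma vector_valued_by_duality:
  fixes g :: "real \<Rightarrow> 'x::real_normed_vector"
  assumes ind: "\<And>n. interval_indicator n \<in> vector_valued \<Phi>"
    and g: "strongly_measurable g" and C: "0 < C"
    and dual: "\<And>h :: real \<Rightarrow> real. h \<in> borel_measurable lebesgue \<Longrightarrow> (\<And>t. 0 \<le> h t) \<Longrightarrow>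
      kothe_ennnorm \<Phi> N (\<lambda>t. complex_of_real (h t)) \<le> 1 \<Longrightarrow>
      (\<integral>\<^sup>+t. ennreal (norm (g t) * h t) \<partial>lebesgue) \<le> ennreal C"
  shows "g \<in> vector_valued \<Phi>" "vector_norm N g \<le> C"
proof -
  have [measurable]: "(\<lambda>t. norm (g t)) \<in> borel_measurable lebesgue" by (rule strongly_measurable_norm[OF g])
  define v where "v n t = min (norm (g t)) (real n) * interval_indicator n t" for n t
  have vm [measurable]: "v n \<in> borel_measurable lebesgue" for n unfolding v_def by measurable
  have v0: "0 \<le> v n t" for n t by (simp add: v_def interval_indicator_bounds)
  have vg: "v n t \<le> norm (g t)" for n t
    unfolding v_def by (rule order_trans[OF mult_left_le]) (auto simp: interval_indicator_bounds)
  have vn: "v n t \<le> real n * interval_indicator n t" for n t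
    unfolding v_def by (rule mult_right_mono) (auto simp: interval_indicator_bounds)
  have vN: "v n \<in> vector_valued \<Phi>" for n
  proof (rule vector_valued_ideal(1))
    show "(\<lambda>t. real n * interval_indicator n t) \<in> vector_valued \<Phi>"
      using sigma_normed.scale[OF sigma_normed ind[of n], of "real n"] by simp
    show "AE t in lebesgue. norm (v n t) \<le> norm (real n * interval_indicator n t)"
      using v0 vn by (intro AE_I2) (simp add: interval_indicator_bounds)
  qed (simp add: strongly_measurable_iff_borel)
  have vC: "vector_norm N (v n) \<le> C" for n
  proof (rule ccontr)
    assume gt: "\<not> ?thesis"
    let ?f = "\<lambda>t. 1 / C * v n t"
    have f: "?f \<in> vector_valued \<Phi> \<and> vector_norm N ?f = 1 / C * vector_norm N (v n)"
      using C by (intro sigma_normed.scale[OF sigma_normed vN]) simp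
    have "integrable lebesgue (\<lambda>t. (v n t)\<^sup>2)"
    proof (rule integrable_square_of_power_integral[OF vm])
      show "power_integral 2 (\<lambda>_. 1) (v n) < \<infinity>"
        by (rule power_integral_bounded_support[of _ _ "real n" _ "real n"])
          (use Ap_locally_integrable[OF Ap_one[of 2]] v0 vn in \<open>auto simp: interval_indicator_def\<close>)
    qed
    then have int: "integrable lebesgue (\<lambda>t. (?f t)\<^sup>2)" by (simp add: power_divide)
    have f0: "0 \<le> ?f t" for t using v0 C by simp
    have "1 < vector_norm N ?f" unfolding f[THEN conjunct2] using gt C by (simp add: field_simps)
    then obtain h where h: "h \<in> borel_measurable lebesgue" "\<And>t. 0 \<le> h t"
      "kothe_ennnorm \<Phi> N (\<lambda>t. complex_of_real (h t)) \<le> 1" "1 < (\<integral>\<^sup>+t. ennreal (?f t * h t) \<partial>lebesgue)"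
      using separating_functional[OF ind _ f0 int] f by blast
    note h(1)[measurable]
    have "(\<integral>\<^sup>+t. ennreal (?f t * h t) \<partial>lebesgue) \<le> (\<integral>\<^sup>+t. ennreal (1 / C) * ennreal (norm (g t) * h t) \<partial>lebesgue)"
    proof (rule nn_integral_mono)
      fix t
      have "?f t * h t \<le> 1 / C * (norm (g t) * h t)"
        using vg[of n t] h(2)[of t] C by (simp add: divide_right_mono mult_right_mono)
      then show "ennreal (?f t * h t) \<le> ennreal (1 / C) * ennreal (norm (g t) * h t)"
        using C h(2)[of t] by (simp flip: ennreal_mult add: ennreal_leI)
    qed
    also have "\<dots> = ennreal (1 / C) * (\<integral>\<^sup>+t. ennreal (norm (g t) * h t) \<partial>lebesgue)"
      by (rule nn_integral_cmult) measurable
    also have "\<dots> \<le> ennreal (1 / C) * ennreal C" by (intro mult_left_mono dual h) auto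
    also have "\<dots> = 1" using C by (simp flip: ennreal_mult)
    finally show False using h(4) by simp
  qed
  have lim: "AE t in lebesgue. (\<lambda>n. v n t) \<longlonglongrightarrow> norm (g t)"
  proof (rule AE_I2, rule tendsto_eventually)
    fix t
    obtain n0 where "max (norm (g t)) \<bar>t\<bar> \<le> real n0" using real_arch_simple by blast
    then have "v n t = norm (g t)" if "n0 \<le> n" for n
      using that by (auto simp: v_def interval_indicator_def indicator_def min_def abs_le_iff)
    then show "eventually (\<lambda>n. v n t = norm (g t)) sequentially" by (auto simp: eventually_sequentially)
  qed
  have n: "(\<lambda>t. norm (g t)) \<in> vector_valued \<Phi>" "vector_norm N (\<lambda>t. norm (g t)) \<le> C"
    by (rule fatou_AE[OF vN vC lim])+
  show "g \<in> vector_valued \<Phi>" "vector_norm N g \<le> C"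
    using vector_valued_ideal[OF n(1) g] n(2) by auto
qed

end

subsection \<open>Extension of operators to weighted spaces\<close>

lemma power_integral_diff_commute:
  "power_integral p w (\<lambda>t. f t - g t) = power_integral p w (\<lambda>t. g t - f t)"
  by (intro power_integral_cong_norm AE_I2) (rule norm_minus_commute)

lemma power_integral_eq_0_imp:
  assumes f: "strongly_measurable f" and w: "w \<in> borel_measurable lebesgue" "AE t in lebesgue. 0 < w t"
    and zero: "power_integral p w f = 0"
  shows "AE t in lebesgue. f t = 0"
proof -
  note strongly_measurable_norm[OF f, measurable] w(1)[measurable]
  have "AE t in lebesgue. ennreal (norm (f t) powr p) * ennreal (w t) = 0"
    using zero unfolding power_integral_def by (subst (asm) nn_integral_0_iff_AE) measurable
  with w(2) show ?thesis by eventually_elim (auto simp: ennreal_eq_0_iff)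
qed

lemma Lpw_scaleC:
  fixes f :: "real \<Rightarrow> 'x::complex_banach"
  assumes f: "f \<in> Lpw p w" and w: "w \<in> borel_measurable lebesgue"
  shows "(\<lambda>t. scaleC c (f t)) \<in> Lpw p w"
    and "power_integral p w (\<lambda>t. scaleC c (f t)) = ennreal (cmod c powr p) * power_integral p w f"
proof -
  show eq: "power_integral p w (\<lambda>t. scaleC c (f t)) = ennreal (cmod c powr p) * power_integral p w f"
    by (rule power_integral_scale) (use f w in \<open>auto simp: Lpw_iff norm_scaleC\<close>)
  show "(\<lambda>t. scaleC c (f t)) \<in> Lpw p w"
    using f unfolding Lpw_iff eq by (auto intro: strongly_measurable_scaleC simp: ennreal_mult_less_top)
qed

lemma Lpw_add:
  fixes f g :: "real \<Rightarrow> 'x::real_normed_vector"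
  assumes f: "f \<in> Lpw p w" and g: "g \<in> Lpw p w" and w: "w \<in> borel_measurable lebesgue" and p: "0 \<le> p"
  shows "(\<lambda>t. f t + g t) \<in> Lpw p w"
proof -
  have "power_integral p w (\<lambda>t. f t + g t) \<le> ennreal (2 powr p) * (power_integral p w f + power_integral p w g)"
    by (rule power_integral_add_le) (use f g w p in \<open>auto simp: Lpw_iff norm_triangle_ineq\<close>)
  also have "\<dots> < \<infinity>" using f g by (simp add: Lpw_iff ennreal_mult_less_top)
  finally show ?thesis using f g by (auto simp: Lpw_iff intro: strongly_measurable_add)
qed

lemma Lpw_mono_weight:
  assumes f: "f \<in> Lpw p w" and "0 \<le> p" "AE t in lebesgue. w' t \<le> w t"
  shows "f \<in> Lpw p w'"
  using f power_integral_mono[OF assms(2) _ assms(3), of f f] by (auto simp: Lpw_iff intro: le_less_trans)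

lemma Lpw_norm_cong_AE:
  assumes "AE t in lebesgue. f t = g t"
  shows "Lpw_norm p w f = Lpw_norm p w g"
proof -
  have "power_integral p w f = power_integral p w g"
    by (rule power_integral_cong_norm) (use assms in eventually_elim, simp)
  then show ?thesis by (simp add: Lpw_norm_def power_integral_def)
qed

lemma uminus_conv_scaleC: "- x = scaleC (- 1) (x :: 'x::complex_banach)"
  using scaleC_of_real[of "- 1" x] by simp

text \<open>Finiteness is required for each weight separately, which is enough for existence and
  uniqueness of the extension. Uniformity in the weight enters later, through a constant K bounding
  the operator norm.\<close>

locale weighted_operator =
  fixes p :: real and T :: "(real \<Rightarrow> 'x::complex_banach) \<Rightarrow> (real \<Rightarrow> complex) \<Rightarrow> 'y::complex_banach"
  assumes p: "1 < p" and T: "schwartz_operator T"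
    and finite_norm: "w \<in> Ap p \<Longrightarrow> Lpw_operator_norm p w T < \<infinity>"
begin

lemma T_represented:
  assumes w: "w \<in> Ap p" and f: "f \<in> schwartz"
  shows "\<exists>g\<in>Lpw p w. represents g (T f)"
proof (rule ccontr)
  assume "\<not> ?thesis"
  with f have "Lpw_operator_norm p w T = \<infinity>" unfolding Lpw_operator_norm_def by auto
  with finite_norm[OF w] show False by simp
qed

lemma T_represented_add:
  assumes "f \<in> schwartz" "f' \<in> schwartz" "represents g (T f)" "represents g' (T f')"
  shows "represents (\<lambda>t. g t + g' t) (T (\<lambda>t. f t + f' t))"
  by (rule represents_add[OF assms(3,4)]) (use T assms in \<open>auto simp: schwartz_operator_def\<close>)

lemma T_represented_scaleC:
  assumes "f \<in> schwartz" "represents g (T f)"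
  shows "represents (\<lambda>t. scaleC c (g t)) (T (\<lambda>t. scaleC c (f t)))"
  by (rule represents_scaleC[OF assms(2)]) (use T assms in \<open>auto simp: schwartz_operator_def\<close>)

text \<open>Homogeneity carries the supremum over the unit ball to arbitrary f. The formulation with
  p-th powers fits the quasi-triangle inequality.\<close>

lemma T_bound:
  assumes w: "w \<in> Ap p" and K: "Lpw_operator_norm p w T \<le> ennreal K" "0 \<le> K"
    and f: "f \<in> schwartz" "f \<in> Lpw p w" and g: "g \<in> Lpw p w" "represents g (T f)"
  shows "power_integral p w g \<le> ennreal (K powr p) * power_integral p w f"
proof -
  note wm = Ap_borel[OF w]
  have p0: "0 < p" using p by simp
  obtain a where a: "power_integral p w f = ennreal a" "0 \<le> a"
    using f(2) by (cases "power_integral p w f") (auto simp: Lpw_iff)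
  obtain b where b: "power_integral p w g = ennreal b" "0 \<le> b"
    using g(1) by (cases "power_integral p w g") (auto simp: Lpw_iff)
  \<comment> \<open>Allowing every s with s a <= 1, and not only 1 / a, also covers a = 0, where s
    can be arbitrarily large.\<close>
  have scaled: "s * b \<le> K powr p" if s: "0 < s" "s * a \<le> 1" for s
  proof -
    define c where "c = s powr (1 / p)"
    have c: "0 < c" "c powr p = s" using s p0 by (auto simp: c_def powr_powr)
    let ?f = "\<lambda>t. scaleC (complex_of_real c) (f t)" and ?g = "\<lambda>t. scaleC (complex_of_real c) (g t)"
    have fS: "?f \<in> schwartz" by (rule schwartz_scaleC[OF f(1)])
    have I: "power_integral p w ?f = ennreal (s * a)" "power_integral p w ?g = ennreal (s * b)"
      using Lpw_scaleC(2)[OF f(2) wm] Lpw_scaleC(2)[OF g(1) wm] a b c s by (auto simp: ennreal_mult)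
    have gL: "?g \<in> Lpw p w" by (rule Lpw_scaleC(1)[OF g(1) wm])
    have grep: "represents ?g (T ?f)" by (rule T_represented_scaleC[OF f(1) g(2)])
    have "Lpw_norm p w ?f \<le> ennreal 1"
      using s p0 by (subst Lpw_norm_le_iff) (auto simp: I ennreal_leI simp flip: ennreal_1)
    then have f1: "?f \<in> {f \<in> schwartz. Lpw_norm p w f \<le> 1}" using fS by simp
    \<comment> \<open>Representing functions in \<open>Lpw p w\<close> are locally integrable and
      hence unique almost everywhere, so the infimum over them is the norm of any one.\<close>
    have "Lpw_norm p w ?g \<le> Lpw_norm_distr p w (T ?f)"
      unfolding Lpw_norm_distr_def
    proof (rule INF_greatest)
      fix g' assume g': "g' \<in> {g \<in> Lpw p w. represents g (T ?f)}"
      have "AE t in lebesgue. ?g t = g' t"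
        by (rule represents_unique[OF Lpw_subset_L1_loc[OF p w gL] Lpw_subset_L1_loc[OF p w] grep])
          (use g' in auto)
      then show "Lpw_norm p w ?g \<le> Lpw_norm p w g'" using Lpw_norm_cong_AE by (metis order_refl)
    qed
    also have "\<dots> \<le> (SUP f\<in>{f \<in> schwartz. Lpw_norm p w f \<le> 1}. Lpw_norm_distr p w (T f))"
      by (rule SUP_upper[OF f1])
    also have "\<dots> = Lpw_operator_norm p w T"
      using T_represented[OF w] by (simp add: Lpw_operator_norm_def)
    finally have "Lpw_norm p w ?g \<le> ennreal K" using K(1) by simp
    then have "ennreal (s * b) \<le> ennreal (K powr p)" using p0 K(2) by (simp add: Lpw_norm_le_iff I)
    then show ?thesis by (simp add: ennreal_le_iff)
  qed
  have "b \<le> K powr p * a"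
  proof (cases "a = 0")
    case False
    then show ?thesis using scaled[of "1 / a"] a by (simp add: field_simps)
  next
    case True
    have "b = 0"
    proof (rule ccontr)
      assume "b \<noteq> 0"
      \<comment> \<open>With a = 0 this s is admissible and makes s b equal to
        \<open>K powr p + 1\<close>, above the allowed bound.\<close>
      then have "(K powr p + 1) / b * b \<le> K powr p"
        using b True by (intro scaled) (auto intro!: divide_pos_pos add_nonneg_pos)
      with \<open>b \<noteq> 0\<close> show False by simp
    qed
    then show ?thesis by (simp add: True)
  qed
  then show ?thesis using a b by (simp flip: ennreal_mult add: ennreal_leI)
qed

text \<open>The approximating Schwartz functions are explicitly required to lie in
  \<open>Lpw p w\<close>: for a general A_p weight this is established here for bumps only.\<close>

definition approximates ::
    "(real \<Rightarrow> real) \<Rightarrow> (real \<Rightarrow> 'x) \<Rightarrow> (real \<Rightarrow> 'y) \<Rightarrow> (nat \<Rightarrow> real \<Rightarrow> 'x) \<Rightarrow> (nat \<Rightarrow> real \<Rightarrow> 'y) \<Rightarrow> bool" where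
  "approximates w f g F G \<longleftrightarrow> f \<in> Lpw p w \<and> g \<in> Lpw p w \<and>
     (\<forall>n. F n \<in> schwartz \<and> F n \<in> Lpw p w \<and> G n \<in> Lpw p w \<and> represents (G n) (T (F n))) \<and>
     (\<lambda>n. power_integral p w (\<lambda>t. f t - F n t)) \<longlonglongrightarrow> 0 \<and>
     (\<lambda>n. power_integral p w (\<lambda>t. g t - G n t)) \<longlonglongrightarrow> 0"

lemma approximatesD:
  assumes "approximates w f g F G"
  shows "f \<in> Lpw p w" "g \<in> Lpw p w"
    "F n \<in> schwartz" "F n \<in> Lpw p w" "G n \<in> Lpw p w" "represents (G n) (T (F n))"
    "(\<lambda>n. power_integral p w (\<lambda>t. f t - F n t)) \<longlonglongrightarrow> 0"
    "(\<lambda>n. power_integral p w (\<lambda>t. g t - G n t)) \<longlonglongrightarrow> 0"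
  using assms unfolding approximates_def by blast+

text \<open>The closure, in the product of two weighted spaces, of the graph of the operator on
  Schwartz functions. As a relation it can be compared for different weights before a value is
  selected.\<close>

definition extension_rel :: "(real \<Rightarrow> real) \<Rightarrow> (real \<Rightarrow> 'x) \<Rightarrow> (real \<Rightarrow> 'y) \<Rightarrow> bool" where
  "extension_rel w f g \<longleftrightarrow> (\<exists>F G. approximates w f g F G)"

lemma extension_relI:
  assumes "f \<in> Lpw p w" "g \<in> Lpw p w"
    "\<And>n. F n \<in> schwartz" "\<And>n. F n \<in> Lpw p w" "\<And>n. G n \<in> Lpw p w" "\<And>n. represents (G n) (T (F n))"
    "(\<lambda>n. power_integral p w (\<lambda>t. f t - F n t)) \<longlonglongrightarrow> 0"
    "(\<lambda>n. power_integral p w (\<lambda>t. g t - G n t)) \<longlonglongrightarrow> 0"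
  shows "extension_rel w f g"
  unfolding extension_rel_def approximates_def by (intro exI[of _ F] exI[of _ G] conjI allI assms)

lemma extension_rel_Lpw:
  assumes "extension_rel w f g" shows "f \<in> Lpw p w" "g \<in> Lpw p w"
  using assms by (auto simp: extension_rel_def dest: approximatesD(1,2))

lemma extension_rel_schwartz:
  assumes "f \<in> schwartz" "f \<in> Lpw p w" "g \<in> Lpw p w" "represents g (T f)"
  shows "extension_rel w f g"
  by (rule extension_relI[of f w g "\<lambda>_. f" "\<lambda>_. g"]) (use assms in \<open>auto simp: power_integral_def\<close>)

text \<open>Convergence for a weight implies convergence for every smaller one, with the same
  approximating sequences. This is what makes the minimum of two weights a common ground.\<close>

lemma extension_rel_mono:
  assumes "extension_rel w f g" and le: "AE t in lebesgue. w' t \<le> w t"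
  shows "extension_rel w' f g"
proof -
  have p0: "0 \<le> p" using p by simp
  obtain F G where "approximates w f g F G"
    using assms(1) unfolding extension_rel_def by blast
  note FG = approximatesD[OF this]
  have mono: "(\<lambda>n. power_integral p w' (h n)) \<longlonglongrightarrow> 0" if "(\<lambda>n. power_integral p w (h n)) \<longlonglongrightarrow> 0"
    for h :: "nat \<Rightarrow> real \<Rightarrow> 'z::real_normed_vector"
    by (rule tendsto_sandwich[OF _ _ tendsto_const that])
      (auto intro!: always_eventually power_integral_mono[OF p0 _ le])
  show ?thesis
    by (rule extension_relI[of _ _ _ F G]) (use FG mono le p0 in \<open>auto intro: Lpw_mono_weight\<close>)
qed

lemma extension_rel_add:
  assumes w: "w \<in> borel_measurable lebesgue"
    and "extension_rel w f g" "extension_rel w f' g'"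
  shows "extension_rel w (\<lambda>t. f t + f' t) (\<lambda>t. g t + g' t)"
proof -
  have p0: "0 \<le> p" using p by simp
  obtain F G where "approximates w f g F G"
    using assms(2) unfolding extension_rel_def by blast
  note FG = approximatesD[OF this]
  obtain F' G' where "approximates w f' g' F' G'"
    using assms(3) unfolding extension_rel_def by blast
  note FG' = approximatesD[OF this]
  have lim: "(\<lambda>n. power_integral p w (\<lambda>t. h t + h' t - (H n t + H' n t))) \<longlonglongrightarrow> 0"
    if hH: "h \<in> Lpw p w" "h' \<in> Lpw p w" "\<And>n. H n \<in> Lpw p w" "\<And>n. H' n \<in> Lpw p w"
      "(\<lambda>n. power_integral p w (\<lambda>t. h t - H n t)) \<longlonglongrightarrow> 0"
      "(\<lambda>n. power_integral p w (\<lambda>t. h' t - H' n t)) \<longlonglongrightarrow> 0"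
    for h h' :: "real \<Rightarrow> 'z::real_normed_vector" and H H'
  proof (rule tendsto_sandwich[OF _ _ tendsto_const])
    show "(\<lambda>n. ennreal (2 powr p) * (power_integral p w (\<lambda>t. h t - H n t) + power_integral p w (\<lambda>t. h' t - H' n t)))
        \<longlonglongrightarrow> 0"
      using ennreal_tendsto_cmult[OF _ tendsto_add[OF hH(5,6)], of "ennreal (2 powr p)"] by simp
    have "power_integral p w (\<lambda>t. h t + h' t - (H n t + H' n t)) \<le>
        ennreal (2 powr p) * (power_integral p w (\<lambda>t. h t - H n t) + power_integral p w (\<lambda>t. h' t - H' n t))" for n
    proof (rule power_integral_add_le[OF p0 _ _ w])
      show "strongly_measurable (\<lambda>t. h t - H n t)" "strongly_measurable (\<lambda>t. h' t - H' n t)"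
        using hH(1-4) by (auto simp: Lpw_iff intro: strongly_measurable_diff)
      show "norm (h t + h' t - (H n t + H' n t)) \<le> norm (h t - H n t) + norm (h' t - H' n t)" for t
        by (rule norm_diff_triangle_ineq)
    qed
    then show "\<forall>\<^sub>F n in sequentially. power_integral p w (\<lambda>t. h t + h' t - (H n t + H' n t)) \<le>
        ennreal (2 powr p) * (power_integral p w (\<lambda>t. h t - H n t) + power_integral p w (\<lambda>t. h' t - H' n t))" by simp
  qed simp
  show ?thesis
    by (rule extension_relI[of _ _ _ "\<lambda>n t. F n t + F' n t" "\<lambda>n t. G n t + G' n t"])
      (intro Lpw_add schwartz_add T_represented_add lim FG FG' w p0)+
qed

lemma extension_rel_scaleC:
  assumes w: "w \<in> borel_measurable lebesgue" and "extension_rel w f g"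
  shows "extension_rel w (\<lambda>t. scaleC c (f t)) (\<lambda>t. scaleC c (g t))"
proof -
  obtain F G where "approximates w f g F G"
    using assms(2) unfolding extension_rel_def by blast
  note FG = approximatesD[OF this]
  have lim: "(\<lambda>n. power_integral p w (\<lambda>t. scaleC c (h t) - scaleC c (H n t))) \<longlonglongrightarrow> 0"
    if hH: "h \<in> Lpw p w" "\<And>n. H n \<in> Lpw p w" "(\<lambda>n. power_integral p w (\<lambda>t. h t - H n t)) \<longlonglongrightarrow> 0"
    for h :: "real \<Rightarrow> 'z::complex_banach" and H
  proof -
    have "power_integral p w (\<lambda>t. scaleC c (h t) - scaleC c (H n t)) =
        ennreal (cmod c powr p) * power_integral p w (\<lambda>t. h t - H n t)" for n
      by (rule power_integral_scale[OF _ w])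
        (use hH in \<open>auto simp: Lpw_iff norm_scaleC simp flip: scaleC_diff_right intro: strongly_measurable_diff\<close>)
    then show ?thesis using ennreal_tendsto_cmult[OF _ hH(3), of "ennreal (cmod c powr p)"] by simp
  qed
  show ?thesis
    by (rule extension_relI[of _ _ _ "\<lambda>n t. scaleC c (F n t)" "\<lambda>n t. scaleC c (G n t)"])
      (intro Lpw_scaleC(1) schwartz_scaleC T_represented_scaleC lim FG w)+
qed

text \<open>The constant collects two quasi-triangle inequalities, one from g to its approximant and
  one from the approximant of f to f, around the bound \<open>K powr p\<close> on Schwartz
  functions. The errors vanish in the limit.\<close>

lemma extension_rel_bound:
  assumes w: "w \<in> Ap p" and K: "Lpw_operator_norm p w T \<le> ennreal K" "0 \<le> K"
    and "extension_rel w f g"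
  shows "power_integral p w g \<le> ennreal (2 powr p * (K powr p * 2 powr p)) * power_integral p w f"
proof -
  note wm = Ap_borel[OF w]
  have p0: "0 \<le> p" using p by simp
  obtain F G where "approximates w f g F G"
    using assms(4) unfolding extension_rel_def by blast
  note FG = approximatesD[OF this]
  let ?c = "ennreal (2 powr p)"
  have sm: "strongly_measurable f" "strongly_measurable g" "strongly_measurable (F n)" "strongly_measurable (G n)" for n
    using FG(1,2,4,5) by (auto simp: Lpw_iff)
  have bound: "power_integral p w g \<le> ?c * (power_integral p w (\<lambda>t. g t - G n t) +
      ennreal (K powr p) * (?c * (power_integral p w (\<lambda>t. f t - F n t) + power_integral p w f)))" for n
  proof -
    have "norm (g t) \<le> norm (g t - G n t) + norm (G n t)" for t
      using norm_triangle_ineq[of "g t - G n t" "G n t"] by simp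
    then have "power_integral p w g \<le> ?c * (power_integral p w (\<lambda>t. g t - G n t) + power_integral p w (G n))"
      by (intro power_integral_add_le[OF p0 _ _ wm] strongly_measurable_diff sm)
    also have "power_integral p w (G n) \<le> ennreal (K powr p) * power_integral p w (F n)"
      by (rule T_bound[OF w K]) (rule FG)+
    also have "power_integral p w (F n) \<le> ?c * (power_integral p w (\<lambda>t. f t - F n t) + power_integral p w f)"
    proof (intro power_integral_add_le[OF p0 _ _ wm] strongly_measurable_diff sm)
      show "norm (F n t) \<le> norm (f t - F n t) + norm (f t)" for t
        using norm_triangle_ineq4[of "f t" "f t - F n t"] by simp
    qed
    finally show ?thesis by (simp add: mult_left_mono add_left_mono)
  qed
  have "(\<lambda>n. ?c * (power_integral p w (\<lambda>t. g t - G n t) +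
      ennreal (K powr p) * (?c * (power_integral p w (\<lambda>t. f t - F n t) + power_integral p w f))))
      \<longlonglongrightarrow> ?c * (0 + ennreal (K powr p) * (?c * (0 + power_integral p w f)))"
    by (intro ennreal_tendsto_cmult tendsto_add FG tendsto_const) auto
  then have "power_integral p w g \<le> ?c * (0 + ennreal (K powr p) * (?c * (0 + power_integral p w f)))"
    by (rule tendsto_lowerbound) (use bound in auto)
  then show ?thesis by (simp add: ennreal_mult mult.assoc)
qed

lemma operator_norm_bound:
  assumes "w \<in> Ap p" obtains K where "0 \<le> K" "Lpw_operator_norm p w T \<le> ennreal K"
  using finite_norm[OF assms] by (cases "Lpw_operator_norm p w T") auto

lemma extension_rel_ex:
  assumes w: "w \<in> Ap p" and f: "f \<in> Lpw p w"
  shows "\<exists>g. extension_rel w f g"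
proof -
  note wm = Ap_borel[OF w]
  have p0: "0 < p" using p by simp
  obtain K where K: "0 \<le> K" "Lpw_operator_norm p w T \<le> ennreal K" by (rule operator_norm_bound[OF w])
  \<comment> \<open>The approximation speed is dictated by the Cauchy rate in
    \<open>power_integral_complete\<close>.\<close>
  define q where "q n = (4 powr - p) ^ n" for n :: nat
  have q: "0 < q n" for n by (simp add: q_def)
  have q1: "4 powr - p < (1::real)" using p by (simp add: powr_minus_divide)
  have q_mono: "q m \<le> q n" if "n \<le> m" for n m
    unfolding q_def by (rule power_decreasing[OF that]) (use q1 in auto)
  have q_lim: "(\<lambda>n. ennreal (A * q n)) \<longlonglongrightarrow> 0" for A
  proof -
    have "(\<lambda>n. A * q n) \<longlonglongrightarrow> A * 0"
      unfolding q_def by (intro tendsto_mult tendsto_const LIMSEQ_realpow_zero) (use q1 in auto)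
    then show ?thesis using tendsto_ennrealI[of "\<lambda>n. A * q n" 0 sequentially] by simp
  qed
  have fm: "strongly_measurable f" using f by (simp add: Lpw_iff)
  have approx: "bump_approximable p w f"
    by (rule bump_approximable_Lpw[OF p0 Ap_locally_integrable[OF w]]) (use f in \<open>auto simp: Lpw_iff\<close>)
  have "\<forall>n. \<exists>u. u \<in> bumps \<and> power_integral p w (\<lambda>t. f t - u t) < ennreal (q n)"
    using bump_approximableD[OF approx q] by blast
  then obtain F where F: "\<And>n. F n \<in> bumps" "\<And>n. power_integral p w (\<lambda>t. f t - F n t) < ennreal (q n)"
    by metis
  have FS: "F n \<in> schwartz" for n using F(1) bumps_subset_schwartz by blast
  have FL: "F n \<in> Lpw p w" for n
    using F(1)[of n] bumps_power_integral[OF F(1) Ap_locally_integrable[OF w] p0]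
    by (simp add: Lpw_iff bumps_strongly_measurable)
  have Fm: "strongly_measurable (F n)" for n by (rule bumps_strongly_measurable[OF F(1)])
  have "\<forall>n. \<exists>g. g \<in> Lpw p w \<and> represents g (T (F n))" using T_represented[OF w FS] by blast
  then obtain G where G: "\<And>n. G n \<in> Lpw p w" "\<And>n. represents (G n) (T (F n))" by metis
  have Gm: "strongly_measurable (G n)" for n using G(1)[of n] by (simp add: Lpw_iff)
  \<comment> \<open>\<open>K powr p\<close> from the operator, \<open>2 powr p\<close> from the
    quasi-triangle inequality, and 2 for the two approximation errors, each at most
    \<open>q n\<close>.\<close>
  define A where "A = K powr p * (2 powr p * 2)"
  have A: "0 \<le> A" by (simp add: A_def)
  have cauchy: "power_integral p w (\<lambda>t. G n t - G m t) \<le> ennreal (A * (4 powr - p) ^ n)" if nm: "n \<le> m" for n m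
  proof -
    \<comment> \<open>Differences are written with \<open>scaleC (- 1)\<close> because linearity of
      the operator is stated for sums and complex multiples.\<close>
    let ?F = "\<lambda>t. F n t + scaleC (- 1) (F m t)" and ?G = "\<lambda>t. G n t + scaleC (- 1) (G m t)"
    have "power_integral p w ?G \<le> ennreal (K powr p) * power_integral p w ?F"
    proof (rule T_bound[OF w K(2,1)])
      show "?F \<in> schwartz" by (intro schwartz_add schwartz_scaleC FS)
      show "?F \<in> Lpw p w" "?G \<in> Lpw p w" by (intro Lpw_add Lpw_scaleC(1) FL G wm less_imp_le[OF p0])+
      show "represents ?G (T ?F)" by (intro T_represented_add T_represented_scaleC schwartz_scaleC FS G)
    qed
    also have "power_integral p w ?F \<le> ennreal (2 powr p) *
        (power_integral p w (\<lambda>t. f t - F n t) + power_integral p w (\<lambda>t. f t - F m t))"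
    proof (intro power_integral_add_le[OF less_imp_le[OF p0] _ _ wm] strongly_measurable_diff fm Fm)
      show "norm (?F t) \<le> norm (f t - F n t) + norm (f t - F m t)" for t
        using norm_triangle_ineq4[of "f t - F m t" "f t - F n t"]
        by (simp flip: uminus_conv_scaleC add: add.commute)
    qed
    also have "\<dots> \<le> ennreal (2 powr p) * (ennreal (q n) + ennreal (q n))"
      using F(2)[of n] F(2)[of m] q_mono[OF nm]
      by (intro mult_left_mono add_mono) (auto intro: order_trans[OF less_imp_le ennreal_leI])
    finally have "power_integral p w ?G \<le> ennreal (K powr p) * (ennreal (2 powr p) * (ennreal (q n) + ennreal (q n)))"
      by (simp add: mult_left_mono)
    also have "\<dots> = ennreal (A * q n)"
      using q[of n] by (simp add: A_def ennreal_mult[symmetric] algebra_simps flip: ennreal_plus)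
    finally show ?thesis by (simp add: q_def flip: uminus_conv_scaleC)
  qed
  obtain g where g: "strongly_measurable g" "AE t in lebesgue. (\<lambda>n. G n t) \<longlonglongrightarrow> g t"
    "\<And>n. power_integral p w (\<lambda>t. G n t - g t) \<le> ennreal (A * (4 powr - p) ^ n)"
    using power_integral_complete[OF p0 wm Ap_pos[OF w] Gm A cauchy] by blast
  have gL: "g \<in> Lpw p w"
  proof -
    have "norm (g t) \<le> norm (G 0 t - g t) + norm (G 0 t)" for t
      using norm_triangle_ineq4[of "G 0 t" "G 0 t - g t"] by simp
    then have "power_integral p w g \<le> ennreal (2 powr p) * (power_integral p w (\<lambda>t. G 0 t - g t) + power_integral p w (G 0))"
      by (intro power_integral_add_le[OF less_imp_le[OF p0] _ _ wm] strongly_measurable_diff Gm g)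
    also have "\<dots> < \<infinity>"
      using le_less_trans[OF g(3)[of 0], of \<infinity>] G(1)[of 0] by (simp add: Lpw_iff ennreal_mult_less_top)
    finally show ?thesis using g(1) by (simp add: Lpw_iff)
  qed
  have "extension_rel w f g"
  proof (rule extension_relI[OF f gL FS FL G])
    show "(\<lambda>n. power_integral p w (\<lambda>t. f t - F n t)) \<longlonglongrightarrow> 0"
      by (rule tendsto_sandwich[OF _ _ tendsto_const q_lim[of 1]]) (use F(2) in \<open>auto intro!: always_eventually less_imp_le\<close>)
    show "(\<lambda>n. power_integral p w (\<lambda>t. g t - G n t)) \<longlonglongrightarrow> 0"
      by (rule tendsto_sandwich[OF _ _ tendsto_const q_lim[of A]])
        (use g(3) in \<open>auto intro!: always_eventually simp: q_def power_integral_diff_commute[of p w g]\<close>)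
  qed
  then show ?thesis by blast
qed

text \<open>Consistency of the extensions for two weights: both restrict to the extension for their
  minimum.\<close>

lemma extension_rel_unique:
  assumes w: "w \<in> Ap p" "w' \<in> Ap p" and fg: "extension_rel w f g" "extension_rel w' f' g'"
    and eq: "AE t in lebesgue. f t = f' t"
  shows "AE t in lebesgue. g t = g' t"
proof -
  define m where "m t = min (w t) (w' t)" for t
  have m: "m \<in> Ap p" using Ap_min[OF p w] by (simp add: m_def[abs_def])
  note mm = Ap_borel[OF m]
  obtain K where K: "0 \<le> K" "Lpw_operator_norm p m T \<le> ennreal K" by (rule operator_norm_bound[OF m])
  have "extension_rel m f g" "extension_rel m f' g'"
    by (rule extension_rel_mono[OF fg(1)], simp add: m_def, rule extension_rel_mono[OF fg(2)], simp add: m_def)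
  then have E: "extension_rel m (\<lambda>t. f t + scaleC (- 1) (f' t)) (\<lambda>t. g t + scaleC (- 1) (g' t))"
    by (intro extension_rel_add[OF mm] extension_rel_scaleC[OF mm])
  have "power_integral p m (\<lambda>t. f t + scaleC (- 1) (f' t)) = power_integral p m (\<lambda>t. 0 :: 'x)"
    by (rule power_integral_cong_norm) (use eq in eventually_elim, simp flip: uminus_conv_scaleC)
  also have "\<dots> = 0" by (simp add: power_integral_def)
  finally have "power_integral p m (\<lambda>t. g t + scaleC (- 1) (g' t)) = 0"
    using extension_rel_bound[OF m K(2,1) E] by simp
  moreover have "strongly_measurable (\<lambda>t. g t + scaleC (- 1) (g' t))"
    using E by (auto simp: Lpw_iff dest: extension_rel_Lpw)
  ultimately have "AE t in lebesgue. g t + scaleC (- 1) (g' t) = 0"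
    by (intro power_integral_eq_0_imp[OF _ mm Ap_pos[OF m]])
  then show ?thesis by eventually_elim (simp flip: uminus_conv_scaleC)
qed

text \<open>Weight and value are chosen together. By \<open>extension_rel_unique\<close> any two
  choices agree almost everywhere, so the weight leaves no trace in the class.\<close>

definition extension :: "(real \<Rightarrow> 'x) \<Rightarrow> (real \<Rightarrow> 'y)" where
  "extension f = (SOME g. \<exists>w\<in>Ap p. extension_rel w f g)"

lemma extension_obtains:
  assumes "f \<in> (\<Union>w\<in>Ap p. Lpw p w)"
  obtains w where "w \<in> Ap p" "extension_rel w f (extension f)"
proof -
  have "\<exists>g. \<exists>w\<in>Ap p. extension_rel w f g" using assms extension_rel_ex by blast
  from someI_ex[OF this] show thesis using that unfolding extension_def[symmetric] by blast
qed

lemma extension_eq: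
  assumes w: "w \<in> Ap p" and fg: "extension_rel w f g"
  shows "AE t in lebesgue. extension f t = g t"
proof -
  have "f \<in> (\<Union>w\<in>Ap p. Lpw p w)" using w fg by (auto dest: extension_rel_Lpw)
  then obtain w' where "w' \<in> Ap p" "extension_rel w' f (extension f)" by (rule extension_obtains)
  then show ?thesis using extension_rel_unique[OF _ w _ fg] by simp
qed

text \<open>The weight behind the choice of \<open>extension f\<close> is unknown, but its value
  agrees almost everywhere with the one obtained from w. Thus the estimates for every suitable
  weight apply to one and the same function.\<close>

lemma extension_Lpw:
  assumes w: "w \<in> Ap p" and f: "f \<in> Lpw p w"
  shows "extension_rel w f (extension f)"
proof -
  obtain g where g: "extension_rel w f g" using extension_rel_ex[OF w f] by blast
  have eq: "AE t in lebesgue. extension f t = g t" by (rule extension_eq[OF w g])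
  obtain F G where "approximates w f g F G"
    using g unfolding extension_rel_def by blast
  note FG = approximatesD[OF this]
  have cong: "power_integral p w (\<lambda>t. g t - G n t) = power_integral p w (\<lambda>t. extension f t - G n t)" for n
    by (rule power_integral_cong_norm) (use eq in eventually_elim, simp)
  have "power_integral p w g = power_integral p w (extension f)"
    by (rule power_integral_cong_norm) (use eq in eventually_elim, simp)
  moreover have "strongly_measurable (extension f)"
  proof (rule strongly_measurable_AE_eq)
    show "strongly_measurable g" using FG(2) by (simp add: Lpw_iff)
    show "AE t in lebesgue. g t = extension f t" using eq by eventually_elim simp
  qed
  ultimately have "extension f \<in> Lpw p w" using FG(2) by (simp add: Lpw_iff)
  then show ?thesis
    by (rule extension_relI[OF FG(1) _ FG(3-7)]) (use FG(8) cong in simp)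
qed

end

section \<open>The union of the weighted spaces as a vector space\<close>

lemma Ap_union_common_weight:
  assumes p: "1 < p" and f: "f \<in> (\<Union>w\<in>Ap p. Lpw p w)" and g: "g \<in> (\<Union>w\<in>Ap p. Lpw p w)"
  obtains w where "w \<in> Ap p" "f \<in> Lpw p w" "g \<in> Lpw p w"
proof -
  obtain u v where uv: "u \<in> Ap p" "v \<in> Ap p" "f \<in> Lpw p u" "g \<in> Lpw p v" using f g by blast
  show thesis
  proof (rule that[OF Ap_min[OF p uv(1,2)]])
    show "f \<in> Lpw p (\<lambda>t. min (u t) (v t))" "g \<in> Lpw p (\<lambda>t. min (u t) (v t))"
      using p uv by (auto intro!: Lpw_mono_weight[OF uv(3)] Lpw_mono_weight[OF uv(4)])
  qed
qed

lemma fun_subspace_Ap_union: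
  assumes p: "1 < p"
  shows "fun_subspace (\<Union>w\<in>Ap p. Lpw p w)"
  unfolding fun_subspace_def
proof (intro conjI ballI allI)
  show "(\<lambda>t. 0) \<in> (\<Union>w\<in>Ap p. Lpw p w)"
    using Ap_one[OF p] by (auto simp: Lpw_iff strongly_measurable_const power_integral_def)
next
  fix f g :: "real \<Rightarrow> 'a" assume "f \<in> (\<Union>w\<in>Ap p. Lpw p w)" "g \<in> (\<Union>w\<in>Ap p. Lpw p w)"
  then obtain w where "w \<in> Ap p" "f \<in> Lpw p w" "g \<in> Lpw p w" by (rule Ap_union_common_weight[OF p])
  then show "(\<lambda>t. f t + g t) \<in> (\<Union>w\<in>Ap p. Lpw p w)" using p by (auto intro!: bexI[of _ w] Lpw_add Ap_borel)
next
  fix c and f :: "real \<Rightarrow> 'a" assume "f \<in> (\<Union>w\<in>Ap p. Lpw p w)"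
  then show "(\<lambda>t. scaleC c (f t)) \<in> (\<Union>w\<in>Ap p. Lpw p w)" by (auto intro: Lpw_scaleC(1) Ap_borel)
qed

lemma schwartz_subset_Lpw_one: "1 < p \<Longrightarrow> schwartz \<subseteq> Lpw p (\<lambda>_. 1)"
  by (intro subsetI LpwI schwartz_strongly_measurable schwartz_power_integral_1) simp_all

context weighted_operator
begin

lemma extension_linear: "linear_operator (\<Union>w\<in>Ap p. Lpw p w) L1_loc extension"
  unfolding linear_operator_def
proof (intro conjI ballI allI impI)
  let ?U = "\<Union>w\<in>Ap p. Lpw p w :: (real \<Rightarrow> 'x) set"
  fix f assume f: "f \<in> ?U"
  then obtain w where w: "w \<in> Ap p" "f \<in> Lpw p w" by blast
  note E = extension_Lpw[OF w]
  show "extension f \<in> L1_loc"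
    using E Lpw_subset_L1_loc[OF p w(1), of "extension f"] by (auto dest: extension_rel_Lpw)
  show "AE t in lebesgue. extension (\<lambda>s. scaleC c (f s)) t = scaleC c (extension f t)" for c
    by (rule extension_eq[OF w(1) extension_rel_scaleC[OF Ap_borel[OF w(1)] E]])
  fix g assume g: "g \<in> ?U"
  show "AE t in lebesgue. extension f t = extension g t" if "AE t in lebesgue. f t = g t"
  proof -
    obtain w' where w': "w' \<in> Ap p" "g \<in> Lpw p w'" using g by blast
    show ?thesis by (rule extension_rel_unique[OF w(1) w'(1) E extension_Lpw[OF w'] that])
  qed
  obtain v where v: "v \<in> Ap p" "f \<in> Lpw p v" "g \<in> Lpw p v" by (rule Ap_union_common_weight[OF p f g])
  show "AE t in lebesgue. extension (\<lambda>s. f s + g s) t = extension f t + extension g t"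
    by (rule extension_eq[OF v(1) extension_rel_add[OF Ap_borel[OF v(1)] extension_Lpw[OF v(1,2)] extension_Lpw[OF v(1,3)]]])
qed

lemma extension_extends: "extends_schwartz_operator T (\<Union>w\<in>Ap p. Lpw p w) extension"
  unfolding extends_schwartz_operator_def
proof (intro conjI ballI)
  \<comment> \<open>A single weight suffices here, since the value of \<open>extension\<close> at f
    is independent of the weight.\<close>
  note one = Ap_one[OF p]
  show "schwartz \<subseteq> (\<Union>w\<in>Ap p. Lpw p w)" using schwartz_subset_Lpw_one[OF p] one by blast
  fix f :: "real \<Rightarrow> 'x" assume f: "f \<in> schwartz"
  obtain g where g: "g \<in> Lpw p (\<lambda>_. 1)" "represents g (T f)" using T_represented[OF one f] by blast
  have "f \<in> Lpw p (\<lambda>_. 1)" using schwartz_subset_Lpw_one[OF p] f by blast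
  from extension_eq[OF one extension_rel_schwartz[OF f this g]]
  have "AE t in lebesgue. g t = extension f t" by eventually_elim simp
  with g(2) show "represents (extension f) (T f)" by (rule represents_AE_eq)
qed

end

subsection \<open>Extrapolation\<close>

text \<open>The second clause is an additive replacement for Hoelder's inequality. In the
  application d bounds the integral of the product of the two A_1 majorants, which is why the same
  number serves in both clauses.\<close>

definition controls ::
    "real \<Rightarrow> (real \<Rightarrow> real) \<Rightarrow> real \<Rightarrow> (real \<Rightarrow> real) \<Rightarrow> (real \<Rightarrow> real) \<Rightarrow> bool" where
  "controls p w d f h \<longleftrightarrow> power_integral p w f \<le> ennreal d \<and>
     (\<forall>g :: real \<Rightarrow> real. g \<in> borel_measurable lebesgue \<longrightarrow> (\<forall>t. 0 \<le> g t) \<longrightarrow>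
        (\<integral>\<^sup>+t. ennreal (g t * h t) \<partial>lebesgue) \<le> power_integral p w g + ennreal d)"

lemma le_powr_add_one: "0 \<le> a \<Longrightarrow> 1 \<le> p \<Longrightarrow> a \<le> a powr p + (1::real)"
proof (cases "a \<le> 1")
  case False
  assume "1 \<le> p"
  with False have "a powr 1 \<le> a powr p" by (intro powr_mono) auto
  with False show ?thesis by simp
qed (simp add: add_increasing)

context banach_function_space
begin

lemma kothe_ennnorm_add_le:
  fixes h e :: "real \<Rightarrow> real"
  assumes [measurable]: "h \<in> borel_measurable lebesgue" "e \<in> borel_measurable lebesgue"
    and nonneg: "\<And>t. 0 \<le> h t" "\<And>t. 0 \<le> e t"
  shows "kothe_ennnorm \<Phi> N (\<lambda>t. complex_of_real (h t + e t)) \<le>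
    kothe_ennnorm \<Phi> N (\<lambda>t. complex_of_real (h t)) + kothe_ennnorm \<Phi> N (\<lambda>t. complex_of_real (e t))"
  unfolding kothe_ennnorm_def[of _ _ "\<lambda>t. complex_of_real (h t + e t)"]
proof (rule SUP_least)
  fix f assume f: "f \<in> {f \<in> \<Phi>. N f \<le> 1}"
  then have [measurable]: "f \<in> borel_measurable lebesgue" using measurable by blast
  have "cmod (f t * complex_of_real (h t + e t)) =
      cmod (f t * complex_of_real (h t)) + cmod (f t * complex_of_real (e t))" for t
    unfolding norm_mult norm_of_real using nonneg[of t] by (simp add: distrib_left)
  then have "(\<integral>\<^sup>+t. ennreal (cmod (f t * complex_of_real (h t + e t))) \<partial>lebesgue) =
      (\<integral>\<^sup>+t. ennreal (cmod (f t * complex_of_real (h t))) + ennreal (cmod (f t * complex_of_real (e t))) \<partial>lebesgue)"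
    by (intro nn_integral_cong) (simp only: ennreal_plus norm_ge_zero)
  also have "\<dots> = (\<integral>\<^sup>+t. ennreal (cmod (f t * complex_of_real (h t))) \<partial>lebesgue) +
      (\<integral>\<^sup>+t. ennreal (cmod (f t * complex_of_real (e t))) \<partial>lebesgue)"
    by (rule nn_integral_add) measurable
  also have "\<dots> \<le> kothe_ennnorm \<Phi> N (\<lambda>t. complex_of_real (h t)) + kothe_ennnorm \<Phi> N (\<lambda>t. complex_of_real (e t))"
    unfolding kothe_ennnorm_def by (intro add_mono SUP_upper f)
  finally show "(\<integral>\<^sup>+t. ennreal (cmod (f t * complex_of_real (h t + e t))) \<partial>lebesgue) \<le>
      kothe_ennnorm \<Phi> N (\<lambda>t. complex_of_real (h t)) + kothe_ennnorm \<Phi> N (\<lambda>t. complex_of_real (e t))" .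
qed

text \<open>An indicator is added to \<open>f\<close> and \<open>h\<close> in order that their \<open>A\<^sub>1\<close> majorants are positive a.e.\<close>

lemma extrapolation_weight:
  assumes M: "maximal_bounded_on \<Phi> N" and M': "maximal_bounded_on (kothe_dual \<Phi> N) (kothe_norm \<Phi> N)"
    and p: "1 < p"
  obtains c and D :: "real \<Rightarrow> real" where "\<And>R. 0 \<le> R \<Longrightarrow> 0 < D R"
    "\<And>(f :: real \<Rightarrow> real) h R. f \<in> vector_valued \<Phi> \<Longrightarrow> (\<And>t. 0 \<le> f t) \<Longrightarrow> vector_norm N f \<le> R \<Longrightarrow> 0 \<le> R \<Longrightarrow>
      h \<in> borel_measurable lebesgue \<Longrightarrow> (\<And>t. 0 \<le> h t) \<Longrightarrow>
      kothe_ennnorm \<Phi> N (\<lambda>t. complex_of_real (h t)) \<le> 1 \<Longrightarrow>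
      \<exists>w\<in>Ap p. Ap_const p w \<le> ennreal c \<and> controls p w (D R) f h"
proof -
  obtain C where C: "0 < C" "\<And>g :: real \<Rightarrow> real. g \<in> vector_valued \<Phi> \<Longrightarrow> (\<And>t. 0 \<le> g t) \<Longrightarrow>
    \<exists>v\<in>vector_valued \<Phi>. A1_bound C v \<and> (AE t in lebesgue. g t \<le> v t) \<and> vector_norm N v \<le> 2 * vector_norm N g"
    by (rule sigma_normed.A1_majorant[OF sigma_normed M]) blast
  obtain C' where C': "0 < C'" "\<And>g :: real \<Rightarrow> real. g \<in> vector_valued (kothe_dual \<Phi> N) \<Longrightarrow> (\<And>t. 0 \<le> g t) \<Longrightarrow>
    \<exists>v\<in>vector_valued (kothe_dual \<Phi> N). A1_bound C' v \<and> (AE t in lebesgue. g t \<le> v t) \<and>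
      vector_norm (kothe_norm \<Phi> N) v \<le> 2 * vector_norm (kothe_norm \<Phi> N) g"
    by (rule sigma_normed.A1_majorant[OF sigma_normed_kothe[OF M] M']) blast
  define e where "e = interval_indicator 1"
  have e0: "0 \<le> e t" for t by (simp add: e_def interval_indicator_bounds)
  have em [measurable]: "e \<in> borel_measurable lebesgue" by (simp add: e_def)
  have e\<Phi>: "e \<in> vector_valued \<Phi>" and e\<Phi>': "e \<in> vector_valued (kothe_dual \<Phi> N)"
    unfolding e_def by (rule interval_indicator_in[OF M] interval_indicator_in_kothe[OF M])+
  define a where "a = vector_norm N e"
  have a: "0 < a" using interval_indicator_norm_pos[OF M, of 0] by (simp add: a_def e_def)
  define b where "b = vector_norm (kothe_norm \<Phi> N) e"
  have b: "0 \<le> b" by (simp add: b_def vector_norm_def kothe_norm_def)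
  have eb: "kothe_ennnorm \<Phi> N (\<lambda>t. complex_of_real (e t)) = ennreal b"
    using ennreal_vector_norm_kothe[OF e\<Phi>'] e0 by (simp add: b_def)
  have e_nz: "AE t in lebesgue. 0 < v t" if v: "A1_bound B v" "AE t in lebesgue. e t \<le> v t" for v B
  proof (rule A1_bound_pos[OF v(1)])
    show "\<not> (AE t in lebesgue. v t = 0)"
    proof
      assume "AE t in lebesgue. v t = 0"
      with v(2) have "AE t in lebesgue. e t \<le> 0" by eventually_elim simp
      then obtain t where "- 1 \<le> t" "t \<le> 1" "e t \<le> 0"
        by (rule AE_lebesgue_ex_in_interval[where a="- 1" and b=1]) auto
      then show False by (simp add: e_def interval_indicator_def)
    qed
  qed
  \<comment> \<open>The factors bound the norm of the majorant v in \<open>\<Phi>\<close> and of u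
    in the Koethe dual, so \<open>D R\<close> bounds the integral of v u. The A_p constant of the
    weight, in contrast, does not depend on R.\<close>
  define D where "D R = 2 * (R + a) * (2 * (1 + b))" for R
  show thesis
  proof (rule that[of D "C powr (p - 1) * C'"])
    show "0 < D R" if "0 \<le> R" for R using that a b by (simp add: D_def add_nonneg_pos)
    fix f h :: "real \<Rightarrow> real" and R
    assume f: "f \<in> vector_valued \<Phi>" "\<And>t. 0 \<le> f t" "vector_norm N f \<le> R" "0 \<le> R"
      and h: "h \<in> borel_measurable lebesgue" "\<And>t. 0 \<le> h t" "kothe_ennnorm \<Phi> N (\<lambda>t. complex_of_real (h t)) \<le> 1"
    have [measurable]: "f \<in> borel_measurable lebesgue"
      using f(1) by (simp add: vector_valued_def strongly_measurable_iff_borel)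
    note h(1)[measurable]
    have sm: "strongly_measurable (\<lambda>t. f t + e t)" by (simp add: strongly_measurable_iff_borel)
    have le: "AE t in lebesgue. norm (f t + e t) \<le> norm (f t) + norm (e t)" by (intro AE_I2 norm_triangle_ineq)
    have fe: "(\<lambda>t. f t + e t) \<in> vector_valued \<Phi>" "vector_norm N (\<lambda>t. f t + e t) \<le> R + a"
      using vector_valued_add_le[OF f(1) e\<Phi> sm le] f(3) by (auto simp: a_def)
    obtain v where v: "v \<in> vector_valued \<Phi>" "A1_bound C v" "AE t in lebesgue. f t + e t \<le> v t"
      "vector_norm N v \<le> 2 * vector_norm N (\<lambda>t. f t + e t)"
      using C(2)[OF fe(1)] f(2) e0 by (meson add_nonneg_nonneg)
    have vN: "vector_norm N v \<le> 2 * (R + a)" using v(4) fe(2) by simp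
    have hk: "kothe_ennnorm \<Phi> N (\<lambda>t. complex_of_real (h t + e t)) \<le> ennreal (1 + b)"
      using order_trans[OF kothe_ennnorm_add_le[OF h(1) em h(2) e0] add_mono[OF h(3) eq_refl[OF eb]]] b
      by simp
    have he: "(\<lambda>t. h t + e t) \<in> vector_valued (kothe_dual \<Phi> N)"
      using hk h(2) e0 by (auto simp: vector_valued_kothe_iff strongly_measurable_iff_borel intro: le_less_trans)
    have heN: "vector_norm (kothe_norm \<Phi> N) (\<lambda>t. h t + e t) \<le> 1 + b"
      using ennreal_vector_norm_kothe[OF he] hk h(2) e0 b by (simp flip: ennreal_le_iff)
    obtain u where u: "u \<in> vector_valued (kothe_dual \<Phi> N)" "A1_bound C' u" "AE t in lebesgue. h t + e t \<le> u t"
      "vector_norm (kothe_norm \<Phi> N) u \<le> 2 * vector_norm (kothe_norm \<Phi> N) (\<lambda>t. h t + e t)"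
      using C'(2)[OF he] h(2) e0 by (meson add_nonneg_nonneg)
    have vu [measurable]: "v \<in> borel_measurable lebesgue" "u \<in> borel_measurable lebesgue"
      and v0: "\<And>t. 0 \<le> v t" and u0: "\<And>t. 0 \<le> u t" using v(2) u(2) by (auto simp: A1_bound_def)
    have vpos: "AE t in lebesgue. 0 < v t"
      by (rule e_nz[OF v(2)]) (use v(3) in eventually_elim, use f(2) in \<open>meson le_add_same_cancel2 order_trans\<close>)
    have upos: "AE t in lebesgue. 0 < u t"
      by (rule e_nz[OF u(2)]) (use u(3) in eventually_elim, use h(2) in \<open>meson le_add_same_cancel2 order_trans\<close>)
    have "(\<integral>\<^sup>+t. ennreal (norm (v t) * norm (u t)) \<partial>lebesgue) \<le>
        ennreal (2 * (R + a)) * kothe_ennnorm \<Phi> N (\<lambda>t. complex_of_real (norm (u t)))"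
      by (rule kothe_pairing[OF v(1) vN _ vu(2)]) (use a f(4) in simp)
    also have "\<dots> = ennreal (2 * (R + a)) * ennreal (vector_norm (kothe_norm \<Phi> N) u)"
      by (simp add: ennreal_vector_norm_kothe[OF u(1)])
    also have "\<dots> \<le> ennreal (2 * (R + a)) * ennreal (2 * (1 + b))"
      using u(4) heN by (intro mult_left_mono ennreal_leI) auto
    also have "\<dots> = ennreal (D R)" using a b f(4) by (simp add: D_def ennreal_mult)
    finally have vuD: "(\<integral>\<^sup>+t. ennreal (v t * u t) \<partial>lebesgue) \<le> ennreal (D R)" using v0 u0 by simp
    \<comment> \<open>The exponents are arranged so that v^p w = v u; as f <= v, the integral of f^p
      w is then at most that of v u.\<close>
    define w where "w t = v t powr (1 - p) * u t" for t
    have w: "w \<in> Ap p" "Ap_const p w \<le> ennreal (C powr (p - 1) * C')"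
      using Ap_of_A1[OF p v(2) vpos u(2) upos C(1) C'(1)] by (simp_all add: w_def[abs_def])
    have wm [measurable]: "w \<in> borel_measurable lebesgue" by (rule Ap_borel[OF w(1)])
    have "power_integral p w f \<le> (\<integral>\<^sup>+t. ennreal (v t * u t) \<partial>lebesgue)"
      unfolding power_integral_def
    proof (rule nn_integral_mono_AE)
      show "AE t in lebesgue. ennreal (norm (f t) powr p) * ennreal (w t) \<le> ennreal (v t * u t)"
        using v(3) vpos
      proof eventually_elim
        case (elim t)
        have "norm (f t) powr p \<le> v t powr p" using elim(1) f(2)[of t] e0[of t] p by (intro powr_mono2) auto
        then have "norm (f t) powr p * (v t powr (1 - p) * u t) \<le> v t powr p * (v t powr (1 - p) * u t)"
          using u0 by (intro mult_right_mono) auto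
        also have "\<dots> = v t * u t" using elim(2) by (simp add: mult.assoc[symmetric] flip: powr_add)
        finally show ?case using u0[of t] by (simp add: w_def ennreal_leI flip: ennreal_mult)
      qed
    qed
    also note vuD
    finally have fw: "power_integral p w f \<le> ennreal (D R)" .
    have "(\<integral>\<^sup>+t. ennreal (g t * h t) \<partial>lebesgue) \<le> power_integral p w g + ennreal (D R)"
      if g: "g \<in> borel_measurable lebesgue" "\<And>t. 0 \<le> g t" for g
    proof -
      note g(1)[measurable]
      have "(\<integral>\<^sup>+t. ennreal (g t * h t) \<partial>lebesgue) \<le>
          (\<integral>\<^sup>+t. ennreal (norm (g t) powr p) * ennreal (w t) + ennreal (v t * u t) \<partial>lebesgue)"
      proof (rule nn_integral_mono_AE)
        show "AE t in lebesgue. ennreal (g t * h t) \<le> ennreal (norm (g t) powr p) * ennreal (w t) + ennreal (v t * u t)"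
          using u(3) vpos
        proof eventually_elim
          case (elim t)
          have "g t * h t \<le> g t * u t" using elim(1) e0[of t] g(2)[of t] by (intro mult_left_mono) auto
          \<comment> \<open>Writing g as (g / v) v brings in the measure v u dt. In x <= x^p + 1
            with x = g / v, the power gives g^p w and the 1 costs just the integral of v u.\<close>
          also have "\<dots> = g t / v t * (v t * u t)" using elim(2) by simp
          also have "\<dots> \<le> ((g t / v t) powr p + 1) * (v t * u t)"
            using g(2)[of t] elim(2) p u0[of t] by (intro mult_right_mono le_powr_add_one) auto
          also have "\<dots> = (g t / v t) powr p * v t * u t + v t * u t" by (simp add: algebra_simps)
          also have "(g t / v t) powr p * v t = g t powr p * v t powr (1 - p)"
            using g(2)[of t] elim(2) by (simp add: powr_divide powr_diff)
          finally have "g t * h t \<le> norm (g t) powr p * w t + v t * u t"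
            using g(2)[of t] by (simp add: w_def mult.assoc)
          moreover have "0 \<le> w t" using u0[of t] by (simp add: w_def)
          ultimately show ?case
            using u0[of t] v0[of t] by (simp add: ennreal_leI flip: ennreal_mult ennreal_plus)
        qed
      qed
      also have "\<dots> = power_integral p w g + (\<integral>\<^sup>+t. ennreal (v t * u t) \<partial>lebesgue)"
        unfolding power_integral_def by (rule nn_integral_add) measurable
      also have "\<dots> \<le> power_integral p w g + ennreal (D R)" by (intro add_left_mono vuD)
      finally show ?thesis .
    qed
    with w fw show "\<exists>w\<in>Ap p. Ap_const p w \<le> ennreal (C powr (p - 1) * C') \<and> controls p w (D R) f h"
      unfolding controls_def by blast
  qed
qed

lemma vector_valued_norm_in:
  assumes "f \<in> vector_valued \<Phi>"
  shows "(\<lambda>t. norm (f t)) \<in> vector_valued \<Phi>" "vector_norm N (\<lambda>t. norm (f t)) = vector_norm N f"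
  using assms strongly_measurable_norm[of f]
  by (auto simp: vector_valued_def vector_norm_def strongly_measurable_iff_borel)

lemma power_integral_norm: "power_integral p w (\<lambda>t. norm (f t)) = power_integral p w f"
  by (rule power_integral_cong_norm) simp

lemma vector_valued_subset_Ap_union:
  assumes M: "maximal_bounded_on \<Phi> N" and M': "maximal_bounded_on (kothe_dual \<Phi> N) (kothe_norm \<Phi> N)"
    and p: "1 < p"
  shows "(vector_valued \<Phi> :: (real \<Rightarrow> 'x::real_normed_vector) set) \<subseteq> (\<Union>w\<in>Ap p. Lpw p w)"
proof
  fix f :: "real \<Rightarrow> 'x" assume f: "f \<in> vector_valued \<Phi>"
  obtain c and D :: "real \<Rightarrow> real" where D: "\<And>R. 0 \<le> R \<Longrightarrow> 0 < D R" and
    cD: "\<And>(f :: real \<Rightarrow> real) h R. f \<in> vector_valued \<Phi> \<Longrightarrow> (\<And>t. 0 \<le> f t) \<Longrightarrow> vector_norm N f \<le> R \<Longrightarrow> 0 \<le> R \<Longrightarrow>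
      h \<in> borel_measurable lebesgue \<Longrightarrow> (\<And>t. 0 \<le> h t) \<Longrightarrow>
      kothe_ennnorm \<Phi> N (\<lambda>t. complex_of_real (h t)) \<le> 1 \<Longrightarrow>
      \<exists>w\<in>Ap p. Ap_const p w \<le> ennreal c \<and> controls p w (D R) f h"
    by (rule extrapolation_weight[OF M M' p]) blast
  \<comment> \<open>With h = 0 the construction still supplies an A_p weight, and its first clause
    puts f into the weighted space.\<close>
  have "kothe_ennnorm \<Phi> N (\<lambda>t. complex_of_real 0) \<le> 1"
    unfolding kothe_ennnorm_def by (rule SUP_least) simp
  then obtain w where "w \<in> Ap p" "power_integral p w (\<lambda>t. norm (f t)) \<le> ennreal (D (vector_norm N f))"
    using cD[of "\<lambda>t. norm (f t)" "vector_norm N f" "\<lambda>_. 0", OF vector_valued_norm_in(1)[OF f] norm_ge_zero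
        eq_refl[OF vector_valued_norm_in(2)[OF f]] vector_norm_nonneg[OF f]] by (auto simp: controls_def)
  then have "w \<in> Ap p" "power_integral p w f < \<infinity>"
    by (auto simp: power_integral_norm intro: le_less_trans)
  moreover have "strongly_measurable f" using f by (simp add: vector_valued_def)
  ultimately show "f \<in> (\<Union>w\<in>Ap p. Lpw p w)" by (auto simp: Lpw_iff)
qed

text \<open>The order of the quantifiers matters: c is obtained before the operator and K, so that
  the uniform hypothesis can be invoked for the family of all weights with constant at most c. The
  bound depends on R without being proportional to it, because the estimate in
  \<open>controls\<close> is inhomogeneous.\<close>

lemma extension_bounded:
  assumes M: "maximal_bounded_on \<Phi> N" and M': "maximal_bounded_on (kothe_dual \<Phi> N) (kothe_norm \<Phi> N)"
    and p: "1 < p"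
  obtains c :: real and B :: "real \<Rightarrow> real \<Rightarrow> real" where
    "\<And>T :: (real \<Rightarrow> 'x::complex_banach) \<Rightarrow> (real \<Rightarrow> complex) \<Rightarrow> 'y::complex_banach. \<And>K f R.
      weighted_operator p T \<Longrightarrow> 0 \<le> K \<Longrightarrow>
      (\<And>w. w \<in> Ap p \<Longrightarrow> Ap_const p w \<le> ennreal c \<Longrightarrow> Lpw_operator_norm p w T \<le> ennreal K) \<Longrightarrow>
      f \<in> vector_valued \<Phi> \<Longrightarrow> vector_norm N f \<le> R \<Longrightarrow> 0 \<le> R \<Longrightarrow>
      weighted_operator.extension p T f \<in> vector_valued \<Phi> \<and>
      vector_norm N (weighted_operator.extension p T f) \<le> B K R"
proof -
  obtain c and D :: "real \<Rightarrow> real" where D: "\<And>R. 0 \<le> R \<Longrightarrow> 0 < D R" and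
    cD: "\<And>(f :: real \<Rightarrow> real) h R. f \<in> vector_valued \<Phi> \<Longrightarrow> (\<And>t. 0 \<le> f t) \<Longrightarrow> vector_norm N f \<le> R \<Longrightarrow> 0 \<le> R \<Longrightarrow>
      h \<in> borel_measurable lebesgue \<Longrightarrow> (\<And>t. 0 \<le> h t) \<Longrightarrow>
      kothe_ennnorm \<Phi> N (\<lambda>t. complex_of_real (h t)) \<le> 1 \<Longrightarrow>
      \<exists>w\<in>Ap p. Ap_const p w \<le> ennreal c \<and> controls p w (D R) f h"
    by (rule extrapolation_weight[OF M M' p]) blast
  define L where "L K = 2 powr p * (K powr p * 2 powr p)" for K
  have L0: "0 \<le> L K" for K by (simp add: L_def)
  show thesis
  proof (rule that[of c "\<lambda>K R. L K * D R + D R"])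
    fix T :: "(real \<Rightarrow> 'x) \<Rightarrow> (real \<Rightarrow> complex) \<Rightarrow> 'y" and K R and f :: "real \<Rightarrow> 'x"
    assume T: "weighted_operator p T" and K: "0 \<le> K"
      "\<And>w. w \<in> Ap p \<Longrightarrow> Ap_const p w \<le> ennreal c \<Longrightarrow> Lpw_operator_norm p w T \<le> ennreal K"
      and f: "f \<in> vector_valued \<Phi>" "vector_norm N f \<le> R" "0 \<le> R"
    interpret weighted_operator p T by (rule T)
    have "f \<in> (\<Union>w\<in>Ap p. Lpw p w)" using vector_valued_subset_Ap_union[OF M M' p] f(1) by blast
    then obtain w0 where "w0 \<in> Ap p" "extension_rel w0 f (extension f)" by (rule extension_obtains)
    then have gm: "strongly_measurable (extension f)" by (auto simp: Lpw_iff dest: extension_rel_Lpw)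
    have fN: "vector_norm N (\<lambda>t. norm (f t)) \<le> R" using f(2) vector_valued_norm_in(2)[OF f(1)] by simp
    have fm: "strongly_measurable f" using f(1) by (simp add: vector_valued_def)
    have pos: "0 < L K * D R + D R" using L0[of K] D[OF f(3)] by (simp add: add_nonneg_pos)
    \<comment> \<open>The weight depends on h, but the function being estimated does not; its A_p
      constant stays below c, so the same K applies for every h.\<close>
    have dual: "(\<integral>\<^sup>+t. ennreal (norm (extension f t) * h t) \<partial>lebesgue) \<le> ennreal (L K * D R + D R)"
      if h: "h \<in> borel_measurable lebesgue" "\<And>t. 0 \<le> h t" "kothe_ennnorm \<Phi> N (\<lambda>t. complex_of_real (h t)) \<le> 1"
      for h :: "real \<Rightarrow> real"
    proof -
      obtain w where w: "w \<in> Ap p" "Ap_const p w \<le> ennreal c"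
        "power_integral p w (\<lambda>t. norm (f t)) \<le> ennreal (D R)"
        "\<And>g :: real \<Rightarrow> real. g \<in> borel_measurable lebesgue \<Longrightarrow> (\<And>t. 0 \<le> g t) \<Longrightarrow>
           (\<integral>\<^sup>+t. ennreal (g t * h t) \<partial>lebesgue) \<le> power_integral p w g + ennreal (D R)"
        using cD[of "\<lambda>t. norm (f t)" R h, OF vector_valued_norm_in(1)[OF f(1)] norm_ge_zero fN f(3) h]
        unfolding controls_def by blast
      have fw: "power_integral p w f \<le> ennreal (D R)" using w(3) by (simp add: power_integral_norm)
      then have "f \<in> Lpw p w" using fm by (auto simp: Lpw_iff intro: le_less_trans)
      from extension_rel_bound[OF w(1) K(2)[OF w(1,2)] K(1) extension_Lpw[OF w(1) this]]
      have "power_integral p w (extension f) \<le> ennreal (L K) * power_integral p w f" by (simp add: L_def)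
      also have "\<dots> \<le> ennreal (L K) * ennreal (D R)" by (rule mult_left_mono[OF fw]) simp
      finally have gw: "power_integral p w (extension f) \<le> ennreal (L K * D R)"
        using L0[of K] D[OF f(3)] by (simp add: ennreal_mult)
      have "(\<integral>\<^sup>+t. ennreal (norm (extension f t) * h t) \<partial>lebesgue) \<le>
          power_integral p w (\<lambda>t. norm (extension f t)) + ennreal (D R)"
        by (rule w(4)[OF strongly_measurable_norm[OF gm]]) simp
      also have "\<dots> \<le> ennreal (L K * D R) + ennreal (D R)"
        unfolding power_integral_norm by (rule add_right_mono[OF gw])
      also have "\<dots> = ennreal (L K * D R + D R)"
        using L0[of K] D[OF f(3)] by (simp add: ennreal_plus)
      finally show ?thesis .
    qed
    show "extension f \<in> vector_valued \<Phi> \<and> vector_norm N (extension f) \<le> L K * D R + D R"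
      using vector_valued_by_duality[OF interval_indicator_in[OF M] gm pos dual] by blast
  qed
qed

end

lemma linear_operator_restrict:
  assumes L: "linear_operator U W L" and V: "V \<subseteq> U" and range: "\<And>f. f \<in> V \<Longrightarrow> L f \<in> W'"
  shows "linear_operator V W' L"
proof -
  have "f \<in> U" if "f \<in> V" for f using V that by blast
  with L range show ?thesis unfolding linear_operator_def by (intro conjI ballI allI impI) simp_all
qed

theorem theorem3p1:
  fixes \<Phi> :: "(real \<Rightarrow> complex) set" and N :: "(real \<Rightarrow> complex) \<Rightarrow> real"
  assumes "banach_function_space \<Phi> N"
    and "maximal_bounded_on \<Phi> N"
    and "maximal_bounded_on (kothe_dual \<Phi> N) (kothe_norm \<Phi> N)"
  shows
    "(\<forall>p>1. (vector_valued \<Phi> :: (real \<Rightarrow> 'a::banach) set) \<subseteq> (\<Union>w\<in>Ap p. Lpw p w)) \<and>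
     (\<forall>p>1. \<forall>(J :: 'j set)
        (T :: 'j \<Rightarrow> (real \<Rightarrow> 'x::complex_banach) \<Rightarrow> (real \<Rightarrow> complex) \<Rightarrow> 'y::complex_banach).
        (\<forall>j\<in>J. schwartz_operator (T j)) \<longrightarrow>
        (\<forall>\<W>. \<W> \<subseteq> Ap p \<longrightarrow> (SUP w\<in>\<W>. Ap_const p w) < \<infinity> \<longrightarrow>
           (SUP w\<in>\<W>. SUP j\<in>J. Lpw_operator_norm p w (T j)) < \<infinity>) \<longrightarrow>
        (let U = (\<Union>w\<in>Ap p. Lpw p w) :: (real \<Rightarrow> 'x) set in
           fun_subspace U \<and> U \<subseteq> L1_loc \<and>
           (\<exists>\<T> :: 'j \<Rightarrow> (real \<Rightarrow> 'x) \<Rightarrow> (real \<Rightarrow> 'y).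
              (\<forall>j\<in>J. linear_operator U L1_loc (\<T> j) \<and>
                 extends_schwartz_operator (T j) U (\<T> j) \<and>
                 vector_valued \<Phi> \<subseteq> U \<and> \<T> j \<in> bounded_operators \<Phi> N) \<and>
              (SUP j\<in>J. operator_norm \<Phi> N (\<T> j)) < \<infinity>)))"
proof (intro conjI allI impI)
  interpret banach_function_space \<Phi> N by (rule assms(1))
  note M = assms(2,3)
  show "(vector_valued \<Phi> :: (real \<Rightarrow> 'a) set) \<subseteq> (\<Union>w\<in>Ap p. Lpw p w)" if "1 < p" for p
    by (rule vector_valued_subset_Ap_union[OF M that])
  fix p :: real and J :: "'j set" and T :: "'j \<Rightarrow> (real \<Rightarrow> 'x) \<Rightarrow> (real \<Rightarrow> complex) \<Rightarrow> 'y"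
  assume p: "1 < p" and T: "\<forall>j\<in>J. schwartz_operator (T j)"
    and unif: "\<forall>\<W>. \<W> \<subseteq> Ap p \<longrightarrow> (SUP w\<in>\<W>. Ap_const p w) < \<infinity> \<longrightarrow>
           (SUP w\<in>\<W>. SUP j\<in>J. Lpw_operator_norm p w (T j)) < \<infinity>"
  let ?U = "(\<Union>w\<in>Ap p. Lpw p w) :: (real \<Rightarrow> 'x) set"
  obtain c :: real and B :: "real \<Rightarrow> real \<Rightarrow> real" where cB:
    "\<And>T :: (real \<Rightarrow> 'x) \<Rightarrow> (real \<Rightarrow> complex) \<Rightarrow> 'y. \<And>K f R.
      weighted_operator p T \<Longrightarrow> 0 \<le> K \<Longrightarrow>
      (\<And>w. w \<in> Ap p \<Longrightarrow> Ap_const p w \<le> ennreal c \<Longrightarrow> Lpw_operator_norm p w T \<le> ennreal K) \<Longrightarrow>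
      f \<in> vector_valued \<Phi> \<Longrightarrow> vector_norm N f \<le> R \<Longrightarrow> 0 \<le> R \<Longrightarrow>
      weighted_operator.extension p T f \<in> vector_valued \<Phi> \<and>
      vector_norm N (weighted_operator.extension p T f) \<le> B K R"
    by (rule extension_bounded[OF M p]) blast
  \<comment> \<open>All weights that the extrapolation can produce satisfy this bound; the uniform
    hypothesis for this one family supplies K.\<close>
  define \<W> where "\<W> = {w \<in> Ap p. Ap_const p w \<le> ennreal c}"
  have "(SUP w\<in>\<W>. Ap_const p w) \<le> ennreal c" by (rule SUP_least) (simp add: \<W>_def)
  then have "(SUP w\<in>\<W>. Ap_const p w) < \<infinity>" by (rule le_less_trans) simp
  then have "(SUP w\<in>\<W>. SUP j\<in>J. Lpw_operator_norm p w (T j)) < \<infinity>"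
    using unif[rule_format, of \<W>] by (auto simp: \<W>_def)
  then obtain K where K: "0 \<le> K" "(SUP w\<in>\<W>. SUP j\<in>J. Lpw_operator_norm p w (T j)) = ennreal K"
    by (cases "SUP w\<in>\<W>. SUP j\<in>J. Lpw_operator_norm p w (T j)") auto
  have TK: "Lpw_operator_norm p w (T j) \<le> ennreal K"
    if "j \<in> J" "w \<in> Ap p" "Ap_const p w \<le> ennreal c" for j w
  proof -
    have "Lpw_operator_norm p w (T j) \<le> (SUP j\<in>J. Lpw_operator_norm p w (T j))" by (rule SUP_upper[OF that(1)])
    also have "\<dots> \<le> (SUP w\<in>\<W>. SUP j\<in>J. Lpw_operator_norm p w (T j))"
      by (rule SUP_upper) (use that in \<open>simp add: \<W>_def\<close>)
    finally show ?thesis using K(2) by simp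
  qed
  have WO: "weighted_operator p (T j)" if j: "j \<in> J" for j
  proof
    show "1 < p" by (rule p)
    show "schwartz_operator (T j)" using T j by blast
    fix w assume w: "w \<in> Ap p"
    \<comment> \<open>The hypothesis for a singleton family gives finiteness for an arbitrary A_p
      weight, including those with constant above c.\<close>
    then have "(SUP w\<in>{w}. SUP j\<in>J. Lpw_operator_norm p w (T j)) < \<infinity>"
      by (intro unif[rule_format]) (auto simp: Ap_def)
    then have "(SUP j\<in>J. Lpw_operator_norm p w (T j)) < \<infinity>" by simp
    then show "Lpw_operator_norm p w (T j) < \<infinity>" by (rule le_less_trans[OF SUP_upper[OF j]])
  qed
  define E where "E j = weighted_operator.extension p (T j)" for j
  have E: "E j f \<in> vector_valued \<Phi> \<and> vector_norm N (E j f) \<le> B K R"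
    if "j \<in> J" "f \<in> vector_valued \<Phi>" "vector_norm N f \<le> R" "0 \<le> R" for j f R
    unfolding E_def by (rule cB[OF WO[OF that(1)] K(1) TK[OF that(1)] that(2-4)])
  have norm_le: "operator_norm \<Phi> N (E j) \<le> ennreal (B K 1)" if j: "j \<in> J" for j
    unfolding operator_norm_def by (rule SUP_least) (use E[OF j, of _ 1] in \<open>auto intro: ennreal_leI\<close>)
  have sub: "(vector_valued \<Phi> :: (real \<Rightarrow> 'x) set) \<subseteq> ?U" by (rule vector_valued_subset_Ap_union[OF M p])
  have lin: "linear_operator ?U L1_loc (E j)" if "j \<in> J" for j
    unfolding E_def by (rule weighted_operator.extension_linear[OF WO[OF that]])
  have bounded: "E j \<in> bounded_operators \<Phi> N" if j: "j \<in> J" for j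
  proof -
    have "linear_operator (vector_valued \<Phi>) (vector_valued \<Phi>) (E j)"
    proof (rule linear_operator_restrict[OF lin[OF j] sub])
      \<comment> \<open>Here R is the norm of f itself: membership is needed for all f, whereas the
        norm bound above uses R = 1.\<close>
      show "E j f \<in> vector_valued \<Phi>" if "f \<in> vector_valued \<Phi>" for f
        using E[OF j that order_refl vector_norm_nonneg[OF that]] by blast
    qed
    with norm_le[OF j] show ?thesis by (auto simp: bounded_operators_def intro: le_less_trans)
  qed
  have "(SUP j\<in>J. operator_norm \<Phi> N (E j)) < \<infinity>"
    by (rule le_less_trans[OF SUP_least[OF norm_le]]) simp_all
  moreover have "\<forall>j\<in>J. linear_operator ?U L1_loc (E j) \<and> extends_schwartz_operator (T j) ?U (E j) \<and>
      vector_valued \<Phi> \<subseteq> ?U \<and> E j \<in> bounded_operators \<Phi> N"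
    using lin sub bounded weighted_operator.extension_extends[OF WO] by (simp add: E_def)
  moreover have "?U \<subseteq> L1_loc" using Lpw_subset_L1_loc[OF p] by blast
  ultimately show "let U = ?U in
           fun_subspace U \<and> U \<subseteq> L1_loc \<and>
           (\<exists>\<T> :: 'j \<Rightarrow> (real \<Rightarrow> 'x) \<Rightarrow> (real \<Rightarrow> 'y).
              (\<forall>j\<in>J. linear_operator U L1_loc (\<T> j) \<and>
                 extends_schwartz_operator (T j) U (\<T> j) \<and>
                 vector_valued \<Phi> \<subseteq> U \<and> \<T> j \<in> bounded_operators \<Phi> N) \<and>
              (SUP j\<in>J. operator_norm \<Phi> N (\<T> j)) < \<infinity>)"
    unfolding Let_def using fun_subspace_Ap_union[OF p] by (intro conjI exI[of _ E])
qed

end
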